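(* (The existence of two-mode water waves.) Let $g,h,B,\sigma>0$, $A\in\mathbb{R}$, $\alpha\in(0,1)$, let $n\ne m$ be positive integers, and let $F(\lambda,\beta,(\mu,w))$, $X$, $Y$, $T_k$, $\lambda^*_{n,\pm}$ and $\beta^*_{\pm}$ be as in the context. Let $\beta^*\in\{\beta^*_\pm\}$ and $\lambda^*\in\{\lambda^*_{n,\pm}\}$ (evaluated at $\beta=\beta^*$). Then there exists a smooth solution curve $$\{(\lambda(s),\beta(s),(\mu(s),w(s))): s\in(-\delta,\delta)\}$$ of the problem $F(\lambda,\beta,(\mu,w))=0$ with $(\lambda(0),\beta(0),(\mu(0),w(0)))=(\lambda^*,\beta^*,(0,0))$, where $\delta>0$ is small enough. More precisely, $$F(\lambda(s),\beta(s),(\mu(s),w(s)))=0,$$ where $$w(s)=s\,(a\cos(nx)+b\cos(mx))+O(s^2)\quad\text{for } a^2+b^2=1.$$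
   Context: For a $2\pi$-periodic function $f$, $[f]$ denotes its mean over one period. For $u\in L^2_{2\pi}$ with $[u]=0$ and Fourier expansion $u(x)=\sum_{k\ge1}a_k\cos(kx)+\sum_{k\ge1}b_k\sin(kx)$, the periodic Hilbert transform for the strip of depth $h$ is $$\mathcal{C}_h(u)(x)=\sum_{k\ge1}a_k\coth(kh)\sin(kx)-\sum_{k\ge1}b_k\coth(kh)\cos(kx).$$ $C^{k,\alpha}_{2\pi,e}(\mathbb{R})$ is the space of even, $2\pi$-periodic $C^{k,\alpha}$ functions. Put $X=\{w\in C^{2,\alpha}_{2\pi,e}(\mathbb{R}):[w]=0\}$ and $Y=C^{0,\alpha}_{2\pi,e}(\mathbb{R})$. For $\lambda,\beta,\mu\in\mathbb{R}$ and $w\in X$ (with $(1+\mathcal{C}_h(w'))^2+w'^2\neq0$ everywhere) define $$F(\lambda,\beta,(\mu,w))=\Big(\lambda-\beta\big(\tfrac{[w^2]}{2h}-w+\mathcal{C}_h(ww')-w\,\mathcal{C}_h(w')\big)-\tfrac{gA}{2}\big(\tfrac{[w^3]}{3h}-[w^2]-w^2-2hw+\mathcal{C}_h(w^2w')-w^2\mathcal{C}_h(w')+2h\,\mathcal{C}_h(ww')-2hw\,\mathcal{C}_h(w')\big)\Big)^2$$ $$-(\lambda^2+\mu-2gBw)\big(w'^2+(1+\mathcal{C}_h(w'))^2\big)-2\sigma\,\frac{w''+\mathcal{C}_h(w')w''-w'\mathcal{C}_h(w'')}{\big((1+\mathcal{C}_h(w'))^2+w'^2\big)^{1/2}}\in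 Y.$$ One has $F(\lambda,\beta,(0,0))=0$ for all $\lambda,\beta\in\mathbb{R}$. Solution curves are understood in $\mathbb{R}\times\mathbb{R}\times(\mathbb{R}\times X)$. For integers $k\ge1$ set $T_k=\tanh(kh)/k$ and, depending on $\beta$, $$\lambda_{k,\pm}^*=\frac{\beta+Agh}{2}T_k\pm\sqrt{\frac{(\beta+Agh)^2}{4}T_k^2+(gB+\sigma k^2)T_k}.$$ For positive integers $n\neq m$ set $$\beta_{n,m}=\frac{\big((gB+\sigma n^2)T_n-(gB+\sigma m^2)T_m\big)^2}{\sigma T_nT_m(T_n-T_m)(m^2-n^2)},\qquad \beta^*_\pm=-Agh\pm\sqrt{\beta_{n,m}}.$$
   Formalization: Corrected: proved for each given (a,b) with a²+b²=1 under added conditions: if b≠0, λ* is also one of λ*_{m,±}; if b=0, λ* is not one of λ*_{2n,±}; if a=0, λ* is not one of λ*_{2m,±}. Without them the claim fails in general. *)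

theory Defs
  imports "HOL-Analysis.Analysis" "HOL-Library.Landau_Symbols"
begin

section \<open>Even periodic Hoelder spaces\<close>

definition holder_continuous :: "real \<Rightarrow> (real \<Rightarrow> real) \<Rightarrow> bool" where
  "holder_continuous \<alpha> f \<longleftrightarrow> (\<exists>C. \<forall>x y. \<bar>f x - f y\<bar> \<le> C * \<bar>x - y\<bar> powr \<alpha>)"

text \<open>No boundedness is imposed: for periodic functions it is automatic.\<close>

definition holder_space :: "nat \<Rightarrow> real \<Rightarrow> (real \<Rightarrow> real) set" where
  "holder_space k \<alpha> =
     {f. (\<forall>j<k. \<forall>x. (deriv ^^ j) f differentiable (at x)) \<and> holder_continuous \<alpha> ((deriv ^^ k) f)}"

definition even_periodic_holder :: "nat \<Rightarrow> real \<Rightarrow> (real \<Rightarrow> real) set" where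
  "even_periodic_holder k \<alpha> =
     {f \<in> holder_space k \<alpha>. (\<forall>x. f (- x) = f x) \<and> (\<forall>x. f (x + 2 * pi) = f x)}"

text \<open>The suprema below are those of bounded sets whenever the function belongs to
  \<^term>\<open>even_periodic_holder k \<alpha>\<close>; the norm is meaningful only there.\<close>

definition holder_seminorm :: "real \<Rightarrow> (real \<Rightarrow> real) \<Rightarrow> real" where
  "holder_seminorm \<alpha> f = (SUP (x, y) \<in> {(x, y). x \<noteq> y}. \<bar>f x - f y\<bar> / \<bar>x - y\<bar> powr \<alpha>)"

definition holder_norm :: "nat \<Rightarrow> real \<Rightarrow> (real \<Rightarrow> real) \<Rightarrow> real" where
  "holder_norm k \<alpha> f =
     (\<Sum>j\<le>k. SUP x. \<bar>(deriv ^^ j) f x\<bar>) + holder_seminorm \<alpha> ((deriv ^^ k) f)"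

definition mean :: "(real \<Rightarrow> real) \<Rightarrow> real" where
  "mean f = integral {-pi..pi} f / (2 * pi)"

definition space_X :: "real \<Rightarrow> (real \<Rightarrow> real) set" where
  "space_X \<alpha> = {w \<in> even_periodic_holder 2 \<alpha>. mean w = 0}"

section \<open>Smooth curves\<close>

definition smooth_on :: "real set \<Rightarrow> (real \<Rightarrow> real) \<Rightarrow> bool" where
  "smooth_on I f \<longleftrightarrow> (\<forall>j. \<forall>s\<in>I. (deriv ^^ j) f differentiable (at s))"

text \<open>Infinite differentiability of a curve into \<^term>\<open>space_X \<alpha>\<close> with respect to its
  \<open>C\<^sup>2\<^sup>,\<^sup>\<alpha>\<close> norm; \<open>W j\<close> is the \<open>j\<close>-th derivative of the curve. To be used with an open set of
  parameters.\<close>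

definition smooth_X_curve_on :: "real \<Rightarrow> real set \<Rightarrow> (real \<Rightarrow> real \<Rightarrow> real) \<Rightarrow> bool" where
  "smooth_X_curve_on \<alpha> I w \<longleftrightarrow>
     (\<exists>W :: nat \<Rightarrow> real \<Rightarrow> real \<Rightarrow> real.
        (\<forall>s\<in>I. W 0 s = w s) \<and>
        (\<forall>j. \<forall>s\<in>I. W j s \<in> space_X \<alpha> \<and>
           ((\<lambda>t. holder_norm 2 \<alpha> (\<lambda>x. (W j t x - W j s x) / (t - s) - W (Suc j) s x))
              \<longlongrightarrow> 0) (at s)))"

section \<open>The periodic Hilbert transform for the strip of depth \<open>h\<close>\<close>

definition coth :: "real \<Rightarrow> real" where
  "coth x = cosh x / sinh x"

definition fourier_cos :: "(real \<Rightarrow> real) \<Rightarrow> nat \<Rightarrow> real" where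
  "fourier_cos u k = integral {-pi..pi} (\<lambda>x. u x * cos (real k * x)) / pi"

definition fourier_sin :: "(real \<Rightarrow> real) \<Rightarrow> nat \<Rightarrow> real" where
  "fourier_sin u k = integral {-pi..pi} (\<lambda>x. u x * sin (real k * x)) / pi"

text \<open>The series are summed pointwise. They converge everywhere if \<open>u\<close> is periodic and Hoelder
  continuous, the sum being the continuous representative of the transform of \<open>u\<close>. This covers
  every argument to which the transform is applied below.\<close>

definition hilbert_strip :: "real \<Rightarrow> (real \<Rightarrow> real) \<Rightarrow> real \<Rightarrow> real" where
  "hilbert_strip h u x =
     (\<Sum>i. fourier_cos u (Suc i) * coth (real (Suc i) * h) * sin (real (Suc i) * x))
   - (\<Sum>i. fourier_sin u (Suc i) * coth (real (Suc i) * h) * cos (real (Suc i) * x))"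

section \<open>The nonlinear operator\<close>

definition nondegenerate :: "real \<Rightarrow> (real \<Rightarrow> real) \<Rightarrow> bool" where
  "nondegenerate h w \<longleftrightarrow> (\<forall>x. (1 + hilbert_strip h (deriv w) x)\<^sup>2 + (deriv w x)\<^sup>2 \<noteq> 0)"

text \<open>The operator \<open>F\<close> is meant for \<open>w\<close> in \<^term>\<open>space_X \<alpha>\<close> with \<^term>\<open>nondegenerate h w\<close>.\<close>

definition F_op ::
  "real \<Rightarrow> real \<Rightarrow> real \<Rightarrow> real \<Rightarrow> real \<Rightarrow> real \<Rightarrow> real \<Rightarrow> real \<times> (real \<Rightarrow> real) \<Rightarrow> real \<Rightarrow> real" where
  "F_op g h A B \<sigma> lam \<beta> = (\<lambda>(\<mu>, w) x.
     (let C = hilbert_strip h; w' = deriv w; w'' = deriv (deriv w) in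
       (lam
        - \<beta> * (mean (\<lambda>y. w y ^ 2) / (2 * h) - w x + C (\<lambda>y. w y * w' y) x - w x * C w' x)
        - g * A / 2 *
            (mean (\<lambda>y. w y ^ 3) / (3 * h) - mean (\<lambda>y. w y ^ 2) - w x ^ 2 - 2 * h * w x
             + C (\<lambda>y. w y ^ 2 * w' y) x - w x ^ 2 * C w' x
             + 2 * h * C (\<lambda>y. w y * w' y) x - 2 * h * w x * C w' x))\<^sup>2
       - (lam\<^sup>2 + \<mu> - 2 * g * B * w x) * ((w' x)\<^sup>2 + (1 + C w' x)\<^sup>2)
       - 2 * \<sigma> * ((w'' x + C w' x * w'' x - w' x * C w'' x)
                    / sqrt ((1 + C w' x)\<^sup>2 + (w' x)\<^sup>2))))"

section \<open>Critical parameters\<close>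

definition Tk :: "real \<Rightarrow> nat \<Rightarrow> real" where
  "Tk h k = tanh (real k * h) / real k"

definition lambda_plus :: "real \<Rightarrow> real \<Rightarrow> real \<Rightarrow> real \<Rightarrow> real \<Rightarrow> real \<Rightarrow> nat \<Rightarrow> real" where
  "lambda_plus g h A B \<sigma> \<beta> k =
     (\<beta> + A * g * h) / 2 * Tk h k
     + sqrt ((\<beta> + A * g * h)\<^sup>2 / 4 * (Tk h k)\<^sup>2 + (g * B + \<sigma> * (real k)\<^sup>2) * Tk h k)"

definition lambda_minus :: "real \<Rightarrow> real \<Rightarrow> real \<Rightarrow> real \<Rightarrow> real \<Rightarrow> real \<Rightarrow> nat \<Rightarrow> real" where
  "lambda_minus g h A B \<sigma> \<beta> k =
     (\<beta> + A * g * h) / 2 * Tk h k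
     - sqrt ((\<beta> + A * g * h)\<^sup>2 / 4 * (Tk h k)\<^sup>2 + (g * B + \<sigma> * (real k)\<^sup>2) * Tk h k)"

definition lambda_set :: "real \<Rightarrow> real \<Rightarrow> real \<Rightarrow> real \<Rightarrow> real \<Rightarrow> real \<Rightarrow> nat \<Rightarrow> real set" where
  "lambda_set g h A B \<sigma> \<beta> k = {lambda_plus g h A B \<sigma> \<beta> k, lambda_minus g h A B \<sigma> \<beta> k}"

definition beta_nm :: "real \<Rightarrow> real \<Rightarrow> real \<Rightarrow> real \<Rightarrow> nat \<Rightarrow> nat \<Rightarrow> real" where
  "beta_nm g h B \<sigma> n m =
     ((g * B + \<sigma> * (real n)\<^sup>2) * Tk h n - (g * B + \<sigma> * (real m)\<^sup>2) * Tk h m)\<^sup>2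
     / (\<sigma> * Tk h n * Tk h m * (Tk h n - Tk h m) * ((real m)\<^sup>2 - (real n)\<^sup>2))"

definition beta_set :: "real \<Rightarrow> real \<Rightarrow> real \<Rightarrow> real \<Rightarrow> real \<Rightarrow> nat \<Rightarrow> nat \<Rightarrow> real set" where
  "beta_set g h A B \<sigma> n m =
     {- A * g * h + sqrt (beta_nm g h B \<sigma> n m), - A * g * h - sqrt (beta_nm g h B \<sigma> n m)}"

end

theory Submission
  imports Defs "HOL-Library.Poly_Mapping" "HOL-Computational_Algebra.Formal_Power_Series"
begin

text \<open>Put \<open>w = s * W\<close> and divide the equation by \<open>s\<close>. With an auxiliary unknown
  \<open>1 + s * \<rho>\<close> for the reciprocal square root of \<open>J = (1 + C_h w')^2 + w'^2\<close>, determined by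
  \<open>(1 + s * \<rho>)^2 * J = 1\<close>, the problem becomes polynomial in all unknowns. These are sought as
  power series in \<open>s\<close> whose coefficients are cosine polynomials. Inverting the linearisation off
  its kernel, and solving the kernel modes for \<open>\<lambda>\<close> and \<open>\<beta>\<close>, turns the problem into a fixed
  point equation in which the coefficient of order \<open>j\<close> depends on lower orders only, so a formal
  solution exists. The iteration also preserves a small ball for the norm summing
  \<open>(1 + |k|)^i\<close> times the absolute coefficients over all modes and orders, hence the formal
  solution converges, which gives the curve without a Banach space implicit function theorem.

  The kernel has at most two modes since \<open>k * coth (k * h)\<close> is strictly concave in \<open>k^2\<close>. If it
  has two modes and the second one has amplitude zero in the profile, it is given the amplitude
  \<open>s^2\<close>; this works because the square of \<open>cos (n * x)\<close> only contains the modes \<open>0\<close> and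
  \<open>2 * n\<close>, and explains the assumption on \<open>2 * n\<close>.\<close>

section \<open>Trigonometric polynomials\<close>

text \<open>Write kappa = beta + A g h, let p be the change of lambda * kappa and q the change of
  lambda^2. On a kernel mode j the equation reads: amplitude of the mode times (p - d q) equals - s
  times that mode of the remainder, where d = j coth(j h). Two modes give a 2x2 system for p and q,
  solvable because two kernel modes have different d; p and q in turn determine lambda and beta
  since lambda is nonzero on the kernel. The obstacle is the mode of amplitude s^2: its equation is
  divided by s once more, so the remainder enters without a factor s. Two devices compensate. In
  orders: \<open>sV\<close>, \<open>sT\<close> and \<open>sM\<close> are updated first and the
  kernel equations are evaluated at the result. In size: these three have radius r^2,
  \<open>sL\<close> and \<open>sG\<close> have radius r, and the parameter ranges up to r^3, so that
  every term of the iteration has a power of r to spare.\<close>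

unbundle no vec_syntax
unbundle fps_syntax

abbreviation (input) "lookup \<equiv> Poly_Mapping.lookup"
abbreviation (input) "keys \<equiv> Poly_Mapping.keys"
abbreviation (input) "single \<equiv> Poly_Mapping.single"

type_synonym trig = "int \<Rightarrow>\<^sub>0 real"

text \<open>Substitution into a trigonometric polynomial, with a map \<open>e\<close> on the
  coefficients. The target ring is left open because the reflection k -> -k (target
  \<open>trig\<close>) and the evaluation at a point (target complex) are both instances, and both
  have to be multiplicative.\<close>

definition linsum :: "(real \<Rightarrow> 'b::comm_ring_1) \<Rightarrow> (int \<Rightarrow> 'b) \<Rightarrow> trig \<Rightarrow> 'b" where
  "linsum e z p = (\<Sum>k\<in>keys p. e (lookup p k) * z k)"

lemma linsum_superset:
  assumes "e 0 = 0" "finite S" "keys p \<subseteq> S"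
  shows "linsum e z p = (\<Sum>k\<in>S. e (lookup p k) * z k)"
  unfolding linsum_def
  by (rule sum.mono_neutral_left) (use assms in \<open>auto simp: in_keys_iff\<close>)

lemma linsum_add:
  assumes e: "\<And>x y. e (x + y) = e x + e y"
  shows "linsum e z (p + q) = linsum e z p + linsum e z q"
proof -
  have e0: "e 0 = 0" using e[of 0 0] by simp
  let ?S = "keys p \<union> keys q"
  have "keys (p + q) \<subseteq> ?S" by (rule keys_add)
  then show ?thesis
    by (simp add: linsum_superset[of e, OF e0, where S = ?S] lookup_add e distrib_right sum.distrib)
qed

lemma linsum_zero [simp]: "linsum e z 0 = 0"
  by (simp add: linsum_def)

lemma linsum_sum:
  assumes e: "\<And>x y. e (x + y) = e x + e y"
  shows "linsum e z (sum f S) = (\<Sum>i\<in>S. linsum e z (f i))"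
  by (induction S rule: infinite_finite_induct) (auto simp: linsum_add[of e, OF e])

lemma linsum_single:
  assumes "e 0 = 0"
  shows "linsum e z (single k c) = e c * z k"
  using assms by (auto simp: linsum_def)

lemma trig_eq_sum: "(p :: trig) = (\<Sum>k\<in>keys p. single k (lookup p k))"
  by (rule poly_mapping_eqI)
    (auto simp: lookup_sum lookup_single when_def in_keys_iff sum.delta' cong: if_cong)

lemma trig_mult_eq_sum:
  "(p :: trig) * q = (\<Sum>k\<in>keys p. \<Sum>l\<in>keys q.
     single (k + l) (lookup p k * lookup q l))"
  by (subst trig_eq_sum[of p], subst trig_eq_sum[of q])
    (simp add: sum_product mult_single)

lemma linsum_mult:
  assumes e: "\<And>x y. e (x + y) = e x + e y" "\<And>x y. e (x * y) = e x * e y"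
    and z: "\<And>k l. z (k + l) = z k * z l"
  shows "linsum e z (p * q) = linsum e z p * linsum e z q"
proof -
  have e0: "e 0 = 0" using e(1)[of 0 0] by simp
  have "linsum e z (p * q) = (\<Sum>k\<in>keys p. \<Sum>l\<in>keys q. e (lookup p k * lookup q l) * z (k + l))"
    by (subst trig_mult_eq_sum)
      (simp only: linsum_sum[of e, OF e(1)] linsum_single[of e, OF e0])
  then show ?thesis
    by (simp add: e(2) z sum_product mult_ac linsum_def)
qed

abbreviation wt :: "int \<Rightarrow> real" where "wt k \<equiv> 1 + \<bar>real_of_int k\<bar>"

text \<open>A weighted Wiener norm. It dominates the supremum of the i-th derivative and, unlike a
  Hoelder norm, makes the boundedness of a Fourier multiplier a pointwise condition on its
  symbol.\<close>

definition tnorm :: "nat \<Rightarrow> trig \<Rightarrow> real" where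
  "tnorm i p = (\<Sum>k\<in>keys p. \<bar>lookup p k\<bar> * wt k ^ i)"

lemma tnorm_superset:
  assumes "finite S" "keys p \<subseteq> S"
  shows "tnorm i p = (\<Sum>k\<in>S. \<bar>lookup p k\<bar> * wt k ^ i)"
  unfolding tnorm_def
  by (rule sum.mono_neutral_left) (use assms in \<open>auto simp: in_keys_iff\<close>)

lemma tnorm_nonneg [simp]: "tnorm i p \<ge> 0"
  by (simp add: tnorm_def sum_nonneg)

lemma tnorm_zero [simp]: "tnorm i 0 = 0"
  by (simp add: tnorm_def)

lemma tnorm_minus [simp]: "tnorm i (- p) = tnorm i p"
  by (simp add: tnorm_def)

lemma tnorm_add: "tnorm i (p + q) \<le> tnorm i p + tnorm i q"
proof -
  let ?S = "keys p \<union> keys q"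
  have "keys (p + q) \<subseteq> ?S" by (rule keys_add)
  then show ?thesis
    by (simp add: tnorm_superset[where S = ?S] lookup_add flip: sum.distrib)
      (rule sum_mono, simp add: abs_triangle_ineq mult_right_mono flip: distrib_right)
qed

lemma tnorm_sum: "tnorm i (sum f S) \<le> (\<Sum>j\<in>S. tnorm i (f j))"
  by (induction S rule: infinite_finite_induct) (auto intro: order.trans[OF tnorm_add])

lemma tnorm_single [simp]:
  "tnorm i (single k c) = \<bar>c\<bar> * wt k ^ i"
  by (auto simp: tnorm_def)

lemma tnorm_one [simp]: "tnorm i 1 = 1"
  using tnorm_single[of i 0 1] by simp

text \<open>The weight is submultiplicative: 1 + |k + l| <= (1 + |k|) (1 + |l|).\<close>

lemma tnorm_mult: "tnorm i (p * q) \<le> tnorm i p * tnorm i q"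
proof -
  have *: "(1 + \<bar>real_of_int (k + l)\<bar>) ^ i \<le> wt k ^ i * wt l ^ i"
    for k l
  proof -
    have "1 + \<bar>real_of_int (k + l)\<bar> \<le> wt k * wt l"
      using abs_triangle_ineq[of "real_of_int k" "real_of_int l"]
      by (simp add: algebra_simps) (smt (verit) mult_nonneg_nonneg)
    then show ?thesis
      by (metis abs_ge_zero add_nonneg_nonneg power_mono power_mult_distrib zero_le_one)
  qed
  have "tnorm i (p * q) \<le> (\<Sum>k\<in>keys p. \<Sum>l\<in>keys q.
      tnorm i (single (k + l) (lookup p k * lookup q l)))"
    by (subst trig_mult_eq_sum) (intro order.trans[OF tnorm_sum] sum_mono tnorm_sum)
  also have "\<dots> \<le> (\<Sum>k\<in>keys p. \<Sum>l\<in>keys q.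
      (\<bar>lookup p k\<bar> * wt k ^ i) * (\<bar>lookup q l\<bar> * wt l ^ i))"
  proof (intro sum_mono)
    fix k l
    show "tnorm i (single (k + l) (lookup p k * lookup q l))
      \<le> (\<bar>lookup p k\<bar> * wt k ^ i) * (\<bar>lookup q l\<bar> * wt l ^ i)"
      using mult_left_mono[OF *[of k l], of "\<bar>lookup p k\<bar> * \<bar>lookup q l\<bar>"]
      by (simp add: abs_mult mult_ac)
  qed
  also have "\<dots> = tnorm i p * tnorm i q"
    by (simp add: tnorm_def sum_product)
  finally show ?thesis .
qed

lemma tnorm_mono: "i \<le> j \<Longrightarrow> tnorm i p \<le> tnorm j p"
  unfolding tnorm_def by (intro sum_mono mult_left_mono power_increasing) auto

lemma lookup_le_tnorm: "\<bar>lookup p k\<bar> \<le> tnorm i p"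
proof (cases "k \<in> keys p")
  case True
  have "\<bar>lookup p k\<bar> * 1 \<le> \<bar>lookup p k\<bar> * wt k ^ i"
    by (intro mult_left_mono) auto
  also have "\<dots> \<le> tnorm i p"
    unfolding tnorm_def
    by (rule member_le_sum[OF True]) auto
  finally show ?thesis by simp
qed (simp add: in_keys_iff)

lift_definition tmul :: "(int \<Rightarrow> real) \<Rightarrow> trig \<Rightarrow> trig" is "\<lambda>c p k. c k * p k"
  by (rule finite_subset) auto

lemma lookup_tmul [simp]: "lookup (tmul c p) k = c k * lookup p k"
  by transfer simp

lemma keys_tmul: "keys (tmul c p) \<subseteq> keys p"
  by (auto simp: in_keys_iff)

lemma tnorm_tmul:
  assumes "\<And>k. \<bar>c k\<bar> * wt k ^ i \<le> C * wt k ^ j"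
  shows "tnorm i (tmul c p) \<le> C * tnorm j p"
proof -
  have "tnorm i (tmul c p) =
      (\<Sum>k\<in>keys p. \<bar>lookup p k\<bar> * (\<bar>c k\<bar> * wt k ^ i))"
    by (simp add: tnorm_superset[OF finite_keys keys_tmul] abs_mult mult_ac)
  also have "\<dots> \<le> (\<Sum>k\<in>keys p. \<bar>lookup p k\<bar> * (C * wt k ^ j))"
    by (intro sum_mono mult_left_mono assms) auto
  also have "\<dots> = C * tnorm j p"
    by (simp add: tnorm_def sum_distrib_left mult_ac)
  finally show ?thesis .
qed

definition flip :: "trig \<Rightarrow> trig" where
  "flip = linsum (single 0) (\<lambda>k. single (- k) 1)"

lemma lookup_flip [simp]: "lookup (flip p) k = lookup p (- k)"
proof -
  have "lookup (flip p) k =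
     (\<Sum>l\<in>keys p. if - l = k then lookup p l else 0)"
    by (simp add: flip_def linsum_def mult_single lookup_sum lookup_single when_def)
  also have "\<dots> = (\<Sum>l\<in>keys p. if l = - k then lookup p (- k) else 0)"
    by (intro sum.cong) auto
  also have "\<dots> = lookup p (- k)"
    by (auto simp: in_keys_iff)
  finally show ?thesis .
qed

lemma flip_mult: "flip (p * q) = flip p * flip q"
  unfolding flip_def by (rule linsum_mult) (auto simp: single_add mult_single add_ac)

text \<open>\<open>True\<close> stands for even and \<open>False\<close> for odd, so that the sign
  rule for products becomes \<open>e = e'\<close>.\<close>

definition parity :: "bool \<Rightarrow> trig \<Rightarrow> bool" where
  "parity e p \<longleftrightarrow> flip p = (if e then p else - p)"

lemma parity_iff: "parity e p \<longleftrightarrow> (\<forall>k. lookup p (- k) = (if e then lookup p k else - lookup p k))"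
  by (auto simp: parity_def poly_mapping_eq_iff fun_eq_iff)

lemma parity_mult: "parity e p \<Longrightarrow> parity e' q \<Longrightarrow> parity (e = e') (p * q)"
  by (auto simp: parity_def flip_mult split: if_splits)

lemma parity_sum: "(\<And>i. i \<in> S \<Longrightarrow> parity e (f i)) \<Longrightarrow> parity e (sum f S)"
  by (auto simp: parity_iff lookup_sum sum_negf)

section \<open>Power series with trigonometric polynomial coefficients\<close>

type_synonym tser = "trig fps"

text \<open>A bound on all partial sums expresses convergence and size at once, and it passes to
  coefficientwise limits (\<open>nb_limit\<close>).\<close>

definition nb :: "nat \<Rightarrow> tser \<Rightarrow> real \<Rightarrow> bool" where
  "nb i U C \<longleftrightarrow> (\<forall>J. (\<Sum>j\<le>J. tnorm i (U $ j)) \<le> C)"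

lemma nb_nonneg: "nb i U C \<Longrightarrow> 0 \<le> C"
  unfolding nb_def using order.trans[OF sum_nonneg] tnorm_nonneg by meson

lemma nb_weaken: "nb i U C \<Longrightarrow> C \<le> C' \<Longrightarrow> i' \<le> i \<Longrightarrow> nb i' U C'"
  unfolding nb_def by (meson order.trans sum_mono tnorm_mono)

lemma nb_add: "nb i U C \<Longrightarrow> nb i U' C' \<Longrightarrow> nb i (U + U') (C + C')"
  unfolding nb_def fps_add_nth
proof
  fix J assume *: "\<forall>J. (\<Sum>j\<le>J. tnorm i (U $ j)) \<le> C" "\<forall>J. (\<Sum>j\<le>J. tnorm i (U' $ j)) \<le> C'"
  have "(\<Sum>j\<le>J. tnorm i (U $ j + U' $ j)) \<le> (\<Sum>j\<le>J. tnorm i (U $ j) + tnorm i (U' $ j))"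
    by (rule sum_mono) (rule tnorm_add)
  also have "\<dots> \<le> C + C'" using * by (simp add: sum.distrib add_mono)
  finally show "(\<Sum>j\<le>J. tnorm i (U $ j + U' $ j)) \<le> C + C'" .
qed

lemma nb_minus: "nb i U C \<Longrightarrow> nb i (- U) C"
  unfolding nb_def by simp

lemma nb_diff: "nb i U C \<Longrightarrow> nb i U' C' \<Longrightarrow> nb i (U - U') (C + C')"
  using nb_add[OF _ nb_minus] by fastforce

text \<open>The triangle i + j <= J lies in the square with side J, and all terms are
  nonnegative.\<close>

lemma sum_cauchy_le:
  fixes a b :: "nat \<Rightarrow> real"
  assumes "\<And>i. 0 \<le> a i" "\<And>i. 0 \<le> b i"
  shows "(\<Sum>j\<le>J. \<Sum>i=0..j. a i * b (j - i)) \<le> (\<Sum>j\<le>J. a j) * (\<Sum>j\<le>J. b j)"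
proof -
  have "(\<Sum>j\<le>J. \<Sum>i=0..j. a i * b (j - i)) = (\<Sum>j\<le>J. \<Sum>i\<le>j. a i * b (j - i))"
    by (simp add: atLeast0AtMost)
  also have "\<dots> = (\<Sum>(i, j)\<in>{(i, j). i + j \<le> J}. a i * b j)"
    by (simp add: sum.triangle_reindex_eq)
  also have "\<dots> \<le> (\<Sum>(i, j)\<in>{..J} \<times> {..J}. a i * b j)"
    by (rule sum_mono2) (auto simp: assms)
  also have "\<dots> = (\<Sum>j\<le>J. a j) * (\<Sum>j\<le>J. b j)"
    by (simp add: sum_product sum.cartesian_product)
  finally show ?thesis .
qed

lemma tnorm_fps_mult_nth:
  "tnorm i ((U * U') $ j) \<le> (\<Sum>l=0..j. tnorm i (U $ l) * tnorm i (U' $ (j - l)))"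
  by (simp add: fps_mult_nth) (rule order.trans[OF tnorm_sum], rule sum_mono, rule tnorm_mult)

lemma nb_mult:
  assumes "nb i U C" "nb i U' C'"
  shows "nb i (U * U') (C * C')"
  unfolding nb_def
proof
  fix J
  have "(\<Sum>j\<le>J. tnorm i ((U * U') $ j))
      \<le> (\<Sum>j\<le>J. \<Sum>l=0..j. tnorm i (U $ l) * tnorm i (U' $ (j - l)))"
    by (rule sum_mono) (rule tnorm_fps_mult_nth)
  also have "\<dots> \<le> (\<Sum>j\<le>J. tnorm i (U $ j)) * (\<Sum>j\<le>J. tnorm i (U' $ j))"
    by (rule sum_cauchy_le) auto
  also have "\<dots> \<le> C * C'"
    using assms nb_nonneg[OF assms(1)] by (intro mult_mono) (auto simp: nb_def sum_nonneg)
  finally show "(\<Sum>j\<le>J. tnorm i ((U * U') $ j)) \<le> C * C'" .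
qed

definition mop :: "(int \<Rightarrow> real) \<Rightarrow> tser \<Rightarrow> tser" where
  "mop c U = Abs_fps (\<lambda>j. tmul c (U $ j))"

lemma mop_nth [simp]: "mop c U $ j = tmul c (U $ j)"
  by (simp add: mop_def)

text \<open>\<open>cof k\<close> extracts a Fourier mode and returns it as a constant function, so that scalar
  power series and function-valued ones live in the same ring.\<close>

definition cof :: "int \<Rightarrow> tser \<Rightarrow> tser" where
  "cof k U = Abs_fps (\<lambda>j. single 0 (lookup (U $ j) k))"

lemma cof_nth [simp]: "cof k U $ j = single 0 (lookup (U $ j) k)"
  by (simp add: cof_def)

definition KK :: "real \<Rightarrow> tser" where
  "KK c = fps_const (single 0 c)"

lemma nb_mop:
  assumes "\<And>k. \<bar>c k\<bar> * wt k ^ i \<le> C * wt k ^ j"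
    and "nb j U B"
  shows "nb i (mop c U) (C * B)"
  unfolding nb_def
proof
  fix J
  have C: "C \<ge> 0"
    using assms(1)[of 0] abs_ge_zero[of "c 0"] by (simp del: abs_ge_zero)
  have "(\<Sum>l\<le>J. tnorm i (mop c U $ l)) \<le> (\<Sum>l\<le>J. C * tnorm j (U $ l))"
    by (rule sum_mono) (simp add: tnorm_tmul assms(1))
  also have "\<dots> \<le> C * B"
    using assms(2) C by (simp add: nb_def mult_left_mono flip: sum_distrib_left)
  finally show "(\<Sum>l\<le>J. tnorm i (mop c U $ l)) \<le> C * B" .
qed

text \<open>The extracted mode becomes a constant function, where the weight is 1; hence i and j are
  unrelated.\<close>

lemma nb_cof: "nb j U B \<Longrightarrow> nb i (cof k U) B"
  unfolding nb_def by (auto intro: order.trans[OF sum_mono] lookup_le_tnorm)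

lemma nb_fps_const: "nb i (fps_const p) (tnorm i p)"
  unfolding nb_def
proof
  fix J
  have "(\<Sum>j\<le>J. tnorm i (fps_const p $ j)) = (\<Sum>j\<le>J. if j = 0 then tnorm i p else 0)"
    by (intro sum.cong) auto
  then show "(\<Sum>j\<le>J. tnorm i (fps_const p $ j)) \<le> tnorm i p" by simp
qed

lemma nb_KK: "nb i (KK c) \<bar>c\<bar>"
  using nb_fps_const[of i "single 0 c"] by (simp add: KK_def)

lemma nb_X: "nb i fps_X 1"
  unfolding nb_def
proof
  fix J
  have "(\<Sum>j\<le>J. tnorm i ((fps_X :: tser) $ j)) = (\<Sum>j\<le>J. if j = 1 then 1 else 0)"
    by (intro sum.cong) (auto simp: fps_X_def)
  also have "\<dots> \<le> 1" by simp
  finally show "(\<Sum>j\<le>J. tnorm i ((fps_X :: tser) $ j)) \<le> 1" by simp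
qed

subsection \<open>Compatibility of the linear operators with the ring structure\<close>

lemma tmul_add: "tmul c (p + q) = tmul c p + tmul c q"
  by (rule poly_mapping_eqI) (simp add: lookup_add algebra_simps)
lemma tmul_minus: "tmul c (- p) = - tmul c p"
  by (rule poly_mapping_eqI) simp
lemma tmul_diff: "tmul c (p - q) = tmul c p - tmul c q"
  by (rule poly_mapping_eqI) (simp add: lookup_minus algebra_simps)
lemma tmul_zero [simp]: "tmul c 0 = 0"
  by (rule poly_mapping_eqI) simp

lemma lookup_single_mult: "lookup (single 0 x * (p :: trig)) k = x * lookup p k"
  by (simp add: mult_map_scale_conv_mult[symmetric] map.rep_eq when_def)

lemma mop_add: "mop c (U + U') = mop c U + mop c U'"
  by (simp add: fps_eq_iff tmul_add)
lemma mop_minus: "mop c (- U) = - mop c U"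
  by (simp add: fps_eq_iff tmul_minus)
lemma mop_diff: "mop c (U - U') = mop c U - mop c U'"
  by (simp add: fps_eq_iff tmul_diff)
lemma mop_mop: "mop c (mop d U) = mop (\<lambda>k. c k * d k) U"
  by (auto simp: fps_eq_iff intro: poly_mapping_eqI)

lemma cof_add: "cof c (U + U') = cof c U + cof c U'"
  by (simp add: fps_eq_iff lookup_add single_add)
lemma cof_minus: "cof c (- U) = - cof c U"
  by (simp add: fps_eq_iff flip: single_uminus)
lemma cof_diff: "cof c (U - U') = cof c U - cof c U'"
  by (simp add: fps_eq_iff lookup_minus single_diff)

text \<open>Scalar series, embedded as functions with mode 0 only. Multipliers and mode extraction
  are linear over them (\<open>mop_sca_mult\<close>, \<open>cof_sca_mult\<close>), which lets
  factors s, lambda and beta be pulled out.\<close>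

definition sca :: "tser \<Rightarrow> bool" where
  "sca U \<longleftrightarrow> (\<forall>j k. k \<noteq> 0 \<longrightarrow> lookup (U $ j) k = 0)"

lemma sca_nth: "sca U \<Longrightarrow> U $ j = single 0 (lookup (U $ j) 0)"
  by (rule poly_mapping_eqI) (auto simp: sca_def lookup_single when_def)

lemma sca_cof [simp]: "sca (cof k U)"
  by (simp add: sca_def lookup_single_not_eq)
lemma sca_KK [simp]: "sca (KK c)"
  by (auto simp: sca_def KK_def fps_const_def lookup_single_not_eq)
lemma sca_X [simp]: "sca fps_X"
  by (auto simp: sca_def fps_X_def lookup_one when_def)
lemma sca_add: "sca U \<Longrightarrow> sca U' \<Longrightarrow> sca (U + U')"
  by (simp add: sca_def lookup_add)
lemma sca_diff: "sca U \<Longrightarrow> sca U' \<Longrightarrow> sca (U - U')"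
  by (simp add: sca_def lookup_minus)

lemma sca_mult_nth:
  assumes "sca U"
  shows "lookup ((U * Y) $ j) k = (\<Sum>i=0..j. lookup (U $ i) 0 * lookup (Y $ (j - i)) k)"
  unfolding fps_mult_nth lookup_sum
  by (intro sum.cong refl, subst sca_nth[OF assms]) (simp add: lookup_single_mult)

lemma sca_mult: "sca U \<Longrightarrow> sca U' \<Longrightarrow> sca (U * U')"
  by (simp add: sca_def[of "U * U'"] sca_mult_nth) (simp add: sca_def)

lemma cof_sca_mult: "sca U \<Longrightarrow> cof k (U * Y) = U * cof k Y"
  by (rule fps_ext, rule poly_mapping_eqI)
    (simp add: sca_mult_nth lookup_single when_def if_distrib cong: if_cong)

lemma mop_sca_mult: "sca U \<Longrightarrow> mop c (U * Y) = U * mop c Y"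
  by (rule fps_ext, rule poly_mapping_eqI)
    (simp add: sca_mult_nth sum_distrib_left mult_ac)

lemma cof_mop: "cof k (mop c U) = KK (c k) * cof k U"
  by (rule fps_ext, rule poly_mapping_eqI) (simp add: KK_def lookup_single when_def lookup_single_mult)

lemma cof_sca: "sca U \<Longrightarrow> cof 0 U = U"
  by (rule fps_ext) (simp flip: sca_nth)

lemma cof_sca_0: "sca U \<Longrightarrow> k \<noteq> 0 \<Longrightarrow> cof k U = 0"
  by (rule fps_ext) (simp add: sca_def)

lemma tser_eqI: "(\<And>k. cof k U = cof k U') \<Longrightarrow> U = U'"
  by (rule fps_ext, rule poly_mapping_eqI) (metis cof_nth lookup_single_eq)

lemma KK_add: "KK (x + y) = KK x + KK y"
  by (simp add: KK_def single_add)
lemma KK_minus: "KK (- x) = - KK x"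
  by (simp add: KK_def single_uminus)
lemma KK_diff: "KK (x - y) = KK x - KK y"
  by (simp add: KK_def single_diff)
lemma KK_mult: "KK (x * y) = KK x * KK y"
  by (simp add: KK_def mult_single)
lemma KK_0 [simp]: "KK 0 = 0" by (simp add: KK_def)
lemma KK_1 [simp]: "KK 1 = 1" by (simp add: KK_def)
lemma KK_numeral [simp]: "KK (numeral n) = numeral n"
  by (simp add: KK_def numeral_fps_const)

definition par :: "bool \<Rightarrow> tser \<Rightarrow> bool" where
  "par e U \<longleftrightarrow> (\<forall>j. parity e (U $ j))"

lemma par_add: "par e U \<Longrightarrow> par e U' \<Longrightarrow> par e (U + U')"
  by (auto simp: par_def parity_iff lookup_add)
lemma par_minus: "par e U \<Longrightarrow> par e (- U)"
  by (auto simp: par_def parity_iff)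
lemma par_diff: "par e U \<Longrightarrow> par e U' \<Longrightarrow> par e (U - U')"
  by (auto simp: par_def parity_iff lookup_minus)
lemma par_mult: "par e U \<Longrightarrow> par e' U' \<Longrightarrow> par (e = e') (U * U')"
  unfolding par_def fps_mult_nth by (auto intro!: parity_sum parity_mult)
lemma par_sca: "sca U \<Longrightarrow> par True U"
  unfolding par_def parity_iff sca_def by (metis (full_types) neg_equal_0_iff_equal)
lemma par_mop: "(\<And>k. c (- k) = (if e' then c k else - c k)) \<Longrightarrow> par e U \<Longrightarrow> par (e = e') (mop c U)"
  by (auto simp: par_def parity_iff)
lemma cof_par: "par True U \<Longrightarrow> cof (- k) U = cof k U"
  by (rule fps_ext) (simp add: par_def parity_iff)

subsection \<open>Order of vanishing\<close>

definition vz :: "nat \<Rightarrow> tser \<Rightarrow> bool" where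
  "vz j U \<longleftrightarrow> (\<forall>i<j. U $ i = 0)"

lemma vz_0 [simp]: "vz 0 U" by (simp add: vz_def)
lemma vz_zero [simp]: "vz j 0" by (simp add: vz_def)
lemma vz_mono: "vz j U \<Longrightarrow> i \<le> j \<Longrightarrow> vz i U" by (simp add: vz_def)
lemma vz_add: "vz j U \<Longrightarrow> vz j U' \<Longrightarrow> vz j (U + U')" by (simp add: vz_def)
lemma vz_minus: "vz j U \<Longrightarrow> vz j (- U)" by (simp add: vz_def)
lemma vz_diff: "vz j U \<Longrightarrow> vz j U' \<Longrightarrow> vz j (U - U')" by (simp add: vz_def)
lemma vz_mop: "vz j U \<Longrightarrow> vz j (mop c U)" by (simp add: vz_def)
lemma vz_cof: "vz j U \<Longrightarrow> vz j (cof c U)" by (simp add: vz_def)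
lemma vz_X: "vz (Suc 0) fps_X" by (simp add: vz_def)

lemma vz_mult:
  assumes "vz i U" "vz j U'"
  shows "vz (i + j) (U * U')"
  unfolding vz_def fps_mult_nth
proof (intro allI impI sum.neutral ballI)
  fix l r assume "l < i + j" "r \<in> {0..l}"
  then have "r < i \<or> l - r < j" by auto
  then show "U $ r * U' $ (l - r) = 0" using assms by (auto simp: vz_def)
qed

lemma vz_all_eq: "(\<And>j. vz j (U - U')) \<Longrightarrow> U = U'"
  by (rule fps_ext) (metis fps_sub_nth lessI right_minus_eq vz_def)

section \<open>The fixed point problem for power series\<close>

text \<open>The unknowns are \<open>W = phi0 + s * phi1 + sV\<close>, \<open>\<rho> = - C_h phi0' + sT\<close>, \<open>\<mu> = s * sM\<close>,
  \<open>\<lambda> = lam0 + sL\<close> and \<open>\<beta> + A * g * h = kap0 + sG\<close>.\<close>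

datatype state = State (sV: tser) (sT: tser) (sM: tser) (sL: tser) (sG: tser)

text \<open>Vanishing at order 0 fixes the starting point of the curve and makes a product of two
  corrections gain an order.\<close>

definition adm :: "state \<Rightarrow> bool" where
  "adm U \<longleftrightarrow> par True (sV U) \<and> par True (sT U) \<and> sca (sM U) \<and> sca (sL U) \<and> sca (sG U) \<and>
     vz 1 (sV U) \<and> vz 1 (sT U) \<and> vz 1 (sM U) \<and> vz 1 (sL U) \<and> vz 1 (sG U)"

text \<open>Three derivatives for \<open>sV\<close>: two are lost in the equation and regained by
  \<open>sm\<close>, and the third makes the second derivative Lipschitz, hence Hoelder for every
  exponent. Products of \<open>sL\<close> or \<open>sG\<close> with \<open>sV\<close>, and terms
  with the parameter, are of order r^3, below the radius r^2; the new \<open>sL\<close> and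
  \<open>sG\<close> are of order r^2, below the radius r.\<close>

definition small :: "real \<Rightarrow> state \<Rightarrow> bool" where
  "small r U \<longleftrightarrow> nb 3 (sV U) (r\<^sup>2) \<and> nb 1 (sT U) (r\<^sup>2) \<and> nb 1 (sM U) (r\<^sup>2) \<and> nb 1 (sL U) r \<and> nb 1 (sG U) r"

text \<open>Two orders, because an iteration step improves \<open>sV\<close>, \<open>sT\<close>,
  \<open>sM\<close> before it improves \<open>sL\<close>, \<open>sG\<close>.\<close>

definition agree :: "nat \<Rightarrow> nat \<Rightarrow> state \<Rightarrow> state \<Rightarrow> bool" where
  "agree i j U U' \<longleftrightarrow> vz i (sV U - sV U') \<and> vz i (sT U - sT U') \<and> vz i (sM U - sM U') \<and>
     vz j (sL U - sL U') \<and> vz j (sG U - sG U')"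

subsection \<open>Norm bounds of given order in the radius\<close>

type_synonym fam = "real \<Rightarrow> state \<Rightarrow> tser"

abbreviation (input) for_small :: "(real \<Rightarrow> state \<Rightarrow> bool) \<Rightarrow> bool" where
  "for_small P \<equiv> \<forall>\<^sub>F r in at_right 0. \<forall>U. small r U \<longrightarrow> P r U"

definition bigo :: "nat \<Rightarrow> nat \<Rightarrow> fam \<Rightarrow> bool" where
  "bigo k i X \<longleftrightarrow> (\<exists>C. for_small (\<lambda>r U. nb i (X r U) (C * r ^ k)))"

lemma bigo_I:
  assumes "\<And>r U. 0 < r \<Longrightarrow> small r U \<Longrightarrow> nb i (X r U) (C * r ^ k)"
  shows "bigo k i X"
  unfolding bigo_def
  by (intro exI[of _ C] eventually_mono[OF eventually_at_right_less[of 0]]) (use assms in auto)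

lemma bigo_add: "bigo k i X \<Longrightarrow> bigo k i Y \<Longrightarrow> bigo k i (\<lambda>r U. X r U + Y r U)"
  unfolding bigo_def
proof (elim exE)
  fix C C' assume "for_small (\<lambda>r U. nb i (X r U) (C * r ^ k))"
    "for_small (\<lambda>r U. nb i (Y r U) (C' * r ^ k))"
  then have "for_small (\<lambda>r U. nb i (X r U + Y r U) ((C + C') * r ^ k))"
    by eventually_elim (auto simp: distrib_right intro: nb_add)
  then show "\<exists>C. for_small (\<lambda>r U. nb i (X r U + Y r U) (C * r ^ k))" ..
qed

lemma bigo_minus: "bigo k i X \<Longrightarrow> bigo k i (\<lambda>r U. - X r U)"
  unfolding bigo_def by (auto elim!: eventually_mono intro!: nb_minus)

lemma bigo_diff: "bigo k i X \<Longrightarrow> bigo k i Y \<Longrightarrow> bigo k i (\<lambda>r U. X r U - Y r U)"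
  using bigo_add[OF _ bigo_minus] by fastforce

lemma bigo_mult: "bigo k i X \<Longrightarrow> bigo l i Y \<Longrightarrow> bigo (k + l) i (\<lambda>r U. X r U * Y r U)"
  unfolding bigo_def
proof (elim exE)
  fix C C' assume "for_small (\<lambda>r U. nb i (X r U) (C * r ^ k))"
    "for_small (\<lambda>r U. nb i (Y r U) (C' * r ^ l))"
  then have "for_small (\<lambda>r U. nb i (X r U * Y r U) ((C * r ^ k) * (C' * r ^ l)))"
    by eventually_elim (auto intro: nb_mult)
  then show "\<exists>C. for_small (\<lambda>r U. nb i (X r U * Y r U) (C * r ^ (k + l)))"
    by (intro exI[of _ "C * C'"]) (simp add: power_add mult_ac)
qed

lemma bigo_weaken:
  assumes "bigo k i X" "k' \<le> k" "i' \<le> i" shows "bigo k' i' X"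
proof -
  obtain C where "for_small (\<lambda>r U. nb i (X r U) (C * r ^ k))"
    using assms(1) by (auto simp: bigo_def)
  moreover have "\<forall>\<^sub>F r :: real in at_right 0. r \<in> {0<..<1}" by (rule eventually_at_right_real) simp
  ultimately have "for_small (\<lambda>r U. nb i' (X r U) (\<bar>C\<bar> * r ^ k'))"
  proof eventually_elim
    case (elim r)
    have "C * r ^ k \<le> \<bar>C\<bar> * r ^ k'"
      using elim(2) assms(2) by (intro mult_mono power_decreasing) auto
    then show ?case using elim(1) assms(3) nb_weaken by blast
  qed
  then show ?thesis by (auto simp: bigo_def)
qed

lemma bigo_mop:
  assumes "bigo k j X" "\<And>k. \<bar>c k\<bar> * wt k ^ i \<le> C0 * wt k ^ j"
  shows "bigo k i (\<lambda>r U. mop c (X r U))"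
proof -
  obtain C where "for_small (\<lambda>r U. nb j (X r U) (C * r ^ k))"
    using assms(1) by (auto simp: bigo_def)
  then have "for_small (\<lambda>r U. nb i (mop c (X r U)) (C0 * C * r ^ k))"
    by eventually_elim (use nb_mop[of c i C0 j, OF assms(2)] in \<open>auto simp: mult.assoc\<close>)
  then show ?thesis by (auto simp: bigo_def)
qed

text \<open>For small r one spare power of r beats the constant. This is how the iteration maps the
  ball into itself.\<close>

lemma bigo_absorb:
  assumes "bigo (Suc k) i X"
  shows "for_small (\<lambda>r U. nb i (X r U) (r ^ k))"
proof -
  obtain C where "for_small (\<lambda>r U. nb i (X r U) (C * r ^ Suc k))"
    using assms by (auto simp: bigo_def)
  moreover have "\<forall>\<^sub>F r in at_right 0. r \<in> {0<..<1 / (\<bar>C\<bar> + 1)}" by (rule eventually_at_right_real) simp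
  ultimately show ?thesis
  proof eventually_elim
    case (elim r)
    have "C * r \<le> (\<bar>C\<bar> + 1) * r" using elim(2) by (intro mult_right_mono) auto
    also have "\<dots> \<le> 1" using elim(2) by (simp add: field_simps)
    finally have "C * r * r ^ k \<le> 1 * r ^ k" using elim(2) by (intro mult_right_mono) auto
    then show ?case using elim(1) by (auto simp: mult_ac intro: nb_weaken)
  qed
qed

lemma bigo_cof: "bigo k j X \<Longrightarrow> bigo k i (\<lambda>r U. cof l (X r U))"
  unfolding bigo_def by (auto elim!: eventually_mono intro!: nb_cof)

lemma bigo_const: "bigo 0 i (\<lambda>r U. fps_const p)"
  by (rule bigo_I[of _ _ "tnorm i p"]) (simp add: nb_fps_const)

lemma bigo_KK: "bigo 0 i (\<lambda>r U. KK c)"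
  unfolding KK_def by (rule bigo_const)

lemma bigo_zero: "bigo k i (\<lambda>r U. 0)"
  by (rule bigo_I[of _ _ 1]) (auto simp: nb_def)

lemma bigo_sV: "bigo 2 3 (\<lambda>r U. sV U)" by (rule bigo_I[of _ _ 1]) (auto simp: small_def)
lemma bigo_sT: "bigo 2 1 (\<lambda>r U. sT U)" by (rule bigo_I[of _ _ 1]) (auto simp: small_def)
lemma bigo_sM: "bigo 2 1 (\<lambda>r U. sM U)" by (rule bigo_I[of _ _ 1]) (auto simp: small_def)
lemma bigo_sL: "bigo 1 1 (\<lambda>r U. sL U)" by (rule bigo_I[of _ _ 1]) (auto simp: small_def)
lemma bigo_sG: "bigo 1 1 (\<lambda>r U. sG U)" by (rule bigo_I[of _ _ 1]) (auto simp: small_def)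

text \<open>The parameter is rescaled, so that convergence for \<open>|fps_X| \<le> 1\<close> amounts to convergence for
  \<open>|s| \<le> r ^ 3\<close>.\<close>

definition ss :: "real \<Rightarrow> tser" where "ss r = KK (r ^ 3) * fps_X"

lemma bigo_ss: "bigo 3 i (\<lambda>r U. ss r)"
proof (rule bigo_I[of _ _ 1])
  fix r :: real and U assume "0 < r"
  then show "nb i (ss r) (1 * r ^ 3)"
    using nb_mult[OF nb_KK nb_X, of i "r ^ 3"] by (simp add: ss_def)
qed

lemma sca_ss [simp]: "sca (ss r)" by (simp add: ss_def sca_mult)
lemma vz_ss: "vz 1 (ss r)" using vz_mult[OF vz_0[of "KK (r ^ 3)"] vz_X] by (simp add: ss_def)

text \<open>The reference \<open>X0\<close> is the part of \<open>X\<close> that survives as the parameter tends to zero; it has to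
  be split off from the equation of the second kernel mode, which is divided by the parameter.\<close>

definition near_bd :: "nat \<Rightarrow> fam \<Rightarrow> fam \<Rightarrow> bool" where
  "near_bd i X X0 \<longleftrightarrow> bigo 0 i X \<and> bigo 0 i X0 \<and> bigo 2 i (\<lambda>r U. X r U - X0 r U)"

lemma near_bd_add: "near_bd i X X0 \<Longrightarrow> near_bd i Y Y0 \<Longrightarrow> near_bd i (\<lambda>r U. X r U + Y r U) (\<lambda>r U. X0 r U + Y0 r U)"
  unfolding near_bd_def add_diff_add by (intro conjI bigo_add) auto

lemma near_bd_minus: "near_bd i X X0 \<Longrightarrow> near_bd i (\<lambda>r U. - X r U) (\<lambda>r U. - X0 r U)"
  unfolding near_bd_def minus_diff_minus by (intro conjI bigo_minus) auto

lemma mult_diff_mult': "x * y - a * b = (x - a) * y + a * (y - b)" for x :: "'a::comm_ring"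
  by (simp add: algebra_simps)

lemma near_bd_mult: "near_bd i X X0 \<Longrightarrow> near_bd i Y Y0 \<Longrightarrow> near_bd i (\<lambda>r U. X r U * Y r U) (\<lambda>r U. X0 r U * Y0 r U)"
  unfolding near_bd_def mult_diff_mult'
  using bigo_mult[of 0 i _ 0] bigo_mult[of 2 i _ 0] bigo_mult[of 0 i _ 2, simplified]
  by (intro conjI bigo_add) (auto simp: numeral_2_eq_2)

lemma near_bd_mop:
  assumes "near_bd j X X0" "\<And>k. \<bar>c k\<bar> * wt k ^ i \<le> C0 * wt k ^ j"
  shows "near_bd i (\<lambda>r U. mop c (X r U)) (\<lambda>r U. mop c (X0 r U))"
  using assms(1) unfolding near_bd_def mop_diff[symmetric] by (intro conjI bigo_mop[OF _ assms(2)]) auto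

lemma near_bd_cof: "near_bd j X X0 \<Longrightarrow> near_bd i (\<lambda>r U. cof l (X r U)) (\<lambda>r U. cof l (X0 r U))"
  unfolding near_bd_def by (auto intro: bigo_cof simp flip: cof_diff)

lemma near_bd_weaken: "near_bd i X X0 \<Longrightarrow> i' \<le> i \<Longrightarrow> near_bd i' X X0"
  unfolding near_bd_def using bigo_weaken by blast

lemma near_bd_same: "bigo 0 i X \<Longrightarrow> near_bd i X X"
  unfolding near_bd_def by (simp add: bigo_zero)

subsection \<open>Parity, and dependence on finitely many coefficients\<close>

text \<open>The last clause is the decisive one: \<open>sL\<close> and \<open>sG\<close> occur in X
  - X0 only multiplied by quantities that vanish at order 0, so knowing them to order j suffices for
  X - X0 to order \<open>Suc j\<close>, provided that the other unknowns are known to order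
  \<open>Suc j\<close>.\<close>

definition near_alg :: "bool \<Rightarrow> fam \<Rightarrow> fam \<Rightarrow> bool" where
  "near_alg e X X0 \<longleftrightarrow> (\<forall>r U. adm U \<longrightarrow> par e (X r U) \<and> par e (X0 r U) \<and> vz 1 (X r U - X0 r U) \<and>
     (\<forall>U' j. adm U' \<longrightarrow>
        (agree j j U U' \<longrightarrow> vz j (X r U - X r U') \<and> vz j (X0 r U - X0 r U')) \<and>
        (agree (Suc j) j U U' \<longrightarrow> vz (Suc j) ((X r U - X0 r U) - (X r U' - X0 r U')))))"

lemma near_alg_add:
  assumes "near_alg e X X0" "near_alg e Y Y0"
  shows "near_alg e (\<lambda>r U. X r U + Y r U) (\<lambda>r U. X0 r U + Y0 r U)"
proof -
  have eq: "(x + y) - (x0 + y0) - ((x' + y') - (x0' + y0')) = ((x - x0) - (x' - x0')) + ((y - y0) - (y' - y0'))"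
    for x y x0 y0 x' y' x0' y0' :: tser by simp
  show ?thesis
    using assms unfolding near_alg_def eq add_diff_add by (simp add: par_add vz_add)
qed

lemma near_alg_minus:
  assumes "near_alg e X X0"
  shows "near_alg e (\<lambda>r U. - X r U) (\<lambda>r U. - X0 r U)"
proof -
  have eq: "(- x) - (- x0) - ((- x') - (- x0')) = - ((x - x0) - (x' - x0'))"
    for x x0 x' x0' :: tser by simp
  show ?thesis
    using assms unfolding near_alg_def eq minus_diff_minus by (simp add: par_minus vz_minus del: minus_diff_eq)
qed

lemma vz_mult1: "vz 1 U \<Longrightarrow> vz j U' \<Longrightarrow> vz (Suc j) (U * U')" "vz j U \<Longrightarrow> vz 1 U' \<Longrightarrow> vz (Suc j) (U * U')"
  using vz_mult[of 1 U j U'] vz_mult[of j U 1 U'] by auto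
lemma vz_mult0: "vz j U' \<Longrightarrow> vz j (U * U')" "vz j U \<Longrightarrow> vz j (U * U')"
  using vz_mult[of 0 U j U'] vz_mult[of j U 0 U'] by auto

lemma agree_Suc: "agree (Suc j) j U U' \<Longrightarrow> agree j j U U'"
  by (auto simp: agree_def intro: vz_mono)

lemma near_alg_mult:
  assumes "near_alg e X X0" "near_alg e' Y Y0"
  shows "near_alg (e = e') (\<lambda>r U. X r U * Y r U) (\<lambda>r U. X0 r U * Y0 r U)"
  unfolding near_alg_def
proof (intro allI impI conjI)
  fix r U assume U: "adm U"
  note X = assms(1)[unfolded near_alg_def, rule_format, OF U, of r]
  note Y = assms(2)[unfolded near_alg_def, rule_format, OF U, of r]
  show "par (e = e') (X r U * Y r U)" "par (e = e') (X0 r U * Y0 r U)"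
    using X Y by (auto intro!: par_mult)
  show "vz 1 (X r U * Y r U - X0 r U * Y0 r U)"
    using X Y by (subst mult_diff_mult', intro vz_add) (auto intro: vz_mult0)
  fix U' j assume U': "adm U'"
  {
    assume ag: "agree j j U U'"
    show "vz j (X r U * Y r U - X r U' * Y r U')" "vz j (X0 r U * Y0 r U - X0 r U' * Y0 r U')"
      using X Y U' ag by (subst mult_diff_mult', intro vz_add; auto intro: vz_mult0)+
  }
  assume ag: "agree (Suc j) j U U'"
  note ag' = agree_Suc[OF ag]
  note X' = assms(1)[unfolded near_alg_def, rule_format, OF U', of r]
  note Y' = assms(2)[unfolded near_alg_def, rule_format, OF U', of r]
  \<comment> \<open>In each of the four products either one factor vanishes to order
    \<open>Suc j\<close>, or one vanishes to order 1 and the other to order j.\<close>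
  have "(X r U * Y r U - X0 r U * Y0 r U) - (X r U' * Y r U' - X0 r U' * Y0 r U')
    = ((X r U - X0 r U) - (X r U' - X0 r U')) * Y r U + (X r U' - X0 r U') * (Y r U - Y r U')
     + ((X0 r U - X0 r U') * (Y r U - Y0 r U) + X0 r U' * ((Y r U - Y0 r U) - (Y r U' - Y0 r U')))"
    by (simp add: algebra_simps)
  also have "vz (Suc j) \<dots>"
    by (intro vz_add) (use X Y X' Y' U U' ag ag' in \<open>auto intro: vz_mult0 vz_mult1 simp del: One_nat_def\<close>)
  finally show "vz (Suc j) (X r U * Y r U - X0 r U * Y0 r U - (X r U' * Y r U' - X0 r U' * Y0 r U'))" .
qed

lemma near_alg_mop:
  assumes "near_alg e X X0" "\<And>k. c (- k) = (if e' then c k else - c k)"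
  shows "near_alg (e = e') (\<lambda>r U. mop c (X r U)) (\<lambda>r U. mop c (X0 r U))"
  using assms(1) par_mop[of c e', OF assms(2)]
  unfolding near_alg_def by (auto simp: vz_mop simp flip: mop_diff)

lemma near_alg_cof:
  assumes "near_alg e X X0"
  shows "near_alg True (\<lambda>r U. cof l (X r U)) (\<lambda>r U. cof l (X0 r U))"
  using assms unfolding near_alg_def by (auto simp: vz_cof par_sca simp flip: cof_diff)

text \<open>Closed under ring operations and multipliers, so the polynomial expressions
  \<open>Rf\<close> and \<open>Tf\<close> inherit bounds and causality from the single
  unknowns.\<close>

definition near :: "nat \<Rightarrow> bool \<Rightarrow> fam \<Rightarrow> fam \<Rightarrow> bool" where
  "near i e X X0 \<longleftrightarrow> near_bd i X X0 \<and> near_alg e X X0"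

lemma near_add: "near i e X X0 \<Longrightarrow> near i e Y Y0 \<Longrightarrow> near i e (\<lambda>r U. X r U + Y r U) (\<lambda>r U. X0 r U + Y0 r U)"
  unfolding near_def by (auto intro: near_bd_add near_alg_add)
lemma near_minus: "near i e X X0 \<Longrightarrow> near i e (\<lambda>r U. - X r U) (\<lambda>r U. - X0 r U)"
  unfolding near_def by (auto intro: near_bd_minus near_alg_minus)
lemma near_diff: "near i e X X0 \<Longrightarrow> near i e Y Y0 \<Longrightarrow> near i e (\<lambda>r U. X r U - Y r U) (\<lambda>r U. X0 r U - Y0 r U)"
  using near_add[OF _ near_minus] by fastforce
lemma near_mult_even:
  "near i True X X0 \<Longrightarrow> near i True Y Y0 \<Longrightarrow> near i True (\<lambda>r U. X r U * Y r U) (\<lambda>r U. X0 r U * Y0 r U)"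
  unfolding near_def using near_alg_mult[of True X X0 True Y Y0] by (auto intro: near_bd_mult)
lemma near_mult_odd:
  "near i False X X0 \<Longrightarrow> near i False Y Y0 \<Longrightarrow> near i True (\<lambda>r U. X r U * Y r U) (\<lambda>r U. X0 r U * Y0 r U)"
  unfolding near_def using near_alg_mult[of False X X0 False Y Y0] by (auto intro: near_bd_mult)
lemma near_mop:
  assumes "near j True X X0" "\<And>k. \<bar>c k\<bar> * wt k ^ i \<le> C0 * wt k ^ j" "\<And>k. c (- k) = (if e then c k else - c k)"
  shows "near i e (\<lambda>r U. mop c (X r U)) (\<lambda>r U. mop c (X0 r U))"
  using assms(1) near_bd_mop[of j X X0 c i, OF _ assms(2)] near_alg_mop[of True X X0 c e, OF _ assms(3)]
  unfolding near_def by auto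
lemma near_cof: "near j e X X0 \<Longrightarrow> near i True (\<lambda>r U. cof l (X r U)) (\<lambda>r U. cof l (X0 r U))"
  unfolding near_def by (auto intro: near_bd_cof near_alg_cof)
lemma near_weaken: "near i e X X0 \<Longrightarrow> i' \<le> i \<Longrightarrow> near i' e X X0"
  unfolding near_def using near_bd_weaken by blast
lemma near_const: "parity e p \<Longrightarrow> near i e (\<lambda>r U. fps_const p) (\<lambda>r U. fps_const p)"
  using near_bd_same[OF bigo_const, of i p]
  unfolding near_def near_alg_def by (auto simp: par_def parity_iff)
lemma near_KK: "near i True (\<lambda>r U. KK c) (\<lambda>r U. KK c)"
  unfolding KK_def by (rule near_const) (auto simp: parity_iff lookup_single when_def)
lemma near_ss: "near i True (\<lambda>r U. ss r) (\<lambda>r U. 0)"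
  using bigo_weaken[OF bigo_ss[of i], of _ i] vz_ss par_sca[OF sca_ss]
  unfolding near_def near_bd_def near_alg_def by (auto simp: par_sca sca_def intro: bigo_zero)
lemma near_sV: "near 3 True (\<lambda>r U. sV U) (\<lambda>r U. 0)"
  using bigo_weaken[OF bigo_sV, of _ 3]
  unfolding near_def near_bd_def near_alg_def by (auto simp: adm_def par_sca sca_def agree_def intro: bigo_zero)
lemma near_sT: "near 1 True (\<lambda>r U. sT U) (\<lambda>r U. 0)"
  using bigo_weaken[OF bigo_sT, of _ 1]
  unfolding near_def near_bd_def near_alg_def by (auto simp: adm_def par_sca sca_def agree_def intro: bigo_zero)
lemma near_sM: "near 1 True (\<lambda>r U. sM U) (\<lambda>r U. 0)"
  using bigo_weaken[OF bigo_sM, of _ 1]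
  unfolding near_def near_bd_def near_alg_def by (auto simp: adm_def par_sca sca_def agree_def intro: bigo_zero)
text \<open>\<open>sL\<close> is of order r only, while the distance to the reference must be of
  order r^2; so \<open>sL\<close> is its own reference. The same holds for
  \<open>sG\<close>.\<close>

lemma near_sL: "near 1 True (\<lambda>r U. sL U) (\<lambda>r U. sL U)"
  using near_bd_same[OF bigo_weaken[OF bigo_sL, of 0 1]]
  unfolding near_def near_alg_def by (auto simp: adm_def par_sca agree_def)
lemma near_sG: "near 1 True (\<lambda>r U. sG U) (\<lambda>r U. sG U)"
  using near_bd_same[OF bigo_weaken[OF bigo_sG, of 0 1]]
  unfolding near_def near_alg_def by (auto simp: adm_def par_sca agree_def)

definition supp :: "int set \<Rightarrow> tser \<Rightarrow> bool" where
  "supp S X \<longleftrightarrow> (\<forall>j. keys (X $ j) \<subseteq> S)"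

lemma supp_add: "supp S X \<Longrightarrow> supp S Y \<Longrightarrow> supp S (X + Y)"
  unfolding supp_def using keys_add by (metis fps_add_nth le_sup_iff order.trans)
lemma supp_minus: "supp S X \<Longrightarrow> supp S (- X)"
  by (auto simp: supp_def in_keys_iff)
lemma supp_diff: "supp S X \<Longrightarrow> supp S Y \<Longrightarrow> supp S (X - Y)"
  using supp_add[OF _ supp_minus] by fastforce
lemma supp_mop: "supp S X \<Longrightarrow> supp S (mop c X)"
  unfolding supp_def using keys_tmul by fastforce
lemma supp_sca: "supp {0} X \<longleftrightarrow> sca X"
  unfolding supp_def sca_def subset_iff in_keys_iff singleton_iff by blast
lemma supp_cof: "0 \<in> S \<Longrightarrow> supp S (cof k X)"
  by (auto simp: supp_def)
lemma supp_mult: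
  assumes "supp S X" "supp T Y" "\<And>a b. a \<in> S \<Longrightarrow> b \<in> T \<Longrightarrow> a + b \<in> R"
  shows "supp R (X * Y)"
  unfolding supp_def
proof (intro allI subsetI)
  fix j l assume "l \<in> keys ((X * Y) $ j)"
  then have "(\<Sum>i=0..j. lookup (X $ i * Y $ (j - i)) l) \<noteq> 0"
    by (simp add: in_keys_iff fps_mult_nth lookup_sum)
  then obtain i where "lookup (X $ i * Y $ (j - i)) l \<noteq> 0"
    by (meson sum.neutral)
  then have "l \<in> keys (X $ i * Y $ (j - i))" by (simp add: in_keys_iff)
  then show "l \<in> R"
    using keys_mult[of "X $ i" "Y $ (j - i)"] assms by (fastforce simp: supp_def)
qed
lemma supp_sca_mult: "sca X \<Longrightarrow> supp S Y \<Longrightarrow> supp S (X * Y)"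
  by (rule supp_mult[of "{0}" _ S]) (auto simp: supp_sca)

lemma par_mult_even: "par True X \<Longrightarrow> par True Y \<Longrightarrow> par True (X * Y)"
  using par_mult[of True X True Y] by simp
lemma par_mop_even: "par True X \<Longrightarrow> (\<And>k. c (- k) = c k) \<Longrightarrow> par True (mop c X)"
  using par_mop[of c True True X] by simp

text \<open>\<open>dm\<close> is the symbol of the Hilbert transform of the derivative, \<open>sm\<close> the inverse of the
  symbol of the linearisation away from its kernel. If \<open>deg\<close> holds, the second kernel mode \<open>k\<close>
  has amplitude of second order only.\<close>

locale wave_series =
  fixes h gA2 gAh gB \<sigma> lam0 kap0 cD cS x1 x2 x3 x4 :: real and n k :: int
    and phi0 phi1 :: trig and dm sm :: "int \<Rightarrow> real" and deg :: bool
  assumes dm_even: "dm (- j) = dm j" and dm_bound: "\<bar>dm j\<bar> \<le> cD * wt j"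
    and sm_even: "sm (- j) = sm j" and sm_bound: "\<bar>sm j\<bar> * (wt j)\<^sup>2 \<le> cS"
    and phi_par: "parity True phi0" "parity True phi1"
    and deg: "deg \<Longrightarrow> keys phi0 \<subseteq> {n, - n}" "deg \<Longrightarrow> k \<notin> {0, n, - n, 2 * n, - 2 * n}"
begin

abbreviation "dd \<equiv> mop dm"
text \<open>The symbol is k instead of i k, which keeps all coefficients real. The missing factors i
  show up as a sign: the square of the derivative of W is represented by -
  \<open>dl W * dl W\<close>.\<close>

abbreviation "dl \<equiv> mop real_of_int"
abbreviation "dq \<equiv> mop (\<lambda>j. real_of_int j * real_of_int j)"
abbreviation "dld \<equiv> mop (\<lambda>j. real_of_int j * dm j)"

lemma dd_bound: "\<bar>dm j\<bar> * wt j ^ 1 \<le> cD * wt j ^ 2"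
  using mult_right_mono[OF dm_bound[of j], of "wt j"] by (simp add: power2_eq_square mult_ac)
lemma dl_bound: "\<bar>real_of_int j\<bar> * wt j ^ 1 \<le> 1 * wt j ^ 2"
  by (simp add: power2_eq_square mult_right_mono)
lemma dq_bound: "\<bar>real_of_int j * real_of_int j\<bar> * wt j ^ 1 \<le> 1 * wt j ^ 3"
proof -
  have "\<bar>real_of_int j\<bar> * \<bar>real_of_int j\<bar> \<le> wt j * wt j"
    by (intro mult_mono) auto
  from mult_right_mono[OF this, of "wt j"] show ?thesis
    by (simp add: power3_eq_cube mult_ac abs_mult)
qed
lemma dld_bound: "\<bar>real_of_int j * dm j\<bar> * wt j ^ 1 \<le> cD * wt j ^ 3"
proof -
  have "\<bar>real_of_int j\<bar> * \<bar>dm j\<bar> \<le> wt j * (cD * wt j)"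
    by (intro mult_mono dm_bound) auto
  from mult_right_mono[OF this, of "wt j"] show ?thesis
    by (simp add: power3_eq_cube mult_ac abs_mult)
qed
lemma sm_bound': "\<bar>sm j\<bar> * wt j ^ 3 \<le> cS * wt j ^ 1"
  using mult_right_mono[OF sm_bound[of j], of "wt j"]
  by (simp add: power2_eq_square power3_eq_cube mult_ac)

section \<open>The nonlinearity after scaling\<close>

definition Qf :: "tser \<Rightarrow> tser \<Rightarrow> tser \<Rightarrow> tser" where
  "Qf s W kap =
     - ((kap - KK gAh) * (KK (1 / (2 * h)) * cof 0 (W * W) + KK (1 / 2) * dd (W * W) - W * dd W))
     - KK gA2 * (s * (KK (1 / (3 * h)) * cof 0 (W * W * W)) - cof 0 (W * W) - W * W
        + s * (KK (1 / 3) * dd (W * W * W)) - s * (W * W * dd W)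
        + KK h * dd (W * W) - KK (2 * h) * (W * dd W))"

definition J2f :: "tser \<Rightarrow> tser" where
  "J2f W = dd W * dd W - dl W * dl W"

definition N2f :: "tser \<Rightarrow> tser" where
  "N2f W = - (dd W * dq W) + dl W * dld W"

text \<open>What is left of the surface equation after w = s W, a division by s, removal of the part
  linear in W and M, and a second division by s; see \<open>surface_identity\<close>.\<close>

definition Rf :: "tser \<Rightarrow> tser \<Rightarrow> tser \<Rightarrow> tser \<Rightarrow> tser \<Rightarrow> tser \<Rightarrow> tser" where
  "Rf s lam kap W M rho =
     KK 2 * lam * Qf s W kap + (kap * W + s * Qf s W kap) * (kap * W + s * Qf s W kap)
     - lam * lam * J2f W - (M - KK (2 * gB) * W) * (KK 2 * dd W + s * J2f W)
     - KK (2 * \<sigma>) * N2f W - KK (2 * \<sigma>) * rho * (- dq W + s * N2f W)"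

text \<open>The equation (1 + s rho)^2 J = 1, divided by 2 s, reads rho = - \<open>dd W\<close> - s
  * \<open>Tf s W rho\<close>; see \<open>sqrt_identity\<close>.\<close>

definition Tf :: "tser \<Rightarrow> tser \<Rightarrow> tser \<Rightarrow> tser" where
  "Tf s W rho = KK (1 / 2) * rho * rho + KK (1 / 2) * J2f W
     + KK (1 / 2) * (KK 2 * rho + s * rho * rho) * (KK 2 * dd W + s * J2f W)"

lemma near_dd: "near 2 True X X0 \<Longrightarrow> near 1 True (\<lambda>r U. dd (X r U)) (\<lambda>r U. dd (X0 r U))"
  by (rule near_mop[OF _ dd_bound]) (simp_all add: dm_even)
lemma near_dl: "near 2 True X X0 \<Longrightarrow> near 1 False (\<lambda>r U. dl (X r U)) (\<lambda>r U. dl (X0 r U))"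
  by (rule near_mop[OF _ dl_bound]) simp_all
lemma near_dq: "near 3 True X X0 \<Longrightarrow> near 1 True (\<lambda>r U. dq (X r U)) (\<lambda>r U. dq (X0 r U))"
  by (rule near_mop[OF _ dq_bound]) simp_all
lemma near_dld: "near 3 True X X0 \<Longrightarrow> near 1 False (\<lambda>r U. dld (X r U)) (\<lambda>r U. dld (X0 r U))"
  by (rule near_mop[OF _ dld_bound]) (simp_all add: dm_even)

context
  fixes S S0 lam lam1 kap kap1 W W0 M M0 rho rho0 :: fam
  assumes S: "near 1 True S S0" and lam: "near 1 True lam lam1" and kap: "near 1 True kap kap1"
    and W: "near 3 True W W0" and M: "near 1 True M M0" and rho: "near 1 True rho rho0"
begin

lemma near_W1: "near 1 True W W0" and near_W2: "near 2 True W W0"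
  using W by (auto intro: near_weaken)

lemma near_Qf: "near 1 True (\<lambda>r U. Qf (S r U) (W r U) (kap r U)) (\<lambda>r U. Qf (S0 r U) (W0 r U) (kap1 r U))"
proof -
  note WW2 = near_mult_even[OF near_W2 near_W2]
  note WWW2 = near_mult_even[OF WW2 near_W2]
  note at = near_dd[OF WW2] near_dd[OF WWW2] near_dd[OF near_W2] near_cof[OF WW2, of 1] near_cof[OF WWW2, of 1]
    near_W1 S kap near_KK
  show ?thesis unfolding Qf_def
    by (intro at near_minus near_add near_diff near_mult_even)
qed

lemma near_J2f: "near 1 True (\<lambda>r U. J2f (W r U)) (\<lambda>r U. J2f (W0 r U))"
  unfolding J2f_def
  by (intro near_diff near_mult_even[OF near_dd[OF near_W2] near_dd[OF near_W2]]
      near_mult_odd[OF near_dl[OF near_W2] near_dl[OF near_W2]])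

lemma near_N2f: "near 1 True (\<lambda>r U. N2f (W r U)) (\<lambda>r U. N2f (W0 r U))"
  unfolding N2f_def
  by (intro near_add near_minus near_mult_even[OF near_dd[OF near_W2] near_dq[OF W]]
      near_mult_odd[OF near_dl[OF near_W2] near_dld[OF W]])

lemma near_Rf:
  "near 1 True (\<lambda>r U. Rf (S r U) (lam r U) (kap r U) (W r U) (M r U) (rho r U))
    (\<lambda>r U. Rf (S0 r U) (lam1 r U) (kap1 r U) (W0 r U) (M0 r U) (rho0 r U))"
proof -
  note at = near_dd[OF near_W2] near_dq[OF W] near_J2f near_N2f near_Qf near_W1 S lam kap M rho near_KK
  show ?thesis unfolding Rf_def
    by (intro at near_minus near_add near_diff near_mult_even)
qed

lemma near_Tf: "near 1 True (\<lambda>r U. Tf (S r U) (W r U) (rho r U)) (\<lambda>r U. Tf (S0 r U) (W0 r U) (rho0 r U))"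
proof -
  note at = near_dd[OF near_W2] near_J2f S rho near_KK
  show ?thesis unfolding Tf_def
    by (intro at near_minus near_add near_diff near_mult_even)
qed

end

definition Wu :: fam where
  "Wu r U = fps_const phi0 + ss r * fps_const phi1 + sV U"
definition rhou :: "state \<Rightarrow> tser" where
  "rhou U = - dd (fps_const phi0) + sT U"
definition lamu :: "state \<Rightarrow> tser" where "lamu U = KK lam0 + sL U"
definition kapu :: "state \<Rightarrow> tser" where "kapu U = KK kap0 + sG U"
definition Ru :: fam where
  "Ru r U = Rf (ss r) (lamu U) (kapu U) (Wu r U) (sM U) (rhou U)"
text \<open>The remainder at s = 0, V = 0, M = 0, with lambda and kappa left as they are: their
  corrections of order r would be too large for the difference \<open>Ru r U - R0 U\<close>, which
  must be of order r^2.\<close>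

definition R0 :: "state \<Rightarrow> tser" where
  "R0 U = Rf 0 (lamu U) (kapu U) (fps_const phi0) 0 (- dd (fps_const phi0))"
definition Tu :: fam where
  "Tu r U = Tf (ss r) (Wu r U) (rhou U)"

lemma near_Wu: "near 3 True Wu (\<lambda>r U. fps_const phi0)"
proof -
  have "near 3 True (\<lambda>r U. fps_const phi0 + ss r * fps_const phi1 + sV U) (\<lambda>r U. fps_const phi0 + 0 * fps_const phi1 + 0)"
    by (intro near_add near_mult_even near_const near_ss near_sV phi_par)
  then show ?thesis by (simp add: Wu_def[abs_def])
qed
lemma near_rhou: "near 1 True (\<lambda>r U. rhou U) (\<lambda>r U. - dd (fps_const phi0))"
proof -
  have "near 1 True (\<lambda>r U. - dd (fps_const phi0) + sT U) (\<lambda>r U. - dd (fps_const phi0) + 0)"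
    by (intro near_add near_minus near_dd near_const near_sT phi_par)
  then show ?thesis by (simp add: rhou_def[abs_def])
qed
lemma near_lamu: "near 1 True (\<lambda>r U. lamu U) (\<lambda>r U. lamu U)"
  unfolding lamu_def by (intro near_add near_KK near_sL)
lemma near_kapu: "near 1 True (\<lambda>r U. kapu U) (\<lambda>r U. kapu U)"
  unfolding kapu_def by (intro near_add near_KK near_sG)
lemma near_Ru: "near 1 True Ru (\<lambda>r U. R0 U)"
  unfolding Ru_def[abs_def] R0_def
  by (rule near_Rf[OF near_ss near_lamu near_kapu near_Wu near_sM near_rhou])
lemma near_Tu: "near 1 True Tu (\<lambda>r U. Tf 0 (fps_const phi0) (- dd (fps_const phi0)))"
  unfolding Tu_def[abs_def]
  by (rule near_Tf[OF near_ss near_lamu near_kapu near_Wu near_sM near_rhou])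

lemma near_alg_Ru: "near_alg True Ru (\<lambda>r U. R0 U)" and near_alg_Tu: "near_alg True Tu (\<lambda>r U. Tf 0 (fps_const phi0) (- dd (fps_const phi0)))"
  and bigo_Ru: "bigo 0 1 Ru" "bigo 2 1 (\<lambda>r U. Ru r U - R0 U)" and bigo_Tu: "bigo 0 1 Tu"
  using near_Ru near_Tu by (simp_all add: near_def near_bd_def)

text \<open>At s = 0 every term of \<open>Rf\<close> is quadratic in \<open>phi0\<close>, since the
  cubic terms carry a factor s and rho is linear in \<open>phi0\<close>. As \<open>phi0\<close>
  lives on the modes n and -n, only the modes 0, 2n and -2n can occur.\<close>

lemma cof_R0:
  assumes "deg" "adm U"
  shows "cof k (R0 U) = 0"
proof -
  let ?S = "{n, - n}" and ?T = "{0, 2 * n, - 2 * n}"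
  define F where "F = fps_const phi0"
  have p: "supp ?S F" using deg(1)[OF assms(1)] by (auto simp: supp_def fps_const_def F_def)
  have sc: "sca (lamu U)" "sca (kapu U)" using assms(2) by (auto simp: lamu_def kapu_def adm_def intro: sca_add)
  have m: "supp ?S X \<Longrightarrow> supp ?S Y \<Longrightarrow> supp ?T (X * Y)" for X Y
    by (rule supp_mult) auto
  have J: "supp ?T (J2f F)" and N: "supp ?T (N2f F)"
    unfolding J2f_def N2f_def by (intro supp_diff supp_add supp_minus supp_mop m p)+
  have "supp ?T (- ((kapu U - KK gAh) * (KK (1 / (2 * h)) * cof 0 (F * F) + KK (1 / 2) * dd (F * F) - F * dd F))
     - KK gA2 * (- cof 0 (F * F) - F * F + KK h * dd (F * F) - KK (2 * h) * (F * dd F)))"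
    by (intro supp_diff supp_add supp_minus supp_sca_mult[OF sca_diff[OF sc(2) sca_KK]] supp_sca_mult[OF sca_KK]
        supp_cof supp_mop m p) auto
  then have Q: "supp ?T (Qf 0 F (kapu U))" by (simp add: Qf_def)
  have "supp ?T (KK 2 * lamu U * Qf 0 F (kapu U) + (kapu U * F) * (kapu U * F)
     - lamu U * lamu U * J2f F - (- (KK (2 * gB) * F)) * (KK 2 * dd F)
     - KK (2 * \<sigma>) * N2f F - (KK (2 * \<sigma>) * (- dd F)) * (- dq F))"
    by (intro supp_diff supp_add m supp_sca_mult[OF sca_mult[OF sc(1) sc(1)] J]
        supp_sca_mult[OF sca_mult[OF sca_KK sc(1)] Q] supp_sca_mult[OF sca_KK N]
       supp_minus supp_sca_mult[OF sca_KK] supp_sca_mult[OF sc(2)] p supp_mop)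
  then have *: "supp ?T (R0 U)" by (simp add: R0_def Rf_def F_def)
  have "lookup (R0 U $ j) k = 0" for j
  proof (rule ccontr)
    assume "lookup (R0 U $ j) k \<noteq> 0"
    then have "k \<in> keys (R0 U $ j)" by (simp add: in_keys_iff)
    then have "k \<in> ?T" using * by (auto simp: supp_def)
    then show False using deg(2)[OF assms(1)] by auto
  qed
  then show ?thesis by (simp add: fps_eq_iff)
qed

end

text \<open>With d = 1, each order of the result depends on strictly lower orders of the unknowns,
  which is what the iteration needs; d = 0 serves as input for \<open>causal_mult\<close>, where two
  factors vanishing at order 0 gain the missing order.\<close>

definition causal :: "nat \<Rightarrow> fam \<Rightarrow> bool" where
  "causal d X \<longleftrightarrow> (\<forall>r U. adm U \<longrightarrow> vz 1 (X r U) \<and>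
     (\<forall>U' j. adm U' \<longrightarrow> agree j j U U' \<longrightarrow> vz (j + d) (X r U - X r U')))"

lemma causal_add: "causal d X \<Longrightarrow> causal d Y \<Longrightarrow> causal d (\<lambda>r U. X r U + Y r U)"
  unfolding causal_def add_diff_add by (simp add: vz_add)
lemma causal_minus: "causal d X \<Longrightarrow> causal d (\<lambda>r U. - X r U)"
  unfolding causal_def minus_diff_minus by (simp add: vz_minus del: minus_diff_eq)
lemma causal_diff: "causal d X \<Longrightarrow> causal d Y \<Longrightarrow> causal d (\<lambda>r U. X r U - Y r U)"
  using causal_add[OF _ causal_minus] by fastforce
lemma causal_mop: "causal d X \<Longrightarrow> causal d (\<lambda>r U. mop c (X r U))"
  unfolding causal_def mop_diff[symmetric] by (simp add: vz_mop)
lemma causal_mult: "causal 0 X \<Longrightarrow> causal 0 Y \<Longrightarrow> causal 1 (\<lambda>r U. X r U * Y r U)"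
  unfolding causal_def mult_diff_mult'
  by (auto intro!: vz_add intro: vz_mult0 vz_mult1[unfolded One_nat_def])
lemma causal_cmul: "causal d X \<Longrightarrow> causal d (\<lambda>r U. KK c * X r U)"
  unfolding causal_def right_diff_distrib[symmetric] by (simp add: vz_mult0)
lemma causal_ss: "near_alg e X X0 \<Longrightarrow> causal 1 (\<lambda>r U. ss r * X r U)"
  unfolding causal_def near_alg_def right_diff_distrib[symmetric] using vz_ss
  by (auto intro: vz_mult0 vz_mult1[unfolded One_nat_def])
lemma causal_lower: "causal 1 X \<Longrightarrow> causal 0 X"
  unfolding causal_def by (simp, meson vz_mono le_SucI order.refl)
lemma causal_sV: "causal 0 (\<lambda>r U. sV U)" by (auto simp: causal_def adm_def agree_def)
lemma causal_sL: "causal 0 (\<lambda>r U. sL U)" by (auto simp: causal_def adm_def agree_def)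
lemma causal_sG: "causal 0 (\<lambda>r U. sG U)" by (auto simp: causal_def adm_def agree_def)

lemma bigo_cmul: "bigo k i X \<Longrightarrow> bigo k i (\<lambda>r U. KK c * X r U)"
  using bigo_mult[OF bigo_KK, of k i X] by simp

section \<open>The iteration and its fixed point\<close>

context wave_series
begin

text \<open>The change of lambda * kappa and, in \<open>qu\<close>, that of lambda^2. The part of
  the equation linear in W depends on lambda and kappa through these two combinations only.\<close>

definition pu :: "state \<Rightarrow> tser" where
  "pu U = KK lam0 * sG U + KK kap0 * sL U + sL U * sG U"
definition qu :: "state \<Rightarrow> tser" where
  "qu U = KK (2 * lam0) * sL U + sL U * sL U"
text \<open>Beside \<open>pu\<close> and \<open>qu\<close> only \<open>sV\<close> appears, not all
  of W: \<open>phi0\<close> and \<open>phi1\<close> have no mode where \<open>sm\<close> is nonzero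
  (hypothesis \<open>regular\<close> below).\<close>

definition V1 :: fam where
  "V1 r U = - mop sm (KK 2 * (pu U * sV U) - KK 2 * (qu U * dd (sV U)) + ss r * Ru r U)"
text \<open>The new \<open>V1\<close> is used here, because \<open>dd (sV U)\<close> would gain
  neither an order nor a power of r.\<close>

definition tau1 :: fam where
  "tau1 r U = - (ss r * dd (fps_const phi1)) - dd (V1 r U) - ss r * Tu r U"
definition M1 :: fam where
  "M1 r U = ss r * cof 0 (Ru r U)"
text \<open>If two states agree to order j, their half steps agree to order \<open>Suc j\<close> in
  the first three components and to order j in the last two, which is exactly the premise of the
  last clause of \<open>near_alg\<close>.\<close>

definition half_step :: "real \<Rightarrow> state \<Rightarrow> state" where
  "half_step r U = State (V1 r U) (tau1 r U) (M1 r U) (sL U) (sG U)"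

lemma half_step_sel [simp]:
  "sV (half_step r U) = V1 r U" "sT (half_step r U) = tau1 r U" "sM (half_step r U) = M1 r U"
  "sL (half_step r U) = sL U" "sG (half_step r U) = sG U"
  by (simp_all add: half_step_def)

lemma causal_pu: "causal 0 (\<lambda>r U. pu U)"
  unfolding pu_def by (intro causal_add causal_cmul causal_sL causal_sG causal_lower[OF causal_mult])
lemma causal_qu: "causal 0 (\<lambda>r U. qu U)"
  unfolding qu_def by (intro causal_add causal_cmul causal_sL causal_sG causal_lower[OF causal_mult])
lemma causal_V1: "causal 1 V1"
  unfolding V1_def[abs_def]
  by (intro causal_minus causal_mop causal_add causal_diff causal_cmul causal_mult causal_pu causal_qu causal_sV causal_ss[OF near_alg_Ru])
lemma near_alg_dd_phi1: "near_alg True (\<lambda>r U. dd (fps_const phi1)) (\<lambda>r U. dd (fps_const phi1))"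
  using near_dd[OF near_const[OF phi_par(2)]] by (simp add: near_def)

lemma causal_tau1: "causal 1 tau1"
  unfolding tau1_def[abs_def]
  by (intro causal_minus causal_diff causal_mop causal_V1 causal_ss[OF near_alg_Tu] causal_ss[OF near_alg_dd_phi1])
lemma causal_M1: "causal 1 M1"
  unfolding M1_def[abs_def] by (intro causal_ss[OF near_alg_cof[OF near_alg_Ru]])

lemma bigo_pu: "bigo 1 1 (\<lambda>r U. pu U)"
  unfolding pu_def using bigo_mult[OF bigo_sL bigo_sG] by (intro bigo_add bigo_cmul bigo_sL bigo_sG) (auto intro: bigo_weaken)
lemma bigo_qu: "bigo 1 1 (\<lambda>r U. qu U)"
  unfolding qu_def using bigo_mult[OF bigo_sL bigo_sL] by (intro bigo_add bigo_cmul bigo_sL) (auto intro: bigo_weaken)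
lemma bigo_dd: "bigo l 2 X \<Longrightarrow> bigo l 1 (\<lambda>r U. dd (X r U))"
  by (rule bigo_mop[OF _ dd_bound])

lemma bigo_V1: "bigo 3 3 V1"
proof -
  have a: "bigo 3 1 (\<lambda>r U. pu U * sV U)"
    using bigo_mult[OF bigo_pu bigo_weaken[OF bigo_sV, of 2 1]] by (simp add: numeral_3_eq_3 numeral_2_eq_2)
  have b: "bigo 3 1 (\<lambda>r U. qu U * dd (sV U))"
    using bigo_mult[OF bigo_qu bigo_dd[OF bigo_weaken[OF bigo_sV, of 2 2]]] by (simp add: numeral_3_eq_3 numeral_2_eq_2)
  have c: "bigo 3 1 (\<lambda>r U. ss r * Ru r U)"
    using bigo_mult[OF bigo_ss bigo_Ru(1)] by simp
  show ?thesis unfolding V1_def[abs_def]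
    by (intro bigo_minus bigo_mop[OF _ sm_bound'] bigo_add bigo_diff bigo_cmul a b c)
qed
lemma bigo_tau1: "bigo 3 1 tau1"
proof -
  have a: "bigo 3 1 (\<lambda>r U. ss r * dd (fps_const phi1))"
    using bigo_mult[OF bigo_ss bigo_dd[OF bigo_const]] by simp
  have b: "bigo 3 1 (\<lambda>r U. ss r * Tu r U)"
    using bigo_mult[OF bigo_ss bigo_Tu] by simp
  show ?thesis unfolding tau1_def[abs_def]
    by (intro bigo_minus bigo_diff a b bigo_dd bigo_weaken[OF bigo_V1]) auto
qed
lemma bigo_M1: "bigo 3 1 M1"
  unfolding M1_def[abs_def] using bigo_mult[OF bigo_ss bigo_cof[OF bigo_Ru(1)]] by simp

lemma adm_sca:
  assumes "adm U" shows "sca (pu U)" "sca (qu U)"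
  using assms by (auto simp: pu_def qu_def adm_def intro!: sca_add sca_mult)

lemma adm_half_step:
  assumes "adm U" shows "adm (half_step r U)"
proof -
  have R: "par True (Ru r U)" and T: "par True (Tu r U)"
    using near_alg_Ru near_alg_Tu assms by (auto simp: near_alg_def)
  have V: "par True (V1 r U)"
    unfolding V1_def using assms adm_sca[OF assms]
    by (intro par_minus par_mop_even par_add par_diff par_mult_even R) (auto simp: adm_def par_sca dm_even sm_even simp del: KK_numeral)
  have f: "par True (fps_const phi1)" using phi_par by (auto simp: par_def parity_iff fps_const_def)
  have t: "par True (tau1 r U)"
    unfolding tau1_def
    by (intro par_minus par_mop_even par_diff par_mult_even V T f par_sca sca_ss) (auto simp: dm_even)
  show ?thesis
    using assms causal_V1 causal_tau1 causal_M1 V t unfolding adm_def causal_def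
    by (auto simp: M1_def intro: sca_mult)
qed

lemma agree_half_step:
  assumes "adm U" "adm U'" "agree j j U U'"
  shows "agree (Suc j) j (half_step r U) (half_step r U')"
  using assms causal_V1 causal_tau1 causal_M1 unfolding causal_def by (simp add: agree_def)

lemma small_half_step: "for_small (\<lambda>r U. small r (half_step r U))"
proof -
  have "for_small (\<lambda>r U. nb 3 (V1 r U) (r\<^sup>2))"
    "for_small (\<lambda>r U. nb 1 (tau1 r U) (r\<^sup>2))"
    "for_small (\<lambda>r U. nb 1 (M1 r U) (r\<^sup>2))"
    using bigo_absorb[of 2 3 V1] bigo_absorb[of 2 1 tau1] bigo_absorb[of 2 1 M1] bigo_V1 bigo_tau1 bigo_M1
    by (simp_all add: eval_nat_numeral)
  then show ?thesis by eventually_elim (simp add: small_def)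
qed

lemma bigo_half_step:
  assumes "bigo l i X" shows "bigo l i (\<lambda>r U. X r (half_step r U))"
proof -
  obtain C where "for_small (\<lambda>r U. nb i (X r U) (C * r ^ l))"
    using assms by (auto simp: bigo_def)
  then have "for_small (\<lambda>r U. nb i (X r (half_step r U)) (C * r ^ l))"
    using small_half_step by eventually_elim auto
  then show ?thesis by (auto simp: bigo_def)
qed

text \<open>If \<open>deg\<close> holds, the equation of mode \<open>k\<close> has been divided by the parameter once more, which
  is possible because the mode \<open>k\<close> of \<open>R0\<close> vanishes.\<close>

definition Yn :: fam where
  "Yn r U = ss r * cof n (Ru r U)"
definition Yk :: fam where
  "Yk r U = (if deg then cof k (Ru r U - R0 U) else ss r * cof k (Ru r U))"

lemma Yk_deg: "deg \<Longrightarrow> Yk r U = cof k (Ru r U - R0 U)"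
  unfolding Yk_def by (rule if_P)
lemma Yk_nondeg: "\<not> deg \<Longrightarrow> Yk r U = ss r * cof k (Ru r U)"
  unfolding Yk_def by (rule if_not_P)

lemma bigo_Yn: "bigo 2 1 Yn"
  using bigo_weaken[OF bigo_mult[OF bigo_ss bigo_cof[OF bigo_Ru(1)]], of 2 1 1] by (simp add: Yn_def[abs_def])

lemma bigo_Yk: "bigo 2 1 Yk"
proof (cases deg)
  case True
  then have "Yk = (\<lambda>r U. cof k (Ru r U - R0 U))" by (intro ext) (rule Yk_deg)
  then show ?thesis by (simp only:) (rule bigo_cof[OF bigo_Ru(2)])
next
  case False
  then have "Yk = (\<lambda>r U. ss r * cof k (Ru r U))" by (intro ext) (rule Yk_nondeg)
  then show ?thesis
    by (simp only:) (rule bigo_weaken[OF bigo_mult[OF bigo_ss[of 1] bigo_cof[OF bigo_Ru(1), of 1]]]; simp)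
qed

lemma causal_Yn: "causal 1 Yn"
  unfolding Yn_def[abs_def] using causal_ss[OF near_alg_cof[OF near_alg_Ru]] by auto

lemma sca_Y: "sca (Yn r U)" "sca (Yk r U)"
  unfolding Yn_def Yk_def by (auto intro: sca_mult)

text \<open>If \<open>deg\<close> holds, \<open>Yk\<close> has no factor \<open>ss r\<close> to
  supply an order; the gain comes from \<open>Ru r U - R0 U\<close> being one order less sensitive
  to \<open>sL\<close> and \<open>sG\<close>.\<close>

lemma Yk_props:
  assumes U: "adm U"
  shows "vz 1 (Yk r U)" "adm U' \<Longrightarrow> agree (Suc j) j U U' \<Longrightarrow> vz (Suc j) (Yk r U - Yk r U')"
proof -
  have z: "causal 1 (\<lambda>r U. ss r * cof k (Ru r U))" by (rule causal_ss[OF near_alg_cof[OF near_alg_Ru]])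
  show "vz 1 (Yk r U)"
  proof (cases deg)
    case True
    have "vz 1 (Ru r U - R0 U)" using near_alg_Ru U by (auto simp: near_alg_def)
    then show ?thesis unfolding Yk_deg[OF True] by (rule vz_cof)
  next
    case False
    show ?thesis unfolding Yk_nondeg[OF False] using z U by (simp add: causal_def)
  qed
  show "vz (Suc j) (Yk r U - Yk r U')" if "adm U'" "agree (Suc j) j U U'"
  proof (cases deg)
    case True
    have "vz (Suc j) ((Ru r U - R0 U) - (Ru r U' - R0 U'))"
      using near_alg_Ru U that by (auto simp: near_alg_def)
    then show ?thesis unfolding Yk_deg[OF True] cof_diff[symmetric] by (rule vz_cof)
  next
    case False
    show ?thesis unfolding Yk_nondeg[OF False]
      using z U that agree_Suc[OF that(2)] by (simp add: causal_def)
  qed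
qed

text \<open>\<open>x1\<close> to \<open>x4\<close> form the inverse matrix of the 2x2 system for p
  and q with right-hand sides built from \<open>Yn\<close> and \<open>Yk\<close>; their values are
  fixed by \<open>kernel_first\<close> and \<open>kernel_second\<close>.\<close>

definition p1 :: fam where "p1 r U = KK x1 * Yn r U + KK x2 * Yk r U"
definition q1 :: fam where "q1 r U = KK x3 * Yn r U + KK x4 * Yk r U"
text \<open>Solves q = 2 lam0 L + L^2 for its linear term, and \<open>G1\<close> does so for p =
  lam0 G + kap0 L + L G. Quadratic terms may keep the old values, as they gain an order and a power
  of r; the linear term kap0 L may not, so \<open>G1\<close> takes the new
  \<open>L1\<close>.\<close>

definition L1 :: fam where
  "L1 r U = KK (1 / (2 * lam0)) * (q1 r (half_step r U) - sL U * sL U)"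
definition G1 :: fam where
  "G1 r U = KK (1 / lam0) * (p1 r (half_step r U) - KK kap0 * L1 r U - sL U * sG U)"
definition step :: "real \<Rightarrow> state \<Rightarrow> state" where
  "step r U = State (V1 r U) (tau1 r U) (M1 r U) (L1 r U) (G1 r U)"

lemma step_sel [simp]:
  "sV (step r U) = V1 r U" "sT (step r U) = tau1 r U" "sM (step r U) = M1 r U"
  "sL (step r U) = L1 r U" "sG (step r U) = G1 r U"
  by (simp_all add: step_def)

lemma bigo_L1: "bigo 2 1 L1"
proof -
  have "bigo 2 1 (\<lambda>r U. q1 r (half_step r U))"
    unfolding q1_def by (rule bigo_half_step) (intro bigo_add bigo_cmul bigo_Yn bigo_Yk)
  moreover have "bigo 2 1 (\<lambda>r U. sL U * sL U)"
    using bigo_mult[OF bigo_sL bigo_sL] by (simp add: numeral_2_eq_2)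
  ultimately show ?thesis unfolding L1_def[abs_def] by (intro bigo_cmul bigo_diff)
qed

lemma bigo_G1: "bigo 2 1 G1"
proof -
  have "bigo 2 1 (\<lambda>r U. p1 r (half_step r U))"
    unfolding p1_def by (rule bigo_half_step) (intro bigo_add bigo_cmul bigo_Yn bigo_Yk)
  moreover have "bigo 2 1 (\<lambda>r U. sL U * sG U)"
    using bigo_mult[OF bigo_sL bigo_sG] by (simp add: numeral_2_eq_2)
  ultimately show ?thesis unfolding G1_def[abs_def] by (intro bigo_cmul bigo_diff bigo_L1)
qed

lemma causal_L1: "causal 1 L1" and causal_G1: "causal 1 G1"
proof -
  have "causal 1 (\<lambda>r U. Yn r (half_step r U))"
    unfolding causal_def
  proof (intro allI impI conjI)
    fix r U assume U: "adm U"
    then show "vz 1 (Yn r (half_step r U))" using causal_Yn adm_half_step by (auto simp: causal_def)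
    fix U' j assume "adm U'" "agree j j U U'"
    then show "vz (j + 1) (Yn r (half_step r U) - Yn r (half_step r U'))"
      using causal_Yn U adm_half_step agree_half_step agree_Suc unfolding causal_def by blast
  qed
  moreover have "causal 1 (\<lambda>r U. Yk r (half_step r U))"
    unfolding causal_def using Yk_props adm_half_step agree_half_step by auto
  ultimately have q: "causal 1 (\<lambda>r U. q1 r (half_step r U))" and p: "causal 1 (\<lambda>r U. p1 r (half_step r U))"
    unfolding p1_def q1_def by (simp_all add: causal_add causal_cmul)
  from q show L: "causal 1 L1"
    unfolding L1_def[abs_def] by (intro causal_cmul causal_diff causal_mult causal_sL)
  show "causal 1 G1"
    unfolding G1_def[abs_def]
    by (intro causal_cmul causal_diff causal_mult causal_sL causal_sG L p)
qed

lemma sca_LG: "adm U \<Longrightarrow> sca (L1 r U)" "adm U \<Longrightarrow> sca (G1 r U)"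
proof -
  assume U: "adm U"
  then have s: "sca (sL U)" "sca (sG U)" by (auto simp: adm_def)
  show L: "sca (L1 r U)"
    unfolding L1_def q1_def by (intro sca_mult sca_KK sca_diff sca_add sca_Y s)
  show "sca (G1 r U)"
    unfolding G1_def p1_def by (intro sca_mult sca_KK sca_diff sca_add sca_Y s L)
qed

lemma adm_step: "adm U \<Longrightarrow> adm (step r U)"
  using adm_half_step[of U r] sca_LG[of U r] causal_L1 causal_G1 by (simp add: adm_def causal_def)

lemma agree_step: "adm U \<Longrightarrow> adm U' \<Longrightarrow> agree j j U U' \<Longrightarrow> agree (Suc j) (Suc j) (step r U) (step r U')"
  using agree_half_step[of U U' j r] causal_L1 causal_G1 by (simp add: agree_def causal_def)

lemma small_step: "for_small (\<lambda>r U. small r (step r U))"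
proof -
  have "for_small (\<lambda>r U. nb 1 (L1 r U) (r ^ 1))"
    "for_small (\<lambda>r U. nb 1 (G1 r U) (r ^ 1))"
    using bigo_absorb[of 1] bigo_L1 bigo_G1 by (simp_all add: numeral_2_eq_2)
  then show ?thesis
    using small_half_step by eventually_elim (simp add: small_def)
qed

text \<open>As \<open>vz i\<close> controls the coefficients below i, coefficient j is final from
  iterate \<open>Suc j\<close> on, and the diagonal is the limit.\<close>

lemma fps_limit:
  fixes u :: "nat \<Rightarrow> tser"
  assumes "\<And>i. vz i (u i - u (Suc i))"
  defines "l \<equiv> Abs_fps (\<lambda>j. u (Suc j) $ j)"
  shows "vz i (l - u i)"
proof -
  have *: "u (i + d) $ j = u i $ j" if "j < i" for i j d
    using that
  proof (induction d)
    case (Suc d)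
    then show ?case using assms(1)[of "i + d"] by (auto simp: vz_def)
  qed simp
  show ?thesis
    unfolding vz_def
  proof (intro allI impI)
    fix j assume "j < i"
    then show "(l - u i) $ j = 0" using *[of j "Suc j" "i - Suc j"] by (simp add: l_def)
  qed
qed

lemma nb_limit: "(\<And>i. vz i (l - u i)) \<Longrightarrow> (\<And>i. nb m (u i) C) \<Longrightarrow> nb m l C"
  unfolding nb_def
proof
  fix J assume l: "\<And>i. vz i (l - u i)" and u: "\<And>i. \<forall>J. (\<Sum>j\<le>J. tnorm m (u i $ j)) \<le> C"
  have "l $ j = u (Suc J) $ j" if "j \<le> J" for j
    using l[of "Suc J"] that by (auto simp: vz_def)
  then show "(\<Sum>j\<le>J. tnorm m (l $ j)) \<le> C" using u[of "Suc J"] by simp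
qed

lemma fixed_point_ball:
  assumes r: "0 < r" and step: "\<And>U. small r U \<Longrightarrow> small r (step r U)"
  shows "\<exists>U. adm U \<and> small r U \<and> step r U = U"
proof -
  define u where "u i = (step r ^^ i) (State 0 0 0 0 0)" for i
  have u_Suc: "u (Suc i) = step r (u i)" for i by (simp add: u_def)
  have small: "small r (u i)" for i
  proof (induction i)
    case 0 show ?case using r by (simp add: u_def small_def nb_def)
  qed (simp add: u_Suc step)
  have adm: "adm (u i)" for i
  proof (induction i)
    case 0 show ?case by (simp add: u_def adm_def par_sca sca_def)
  qed (simp add: u_Suc adm_step)
  have ag: "agree i i (u i) (u (Suc i))" for i
  proof (induction i)
    case (Suc i) then show ?case using agree_step[OF adm adm, of i i "Suc i" r] by (simp only: u_Suc)
  qed (simp add: agree_def)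
  define lim where "lim f = Abs_fps (\<lambda>j. f (u (Suc j)) $ j)" for f :: "state \<Rightarrow> tser"
  define U where "U = State (lim sV) (lim sT) (lim sM) (lim sL) (lim sG)"
  have l: "vz i (lim sV - sV (u i))" "vz i (lim sT - sT (u i))" "vz i (lim sM - sM (u i))"
    "vz i (lim sL - sL (u i))" "vz i (lim sG - sG (u i))" for i
    unfolding lim_def by (rule fps_limit; use ag in \<open>simp add: agree_def\<close>)+
  have agU: "agree i i U (u i)" for i using l by (simp add: agree_def U_def)
  have sm: "small r U"
    using nb_limit[OF l(1), of 3 "r\<^sup>2"] nb_limit[OF l(2), of 1 "r\<^sup>2"] nb_limit[OF l(3), of 1 "r\<^sup>2"]
      nb_limit[OF l(4), of 1 r] nb_limit[OF l(5), of 1 r] small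
    by (simp add: small_def U_def)
  have P: "par True (lim sV)" "par True (lim sT)"
    using adm unfolding par_def adm_def lim_def by simp_all
  have S: "sca (lim sM)" "sca (lim sL)" "sca (lim sG)"
    using adm unfolding sca_def adm_def lim_def by simp_all
  have Z: "vz 1 (lim f)" if "\<And>i. vz 1 (f (u i))" for f
    using that by (auto simp: vz_def lim_def)
  have aU: "adm U"
    using P S Z adm by (simp add: adm_def U_def)
  \<comment> \<open>Both \<open>U\<close> and \<open>step r U\<close> agree with iterate i + 1 to
    order i + 1, for every i; hence they are equal.\<close>
  have ag2: "agree (Suc i) (Suc i) (step r U) (u (Suc i))" for i
    using agree_step[OF aU adm agU] by (simp add: u_Suc)
  have "vz i (f (step r U) - f U)" if "f = sV \<or> f = sT \<or> f = sM \<or> f = sL \<or> f = sG" for f i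
  proof -
    have a: "vz (Suc i) (f (step r U) - f (u (Suc i)))" "vz (Suc i) (f U - f (u (Suc i)))"
      using ag2[of i] agU[of "Suc i"] that by (auto simp: agree_def)
    from vz_diff[OF this] have "vz (Suc i) (f (step r U) - f U)" by simp
    then show ?thesis by (rule vz_mono) simp
  qed
  then have eq: "f (step r U) = f U" if "f = sV \<or> f = sT \<or> f = sM \<or> f = sL \<or> f = sG" for f
    using that by (intro vz_all_eq) auto
  have "step r U = U"
    using eq[of sV] eq[of sT] eq[of sM] eq[of sL] eq[of sG] by (intro state.expand conjI) simp_all
  with aU sm show "\<exists>U. adm U \<and> small r U \<and> step r U = U" by blast
qed

theorem fixed_point: "\<forall>\<^sub>F r in at_right 0. \<exists>U. adm U \<and> small r U \<and> step r U = U"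
  using small_step eventually_at_right_less[of 0] by eventually_elim (auto intro: fixed_point_ball)

end

section \<open>From the fixed point back to the surface equation\<close>

lemma surface_identity:
  fixes lam kap s W Q M c D J2 d rho Sq N2 :: "'a::comm_ring_1"
  shows "(lam + kap * (s * W) + s * s * Q)\<^sup>2 - (lam\<^sup>2 + s * M - c * (s * W)) * (1 + s * (2 * D + s * J2))
     - d * (1 + s * rho) * (s * (- Sq) + s * s * N2)
   = s * (2 * lam * kap * W + c * W - 2 * lam * lam * D + d * Sq - M
       + s * (2 * lam * Q + (kap * W + s * Q) * (kap * W + s * Q) - lam * lam * J2
          - (M - c * W) * (2 * D + s * J2) - d * N2 - d * rho * (- Sq + s * N2)))"
  by (simp add: algebra_simps power2_eq_square)

text \<open>\<open>H\<close> plays the role of 1/2, for which a commutative ring has no notation.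
  Doubling the hypothesis turns it into the expanded conclusion divided by s.\<close>

lemma sqrt_identity:
  fixes s D J2 rho H :: "'a::comm_ring_1"
  assumes "2 * H = 1"
    and "rho = - D - s * (H * rho * rho + H * J2 + H * (2 * rho + s * rho * rho) * (2 * D + s * J2))"
  shows "(1 + s * rho)\<^sup>2 * (1 + s * (2 * D + s * J2)) = 1"
proof -
  have aux: "a = - b - c \<Longrightarrow> a + b + c = 0" for a b c :: 'a by simp
  let ?X = "2 * D + s * J2" and ?Y = "2 * rho + s * rho * rho"
  have "2 * rho = 2 * (- D - s * (H * rho * rho + H * J2 + H * ?Y * ?X))"
    by (subst assms(2)[symmetric]) (rule refl)
  also have "\<dots> = - (2 * D) - s * ((2 * H) * (rho * rho + J2 + ?Y * ?X))"
    by (simp add: algebra_simps)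
  also have "\<dots> = - (2 * D) - s * (rho * rho + J2 + ?Y * ?X)"
    unfolding assms(1) by simp
  finally have "2 * rho + 2 * D + s * (rho * rho + J2 + ?Y * ?X) = 0"
    by (rule aux)
  then have "s * (2 * rho + 2 * D + s * (rho * rho + J2 + ?Y * ?X)) = 0" by simp
  then show ?thesis by (simp add: algebra_simps power2_eq_square)
qed

context wave_series
begin

definition surfP :: "tser \<Rightarrow> tser \<Rightarrow> tser \<Rightarrow> tser" where
  "surfP lam kap w = lam
     - (kap - KK gAh) * (KK (1 / (2 * h)) * cof 0 (w * w) - w + KK (1 / 2) * dd (w * w) - w * dd w)
     - KK gA2 * (KK (1 / (3 * h)) * cof 0 (w * w * w) - cof 0 (w * w) - w * w - KK (2 * h) * w
        + KK (1 / 3) * dd (w * w * w) - w * w * dd w + KK h * dd (w * w) - KK (2 * h) * (w * dd w))"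

definition surfJ :: "tser \<Rightarrow> tser" where
  "surfJ w = (1 + dd w)\<^sup>2 - dl w * dl w"

definition surfN :: "tser \<Rightarrow> tser" where
  "surfN w = - dq w - dd w * dq w + dl w * dld w"

context
  fixes s W :: tser
  assumes s: "sca s"
begin

lemma pull: "mop c (s * X) = s * mop c X" "cof l (s * X) = s * cof l X"
  using s by (simp_all add: mop_sca_mult cof_sca_mult)
lemma pull2: "mop c (s * s * X) = s * s * mop c X" "cof l (s * s * X) = s * s * cof l X"
    "mop c (s * s * s * X) = s * s * s * mop c X" "cof l (s * s * s * X) = s * s * s * cof l X"
  using s by (simp_all add: mop_sca_mult cof_sca_mult sca_mult)

text \<open>The two terms linear in w, (kap - gAh) w and 2 h gA2 w, add up to kap w. This is why
  beta enters the problem through kappa = beta + A g h.\<close>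

lemma surfP_scale:
  assumes "gAh = 2 * h * gA2"
  shows "surfP lam kap (s * W) = lam + kap * (s * W) + s * s * Qf s W kap"
proof -
  have w: "s * W * (s * W) = s * s * (W * W)" "s * s * (W * W) * (s * W) = s * s * s * (W * W * W)"
    by (simp_all add: mult_ac)
  have g: "KK gAh = KK gA2 * KK (2 * h)"
    using assms by (simp add: mult_ac flip: KK_mult)
  show ?thesis
    unfolding surfP_def w pull pull2 Qf_def g
    by (simp add: algebra_simps)
qed

lemma surfJ_scale: "surfJ (s * W) = 1 + s * (2 * dd W + s * J2f W)"
  unfolding surfJ_def J2f_def pull by (simp add: algebra_simps power2_eq_square)

lemma surfN_scale: "surfN (s * W) = s * (- dq W) + s * s * N2f W"
  unfolding surfN_def N2f_def pull by (simp add: algebra_simps)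

end

definition ell :: "int \<Rightarrow> real" where
  "ell j = 2 * (lam0 * kap0 + gB - lam0\<^sup>2 * dm j + \<sigma> * (real_of_int j * real_of_int j))"

context
  fixes r :: real and U :: state
  assumes U: "adm U" "step r U = U"
    and lam0: "lam0 \<noteq> 0"
    and phi_0: "lookup phi0 0 = 0" "lookup phi1 0 = 0"
    and sm_0: "sm 0 = 0" and dm_0: "dm 0 = 0"
    and regular: "\<And>j. sm j \<noteq> 0 \<Longrightarrow> sm j * ell j = 1 \<and> lookup phi0 j = 0 \<and> lookup phi1 j = 0"
    and kernel: "\<And>j. j \<noteq> 0 \<Longrightarrow> sm j = 0 \<Longrightarrow> ell j = 0 \<and>
      (KK (2 * lookup phi0 j) + ss r * KK (2 * lookup phi1 j)) * (p1 r U - KK (dm j) * q1 r U)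
        = - (ss r * cof j (Ru r U))"
begin

lemma fixed_eqs:
  "sV U = V1 r U" "sT U = tau1 r U" "sM U = M1 r U" "sL U = L1 r U" "sG U = G1 r U" "half_step r U = U"
proof -
  show *: "sV U = V1 r U" "sT U = tau1 r U" "sM U = M1 r U" "sL U = L1 r U" "sG U = G1 r U"
    using U(2) by (metis step_sel)+
  show "half_step r U = U" by (intro state.expand) (simp add: * flip: step_sel)
qed

text \<open>At a fixed point the half step is the identity, and the formulas for \<open>L1\<close>
  and \<open>G1\<close> can be solved back for \<open>qu\<close> and \<open>pu\<close>.\<close>

lemma pu_eq: "pu U = p1 r U" and qu_eq: "qu U = q1 r U"
proof -
  have "KK (2 * lam0) * KK (1 / (2 * lam0)) = 1" "KK lam0 * KK (1 / lam0) = 1"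
    using lam0 by (simp_all flip: KK_mult)
  moreover have "sL U = KK (1 / (2 * lam0)) * (q1 r U - sL U * sL U)"
    "sG U = KK (1 / lam0) * (p1 r U - KK kap0 * sL U - sL U * sG U)"
    using fixed_eqs by (simp_all add: L1_def G1_def)
  ultimately show "pu U = p1 r U" "qu U = q1 r U"
    unfolding pu_def qu_def by algebra+
qed

lemma rho_eq: "rhou U = - dd (Wu r U) - ss r * Tu r U"
proof -
  have "sT U = - (ss r * dd (fps_const phi1)) - dd (sV U) - ss r * Tu r U"
    using fixed_eqs(1,2) by (simp add: tau1_def)
  then show ?thesis
    by (simp add: rhou_def Wu_def mop_add mop_sca_mult)
qed

lemma cof_fps_const: "cof j (fps_const p) = KK (lookup p j)"
  by (auto simp: fps_eq_iff KK_def)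

lemma cof_Wu: "cof j (Wu r U) = KK (lookup phi0 j) + ss r * KK (lookup phi1 j) + cof j (sV U)"
  by (simp add: Wu_def cof_add cof_sca_mult cof_fps_const)

lemma cof_V:
  "cof j (sV U) = - (KK (sm j) * (KK 2 * (pu U * cof j (sV U)) - KK 2 * (qu U * (KK (dm j) * cof j (sV U)))
      + ss r * cof j (Ru r U)))"
  using adm_sca[OF U(1)]
  by (subst fixed_eqs(1))
    (simp add: V1_def cof_minus cof_mop cof_add cof_diff cof_sca_mult del: KK_numeral)

text \<open>Mode by mode: j = 0 is the equation for \<open>sM\<close>, a kernel mode is the
  hypothesis \<open>kernel\<close> (where \<open>sV\<close> has no component), and on the remaining
  modes \<open>sm j\<close> is the inverse of \<open>ell j\<close>.\<close>

lemma linear_eq_cof: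
  "KK (ell j) * cof j (Wu r U) + KK 2 * (pu U * cof j (Wu r U)) - KK 2 * (qu U * (KK (dm j) * cof j (Wu r U)))
     - cof j (sM U) + ss r * cof j (Ru r U) = 0"
proof (cases "sm j = 0")
  case True
  have V: "cof j (sV U) = 0" by (subst cof_V) (simp add: True)
  show ?thesis
  proof (cases "j = 0")
    case j: True
    have "cof 0 (sM U) = ss r * cof 0 (Ru r U)"
      using fixed_eqs(3) by (simp add: M1_def cof_sca_mult cof_sca)
    then show ?thesis using V by (simp add: j cof_Wu phi_0)
  next
    case False
    have "cof j (sM U) = 0" using U(1) False by (simp add: adm_def cof_sca_0)
    moreover have "KK 2 * (pu U * cof j (Wu r U)) - KK 2 * (qu U * (KK (dm j) * cof j (Wu r U)))
      = (KK (2 * lookup phi0 j) + ss r * KK (2 * lookup phi1 j)) * (p1 r U - KK (dm j) * q1 r U)"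
      by (simp add: cof_Wu V pu_eq qu_eq KK_mult algebra_simps)
    ultimately show ?thesis using kernel[OF False True] by (simp del: KK_numeral)
  qed
next
  case False
  then have j: "j \<noteq> 0" using sm_0 by auto
  have "cof j (sM U) = 0" using U(1) j by (simp add: adm_def cof_sca_0)
  moreover have "cof j (Wu r U) = cof j (sV U)" using regular[OF False] by (simp add: cof_Wu)
  moreover have "KK (sm j) * KK (ell j) = 1" using regular[OF False] by (simp flip: KK_mult)
  ultimately show ?thesis using cof_V[of j] by algebra
qed

lemma mop_ell: "mop ell X = KK (2 * (lam0 * kap0 + gB)) * X - KK (2 * lam0\<^sup>2) * dd X + KK (2 * \<sigma>) * dq X"
proof (rule tser_eqI)
  fix j
  have "cof j (KK (2 * (lam0 * kap0 + gB)) * X - KK (2 * lam0\<^sup>2) * dd X + KK (2 * \<sigma>) * dq X)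
    = KK (2 * (lam0 * kap0 + gB)) * cof j X - KK (2 * lam0\<^sup>2) * (KK (dm j) * cof j X)
      + KK (2 * \<sigma>) * (KK (real_of_int j * real_of_int j) * cof j X)"
    by (simp only: cof_add cof_diff cof_sca_mult[OF sca_KK] cof_mop)
  also have "\<dots> = cof j (mop ell X)"
    unfolding cof_mop ell_def KK_mult KK_add KK_diff by (simp add: algebra_simps)
  finally show "cof j (mop ell X) = cof j (KK (2 * (lam0 * kap0 + gB)) * X - KK (2 * lam0\<^sup>2) * dd X + KK (2 * \<sigma>) * dq X)" by simp
qed

lemma linear_eq:
  "2 * lamu U * kapu U * Wu r U + KK (2 * gB) * Wu r U - 2 * lamu U * lamu U * dd (Wu r U)
     + KK (2 * \<sigma>) * dq (Wu r U) - sM U + ss r * Ru r U = 0"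
proof -
  have "mop ell (Wu r U) + KK 2 * (pu U * Wu r U) - KK 2 * (qu U * dd (Wu r U)) - sM U + ss r * Ru r U = 0"
    by (rule tser_eqI)
      (use adm_sca[OF U(1)] linear_eq_cof in \<open>simp add: cof_add cof_diff cof_sca_mult cof_mop mult_ac del: KK_numeral\<close>,
       simp add: fps_eq_iff cof_def)
  moreover have "lamu U * kapu U = KK (lam0 * kap0) + pu U" "lamu U * lamu U = KK (lam0\<^sup>2) + qu U"
    by (simp_all add: lamu_def kapu_def pu_def qu_def KK_mult algebra_simps power2_eq_square)
  ultimately show ?thesis
    unfolding mop_ell KK_mult KK_add KK_numeral by algebra
qed

theorem surface_eq:
  assumes "gAh = 2 * h * gA2"
  defines "w \<equiv> ss r * Wu r U" and "rt \<equiv> 1 + ss r * rhou U"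
  shows "rt\<^sup>2 * surfJ w = 1"
    "(surfP (lamu U) (kapu U) w)\<^sup>2 - ((lamu U)\<^sup>2 + ss r * sM U - KK (2 * gB) * w) * surfJ w
      - KK (2 * \<sigma>) * rt * surfN w = 0"
proof -
  have "2 * KK (1 / 2) = 1" using KK_mult[of 2 "1 / 2"] by simp
  then show "rt\<^sup>2 * surfJ w = 1"
    unfolding rt_def w_def surfJ_scale[OF sca_ss]
    by (rule sqrt_identity) (subst rho_eq, simp add: Tu_def Tf_def)
  show "(surfP (lamu U) (kapu U) w)\<^sup>2 - ((lamu U)\<^sup>2 + ss r * sM U - KK (2 * gB) * w) * surfJ w
      - KK (2 * \<sigma>) * rt * surfN w = 0"
    using linear_eq
    unfolding rt_def w_def surfJ_scale[OF sca_ss] surfN_scale[OF sca_ss] surfP_scale[OF sca_ss assms(1)]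
      surface_identity
    by (simp add: Ru_def Rf_def)
qed

end

end

\<comment> \<open>From here on a sum sign without a range denotes an infinite series, not the sum
  \<open>Sum_any\<close> over a finite support.\<close>
no_syntax
  "_Sum_any" :: "pttrn \<Rightarrow> 'a \<Rightarrow> 'a::comm_monoid_add"  (\<open>(\<open>indent=2 notation=\<open>binder \<Sum>\<close>\<close>\<Sum>_. _)\<close> [0, 10] 10)

section \<open>Evaluation of absolutely convergent series\<close>

definition asum :: "nat \<Rightarrow> tser \<Rightarrow> bool" where
  "asum i U \<longleftrightarrow> summable (\<lambda>j. tnorm i (U $ j))"

lemma nb_imp_asum:
  assumes "nb i U C" shows "asum i U"
  unfolding asum_def
proof (rule summableI_nonneg_bounded)
  fix n
  have "(\<Sum>j<n. tnorm i (U $ j)) \<le> (\<Sum>j\<le>n. tnorm i (U $ j))"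
    by (rule sum_mono2) auto
  then show "(\<Sum>j<n. tnorm i (U $ j)) \<le> C"
    using assms by (auto simp: nb_def intro: order.trans)
qed simp

lemma asum_imp_nb: "asum i U \<Longrightarrow> nb i U (\<Sum>j. tnorm i (U $ j))"
  unfolding asum_def nb_def by (auto intro: sum_le_suminf)

lemma asum_iff: "asum i U \<longleftrightarrow> (\<exists>C. nb i U C)"
  using nb_imp_asum asum_imp_nb by blast

lemma asum_add: "asum i U \<Longrightarrow> asum i V \<Longrightarrow> asum i (U + V)"
  unfolding asum_iff using nb_add by blast
lemma asum_minus: "asum i U \<Longrightarrow> asum i (- U)"
  unfolding asum_iff using nb_minus by blast
lemma asum_diff: "asum i U \<Longrightarrow> asum i V \<Longrightarrow> asum i (U - V)"
  unfolding asum_iff using nb_diff by blast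
lemma asum_mult: "asum i U \<Longrightarrow> asum i V \<Longrightarrow> asum i (U * V)"
  unfolding asum_iff using nb_mult by blast
lemma asum_mono: "asum i U \<Longrightarrow> i' \<le> i \<Longrightarrow> asum i' U"
  unfolding asum_iff using nb_weaken by blast
lemma asum_KK: "asum i (KK c)"
  unfolding asum_iff using nb_KK by blast
lemma asum_one: "asum i 1"
  using asum_KK[of i 1] by simp
lemma asum_cof: "asum j U \<Longrightarrow> asum i (cof k U)"
  unfolding asum_iff using nb_cof by blast
lemma asum_mop:
  assumes "\<And>k. \<bar>c k\<bar> * wt k ^ i \<le> C * wt k ^ j" "asum j U"
  shows "asum i (mop c U)"
  using assms(2) nb_mop[of c i C j, OF assms(1)] unfolding asum_iff by blast

text \<open>Complex evaluation is a ring homomorphism, so the product rules for the cosine part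
  \<open>tc\<close> and the sine part \<open>ts\<close> are read off as real and imaginary parts,
  without addition theorems.\<close>

definition tev :: "trig \<Rightarrow> real \<Rightarrow> complex" where
  "tev p x = linsum complex_of_real (\<lambda>k. cis (real_of_int k * x)) p"

definition tc :: "trig \<Rightarrow> real \<Rightarrow> real" where
  "tc p x = (\<Sum>k\<in>keys p. lookup p k * cos (real_of_int k * x))"
definition ts :: "trig \<Rightarrow> real \<Rightarrow> real" where
  "ts p x = (\<Sum>k\<in>keys p. lookup p k * sin (real_of_int k * x))"

lemma tev_eq: "tev p x = Complex (tc p x) (ts p x)"
  by (rule complex_eqI) (simp_all add: tev_def linsum_def tc_def ts_def)

lemma tc_superset: "finite S \<Longrightarrow> keys p \<subseteq> S \<Longrightarrow> tc p x = (\<Sum>k\<in>S. lookup p k * cos (real_of_int k * x))"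
  unfolding tc_def by (rule sum.mono_neutral_left) (auto simp: in_keys_iff)
lemma ts_superset: "finite S \<Longrightarrow> keys p \<subseteq> S \<Longrightarrow> ts p x = (\<Sum>k\<in>S. lookup p k * sin (real_of_int k * x))"
  unfolding ts_def by (rule sum.mono_neutral_left) (auto simp: in_keys_iff)

lemma tc_bound: "\<bar>tc p x\<bar> \<le> tnorm 0 p"
  unfolding tc_def tnorm_def
  by (rule order.trans[OF sum_abs], rule sum_mono) (simp add: abs_mult mult_left_le)
lemma ts_bound: "\<bar>ts p x\<bar> \<le> tnorm 0 p"
  unfolding ts_def tnorm_def
  by (rule order.trans[OF sum_abs], rule sum_mono) (simp add: abs_mult mult_left_le)

lemma norm_tev: "norm (tev p x) \<le> tnorm 0 p"
  unfolding tev_def linsum_def tnorm_def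
  by (rule order.trans[OF norm_sum], rule sum_mono) (simp add: norm_mult)

lemma tev_add: "tev (p + q) x = tev p x + tev q x"
  unfolding tev_def by (rule linsum_add) simp
lemma tev_mult: "tev (p * q) x = tev p x * tev q x"
  unfolding tev_def by (rule linsum_mult) (auto simp: cis_mult distrib_right)
lemma tev_sum: "tev (sum f S) x = (\<Sum>i\<in>S. tev (f i) x)"
  unfolding tev_def by (rule linsum_sum) simp
lemma tev_zero [simp]: "tev 0 x = 0" by (simp add: tev_def)
lemma tev_minus: "tev (- p) x = - tev p x"
  using tev_add[of p "- p" x] by (simp add: eq_neg_iff_add_eq_0 add.commute)
lemma tev_const: "tev (single 0 c) x = complex_of_real c"
  by (simp add: tev_def linsum_single)

definition ev :: "tser \<Rightarrow> real \<Rightarrow> complex" where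
  "ev U x = (\<Sum>j. tev (U $ j) x)"
definition rc :: "tser \<Rightarrow> real \<Rightarrow> real" where "rc U x = (\<Sum>j. tc (U $ j) x)"
definition rs :: "tser \<Rightarrow> real \<Rightarrow> real" where "rs U x = (\<Sum>j. ts (U $ j) x)"

lemma summable_tev: "asum i U \<Longrightarrow> summable (\<lambda>j. norm (tev (U $ j) x))"
  unfolding asum_def
  by (rule summable_comparison_test'[of _ 0]) (auto intro: order.trans[OF norm_tev] tnorm_mono)
lemma summable_tev': "asum i U \<Longrightarrow> summable (\<lambda>j. tev (U $ j) x)"
  by (rule summable_norm_cancel) (rule summable_tev)
lemma summable_tc: "asum i U \<Longrightarrow> summable (\<lambda>j. tc (U $ j) x)"
  using summable_Re[OF summable_tev'[of i U x]] by (simp add: tev_eq)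
lemma summable_ts: "asum i U \<Longrightarrow> summable (\<lambda>j. ts (U $ j) x)"
  using summable_Im[OF summable_tev'[of i U x]] by (simp add: tev_eq)

lemma ev_eq: "asum i U \<Longrightarrow> ev U x = Complex (rc U x) (rs U x)"
  unfolding ev_def rc_def rs_def
  using Re_suminf[OF summable_tev'[of i U x]] Im_suminf[OF summable_tev'[of i U x]]
  by (intro complex_eqI) (simp_all add: tev_eq)

lemma ev_add: "asum i U \<Longrightarrow> asum i V \<Longrightarrow> ev (U + V) x = ev U x + ev V x"
  unfolding ev_def by (simp add: tev_add suminf_add[OF summable_tev' summable_tev'])
lemma ev_minus: "asum i U \<Longrightarrow> ev (- U) x = - ev U x"
  unfolding ev_def by (simp add: tev_minus suminf_minus[OF summable_tev'])

lemma ev_mult: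
  assumes "asum i U" "asum i V" shows "ev (U * V) x = ev U x * ev V x"
proof -
  have "ev U x * ev V x = (\<Sum>k. \<Sum>i\<le>k. tev (U $ i) x * tev (V $ (k - i)) x)"
    unfolding ev_def by (rule Cauchy_product[OF summable_tev[OF assms(1)] summable_tev[OF assms(2)]])
  then show ?thesis
    by (simp add: ev_def fps_mult_nth tev_sum tev_mult atLeast0AtMost)
qed

lemma ev_KK: "ev (KK c) x = complex_of_real c"
proof -
  have "(\<lambda>j. tev (KK c $ j) x) sums (\<Sum>j\<in>{0}. tev (KK c $ j) x)"
    by (rule sums_finite) (auto simp: KK_def)
  then show ?thesis by (simp add: ev_def sums_iff KK_def tev_const)
qed

lemma rc_add: "asum i U \<Longrightarrow> asum i V \<Longrightarrow> rc (U + V) x = rc U x + rc V x"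
  using ev_add[of i U V x] by (simp add: ev_eq[of i] asum_add complex_eq_iff)
lemma rc_minus: "asum i U \<Longrightarrow> rc (- U) x = - rc U x"
  using ev_minus[of i U x] by (simp add: ev_eq[of i] asum_minus complex_eq_iff)
lemma rs_minus: "asum i U \<Longrightarrow> rs (- U) x = - rs U x"
  using ev_minus[of i U x] by (simp add: ev_eq[of i] asum_minus complex_eq_iff)
lemma rc_diff: "asum i U \<Longrightarrow> asum i V \<Longrightarrow> rc (U - V) x = rc U x - rc V x"
  using rc_add[of i U "- V" x] rc_minus[of i V x] asum_minus[of i V] by simp
lemma rc_KK: "rc (KK c) x = c"
  using ev_KK[of c x] by (simp add: ev_eq[OF asum_KK[of 0]] complex_eq_iff)

lemma ts_even: assumes "parity True p" shows "ts p x = 0"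
proof -
  let ?S = "keys p \<union> uminus ` keys p"
  have "ts p x = (\<Sum>k\<in>?S. lookup p k * sin (real_of_int k * x))" by (rule ts_superset) auto
  also have "\<dots> = (\<Sum>k\<in>?S. lookup p (- k) * sin (real_of_int (- k) * x))"
    by (rule sum.reindex_bij_witness[of _ uminus uminus]) auto
  also have "\<dots> = - (\<Sum>k\<in>?S. lookup p k * sin (real_of_int k * x))"
    using assms by (simp add: parity_iff sum_negf)
  also have "(\<Sum>k\<in>?S. lookup p k * sin (real_of_int k * x)) = ts p x"
    by (rule ts_superset[symmetric]) auto
  finally show "ts p x = 0" by simp
qed

lemma tc_odd: assumes p: "parity False p'" shows "tc p' x = 0"
proof -
  let ?S = "keys p' \<union> uminus ` keys p'"
  have "tc p' x = (\<Sum>k\<in>?S. lookup p' k * cos (real_of_int k * x))" by (rule tc_superset) auto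
  also have "\<dots> = (\<Sum>k\<in>?S. lookup p' (- k) * cos (real_of_int (- k) * x))"
    by (rule sum.reindex_bij_witness[of _ uminus uminus]) auto
  also have "\<dots> = - (\<Sum>k\<in>?S. lookup p' k * cos (real_of_int k * x))"
    using p by (simp add: parity_iff sum_negf)
  also have "(\<Sum>k\<in>?S. lookup p' k * cos (real_of_int k * x)) = tc p' x"
    by (rule tc_superset[symmetric]) auto
  finally show "tc p' x = 0" by simp
qed

lemma rs_even: "par True U \<Longrightarrow> rs U x = 0" and rc_odd: "par False U \<Longrightarrow> rc U x = 0"
  by (simp_all add: rs_def rc_def par_def ts_even tc_odd)

lemma rc_mult_even:
  assumes "asum i U" "asum i V" "par True U" "par True V"
  shows "rc (U * V) x = rc U x * rc V x"
  using ev_mult[OF assms(1,2), of x] rs_even[of U x] rs_even[of V x] assms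
  by (simp add: ev_eq[of i] asum_mult complex_eq_iff)

text \<open>An odd series evaluates to i times its sine part, and i * i = -1. This is the sign
  behind \<open>surfJ\<close> and \<open>surfN\<close>.\<close>

lemma rc_mult_odd:
  assumes "asum i U" "asum i V" "par False U" "par False V"
  shows "rc (U * V) x = - (rs U x * rs V x)"
  using ev_mult[OF assms(1,2), of x] rc_odd[of U x] rc_odd[of V x] assms
  by (simp add: ev_eq[of i] asum_mult complex_eq_iff)

lemma norm_ev_le:
  assumes "asum 0 U" shows "norm (ev U x) \<le> (\<Sum>j. tnorm 0 (U $ j))"
  unfolding ev_def
  using suminf_le[OF norm_tev summable_tev[OF assms]] assms
  by (intro order.trans[OF summable_norm[OF summable_tev[OF assms]]]) (auto simp: asum_def)

lemma abs_rc_le: "asum 0 U \<Longrightarrow> \<bar>rc U x\<bar> \<le> (\<Sum>j. tnorm 0 (U $ j))"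
  using norm_ev_le[of U x] abs_Re_le_cmod[of "ev U x"] by (simp add: ev_eq)
lemma abs_rs_le: "asum 0 U \<Longrightarrow> \<bar>rs U x\<bar> \<le> (\<Sum>j. tnorm 0 (U $ j))"
  using norm_ev_le[of U x] abs_Im_le_cmod[of "ev U x"] by (simp add: ev_eq)

subsection \<open>Derivatives\<close>

abbreviation dx :: "tser \<Rightarrow> tser" where "dx \<equiv> mop real_of_int"

lemma asum_dx: "asum (Suc i) U \<Longrightarrow> asum i (dx U)"
  by (rule asum_mop[of _ _ 1 "Suc i"]) (simp_all add: mult_right_mono)

lemma tc_tmul: "tc (tmul c p) x = (\<Sum>k\<in>keys p. c k * lookup p k * cos (real_of_int k * x))"
  using tc_superset[OF finite_keys keys_tmul] by simp
lemma ts_tmul: "ts (tmul c p) x = (\<Sum>k\<in>keys p. c k * lookup p k * sin (real_of_int k * x))"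
  using ts_superset[OF finite_keys keys_tmul] by simp

lemma tc_deriv: "(tc p has_field_derivative - ts (tmul real_of_int p) x) (at x within S)"
  unfolding tc_def[abs_def] ts_tmul
  by (auto intro!: derivative_eq_intros sum.cong simp: sum_negf[symmetric] mult_ac)
lemma ts_deriv: "(ts p has_field_derivative tc (tmul real_of_int p) x) (at x within S)"
  unfolding ts_def[abs_def] tc_tmul
  by (auto intro!: derivative_eq_intros sum.cong simp: mult_ac)

lemma rc_deriv:
  assumes "asum 1 U"
  shows "(rc U has_field_derivative - rs (dx U) x) (at x)"
proof -
  have s: "summable (\<lambda>n. tnorm 0 (dx U $ n))"
    using asum_dx[of 0 U] assms by (simp add: asum_def)
  have "((\<lambda>x. \<Sum>n. tc (U $ n) x) has_field_derivative (\<Sum>n. - ts (dx U $ n) x)) (at x)"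
  proof (rule has_field_derivative_series'(2)[of UNIV])
    show "uniformly_convergent_on UNIV (\<lambda>n x. \<Sum>i<n. - ts (dx U $ i) x)"
      using Weierstrass_m_test[of UNIV "\<lambda>n x. - ts (dx U $ n) x" "\<lambda>n. tnorm 0 (dx U $ n)"] s ts_bound
      unfolding uniformly_convergent_on_def by auto
    show "summable (\<lambda>n. tc (U $ n) 0)" by (rule summable_tc[OF assms])
  qed (auto intro: tc_deriv)
  also have "(\<Sum>n. - ts (dx U $ n) x) = - rs (dx U) x"
    unfolding rs_def using asum_dx[of 0 U] assms by (intro suminf_minus summable_ts) auto
  finally show ?thesis by (simp add: rc_def[abs_def])
qed

lemma rs_deriv:
  assumes "asum 1 U"
  shows "(rs U has_field_derivative rc (dx U) x) (at x)"
proof -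
  have s: "summable (\<lambda>n. tnorm 0 (dx U $ n))"
    using asum_dx[of 0 U] assms by (simp add: asum_def)
  have "((\<lambda>x. \<Sum>n. ts (U $ n) x) has_field_derivative (\<Sum>n. tc (dx U $ n) x)) (at x)"
  proof (rule has_field_derivative_series'(2)[of UNIV])
    show "uniformly_convergent_on UNIV (\<lambda>n x. \<Sum>i<n. tc (dx U $ i) x)"
      using Weierstrass_m_test[of UNIV "\<lambda>n x. tc (dx U $ n) x" "\<lambda>n. tnorm 0 (dx U $ n)"] s tc_bound
      unfolding uniformly_convergent_on_def by auto
    show "summable (\<lambda>n. ts (U $ n) 0)" by (rule summable_ts[OF assms])
  qed (auto intro: ts_deriv)
  then show ?thesis by (simp add: rc_def rs_def[abs_def])
qed

lemma deriv_rc: "asum 1 U \<Longrightarrow> deriv (rc U) = (\<lambda>x. - rs (dx U) x)"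
  using rc_deriv by (intro ext DERIV_imp_deriv)
lemma deriv_deriv_rc: "asum 2 U \<Longrightarrow> deriv (deriv (rc U)) = (\<lambda>x. - rc (dx (dx U)) x)"
  using asum_dx[of 1 U] asum_mono[of 2 U 1] rs_deriv[of "dx U"]
  by (intro ext DERIV_imp_deriv) (auto simp: deriv_rc numeral_2_eq_2 intro!: derivative_eq_intros)

subsection \<open>Fourier coefficients\<close>

definition fc :: "tser \<Rightarrow> int \<Rightarrow> real" where
  "fc U k = (\<Sum>j. lookup (U $ j) k)"

lemma summable_lookup: "asum i U \<Longrightarrow> summable (\<lambda>j. lookup (U $ j) k)"
  unfolding asum_def
  by (rule summable_comparison_test'[of _ 0]) (auto intro: lookup_le_tnorm)

lemma integral_series:
  fixes f :: "nat \<Rightarrow> real \<Rightarrow> complex"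
  assumes c: "\<And>j. continuous_on {a..b} (f j)" and M: "\<And>j x. norm (f j x) \<le> M j" "summable M"
    and I: "\<And>j. (f j has_integral I j) {a..b}"
  shows "((\<lambda>x. \<Sum>j. f j x) has_integral (\<Sum>j. I j)) {a..b}"
proof -
  have u: "uniform_limit {a..b} (\<lambda>n x. \<Sum>j<n. f j x) (\<lambda>x. \<Sum>j. f j x) sequentially"
    by (rule Weierstrass_m_test[OF _ M(2)]) (use M(1) in auto)
  obtain I' J where J: "\<And>n. ((\<lambda>x. \<Sum>j<n. f j x) has_integral I' n) {a..b}"
    "((\<lambda>x. \<Sum>j. f j x) has_integral J) {a..b}" "I' \<longlonglongrightarrow> J"
    using uniform_limit_integral[OF u] c by (metis continuous_on_sum sequentially_bot)
  have "I' n = (\<Sum>j<n. I j)" for n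
    using J(1) has_integral_sum[of "{..<n}" f I "{a..b}"] I by (metis finite_lessThan has_integral_unique)
  then have "I' = (\<lambda>n. \<Sum>j<n. I j)" by (rule ext)
  then have "I sums J" using J(3) by (simp add: sums_def)
  then show ?thesis using J(2) by (simp add: sums_iff)
qed

lemma integral_cos_int:
  "((\<lambda>x. cos (real_of_int j * x)) has_integral (if j = 0 then 2 * pi else 0)) {-pi..pi}"
proof (cases "j = 0")
  case True then show ?thesis using has_integral_const_real[of "1::real" "-pi" pi] by simp
next
  case False
  have "((\<lambda>x. cos (real_of_int j * x)) has_integral (sin (real_of_int j * pi) / real_of_int j - sin (real_of_int j * (- pi)) / real_of_int j)) {-pi..pi}"
    by (rule fundamental_theorem_of_calculus)
      (use False in \<open>auto intro!: derivative_eq_intros simp flip: has_real_derivative_iff_has_vector_derivative\<close>)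
  then show ?thesis using False by (simp add: sin_npi_int mult.commute)
qed

lemma integral_sin_int: "((\<lambda>x. sin (real_of_int j * x)) has_integral 0) {-pi..pi}"
proof (cases "j = 0")
  case False
  have "((\<lambda>x. sin (real_of_int j * x)) has_integral (- cos (real_of_int j * pi) / real_of_int j - - cos (real_of_int j * (- pi)) / real_of_int j)) {-pi..pi}"
    by (rule fundamental_theorem_of_calculus)
      (use False in \<open>auto intro!: derivative_eq_intros simp flip: has_real_derivative_iff_has_vector_derivative\<close>)
  then show ?thesis by simp
qed simp

lemma integral_cis_int:
  "((\<lambda>x. cis (real_of_int j * x)) has_integral complex_of_real (if j = 0 then 2 * pi else 0)) {-pi..pi}"
proof -
  have "((\<lambda>x. complex_of_real (cos (real_of_int j * x)) + \<i> * complex_of_real (sin (real_of_int j * x))) has_integral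
      complex_of_real (if j = 0 then 2 * pi else 0) + \<i> * complex_of_real 0) {-pi..pi}"
    using has_integral_linear[OF integral_cos_int[of j] bounded_linear_of_real]
      has_integral_linear[OF integral_sin_int[of j] bounded_linear_of_real]
    by (intro has_integral_add has_integral_mult_right) (simp_all add: o_def)
  moreover have "complex_of_real (cos y) + \<i> * complex_of_real (sin y) = cis y" for y
    by (simp add: complex_eq_iff)
  ultimately show ?thesis by simp
qed

lemma integral_tev:
  "((\<lambda>x. tev p x * cis (real_of_int m * x)) has_integral complex_of_real (2 * pi * lookup p (- m))) {-pi..pi}"
proof -
  have "((\<lambda>x. \<Sum>k\<in>keys p. complex_of_real (lookup p k) * cis (real_of_int (k + m) * x)) has_integral
     (\<Sum>k\<in>keys p. complex_of_real (lookup p k) * complex_of_real (if k + m = 0 then 2 * pi else 0))) {-pi..pi}"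
    by (intro has_integral_sum has_integral_mult_right integral_cis_int) auto
  also have "(\<Sum>k\<in>keys p. complex_of_real (lookup p k) * complex_of_real (if k + m = 0 then 2 * pi else 0))
     = (\<Sum>k\<in>keys p. if k = - m then complex_of_real (2 * pi * lookup p (- m)) else 0)"
    by (intro sum.cong) auto
  also have "\<dots> = complex_of_real (2 * pi * lookup p (- m))"
    by (simp add: in_keys_iff)
  finally show ?thesis
    by (simp add: tev_def linsum_def sum_distrib_right distrib_right cis_mult mult.assoc)
qed

lemma integral_ev:
  assumes "asum 0 U"
  shows "((\<lambda>x. ev U x * cis (real_of_int m * x)) has_integral complex_of_real (2 * pi * fc U (- m))) {-pi..pi}"
proof -
  have "((\<lambda>x. \<Sum>j. tev (U $ j) x * cis (real_of_int m * x)) has_integral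
      (\<Sum>j. complex_of_real (2 * pi * lookup (U $ j) (- m)))) {-pi..pi}"
  proof (rule integral_series)
    show "continuous_on {-pi..pi} (\<lambda>x. tev (U $ j) x * cis (real_of_int m * x))" for j
      unfolding tev_def linsum_def by (intro continuous_intros)
    show "norm (tev (U $ j) x * cis (real_of_int m * x)) \<le> tnorm 0 (U $ j)" for j x
      using norm_tev by (simp add: norm_mult)
  qed (use assms integral_tev in \<open>auto simp: asum_def\<close>)
  moreover have "(\<Sum>j. complex_of_real (2 * pi * lookup (U $ j) (- m))) = complex_of_real (2 * pi * fc U (- m))"
    unfolding fc_def using summable_lookup[OF assms]
    by (simp add: suminf_of_real[symmetric] summable_mult suminf_mult flip: of_real_mult)
  ultimately show ?thesis by (simp add: ev_def suminf_mult2[OF summable_tev'[OF assms]])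
qed

lemma mean_rc: "asum 0 U \<Longrightarrow> mean (rc U) = fc U 0"
  using has_integral_linear[OF integral_ev[of U 0] bounded_linear_Re]
  by (simp add: o_def ev_eq mean_def integral_unique)

lemma fc_uminus: "par e U \<Longrightarrow> asum i U \<Longrightarrow> fc U (- k) = (if e then fc U k else - fc U k)"
  unfolding fc_def par_def parity_iff by (simp add: suminf_minus summable_lookup)

text \<open>The factor 2 arises because \<open>fourier_cos\<close> divides by pi, whereas
  \<open>fc\<close> is the coefficient with respect to the complex exponentials.\<close>

lemma fourier_rc:
  assumes "asum 0 U" "par True U"
  shows "fourier_cos (rc U) k = 2 * fc U (int k)" "fourier_sin (rc U) k = 0"
  using has_integral_linear[OF integral_ev[OF assms(1), of "int k"] bounded_linear_Re]
    has_integral_linear[OF integral_ev[OF assms(1), of "int k"] bounded_linear_Im] assms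
  by (simp_all add: o_def ev_eq rs_even fc_uminus fourier_cos_def fourier_sin_def integral_unique)

lemma fourier_rs:
  assumes "asum 0 U" "par False U"
  shows "fourier_sin (rs U) k = 2 * fc U (int k)" "fourier_cos (rs U) k = 0"
  using has_integral_linear[OF integral_ev[OF assms(1), of "int k"] bounded_linear_Re]
    has_integral_linear[OF integral_ev[OF assms(1), of "int k"] bounded_linear_Im] assms
  by (simp_all add: o_def ev_eq rc_odd fc_uminus fourier_cos_def fourier_sin_def has_integral_neg_iff integral_unique)

subsection \<open>The Hilbert transform\<close>

text \<open>The Fourier partial sum as a multiplier. \<open>ev\<close> sums over orders of the
  parameter while \<open>hilbert_strip\<close> sums over modes; cutting off modes by a multiplier
  lets the norms control the exchange.\<close>

definition chi :: "nat \<Rightarrow> int \<Rightarrow> real" where "chi N k = (if \<bar>k\<bar> \<le> int N then 1 else 0)"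

lemma sum_symmetric:
  fixes g :: "int \<Rightarrow> real"
  shows "(\<Sum>k\<in>{- int N..int N}. g k) = g 0 + (\<Sum>i<N. g (int (Suc i)) + g (- int (Suc i)))"
proof (induction N)
  case (Suc N)
  have "{- int (Suc N)..int (Suc N)} = insert (int (Suc N)) (insert (- int (Suc N)) {- int N..int N})"
    by auto
  then show ?case by (simp add: Suc)
qed simp

lemma tev_chi:
  "tev (tmul (chi N) p) x = (\<Sum>k\<in>{- int N..int N}. complex_of_real (lookup p k) * cis (real_of_int k * x))"
proof -
  have "tev (tmul (chi N) p) x = (\<Sum>k\<in>{- int N..int N}. complex_of_real (lookup (tmul (chi N) p) k) * cis (real_of_int k * x))"
    unfolding tev_def by (rule linsum_superset) (auto simp: in_keys_iff chi_def abs_le_iff split: if_splits)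
  then show ?thesis by (simp add: chi_def abs_le_iff)
qed

lemma asum_chi: "asum i U \<Longrightarrow> asum i (mop (chi N) U)"
  by (rule asum_mop[of _ _ 1]) (auto simp: chi_def)

text \<open>On the modes beyond N the weight is at least N + 1, so one spare derivative pays for the
  decay 1 / (N + 1).\<close>

lemma chi_tail:
  assumes "asum 1 U"
  shows "norm (ev (mop (chi N) U) x - ev U x) \<le> (\<Sum>j. tnorm 1 (U $ j)) * inverse (real (Suc N))"
proof -
  let ?V = "mop (\<lambda>k. 1 - chi N k) U"
  have U0: "asum 0 U" using assms by (rule asum_mono) simp
  have V: "?V + mop (chi N) U = U"
    by (rule fps_ext, rule poly_mapping_eqI) (simp add: lookup_add algebra_simps)
  have b: "\<bar>1 - chi N k\<bar> * wt k ^ 0 \<le> inverse (real (Suc N)) * wt k ^ 1" for k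
  proof (cases "\<bar>k\<bar> \<le> int N")
    case False
    then have "real (Suc N) \<le> wt k" by linarith
    then show ?thesis using False by (simp add: chi_def divide_simps)
  qed (simp add: chi_def)
  have Va: "asum 0 ?V" using assms by (rule asum_mop[OF b])
  have "norm (ev ?V x) \<le> (\<Sum>j. tnorm 0 (?V $ j))" by (rule norm_ev_le[OF Va])
  also have "\<dots> \<le> (\<Sum>j. inverse (real (Suc N)) * tnorm 1 (U $ j))"
    using Va assms tnorm_tmul[OF b] unfolding asum_def mop_nth
    by (intro suminf_le summable_mult) auto
  also have "\<dots> = (\<Sum>j. tnorm 1 (U $ j)) * inverse (real (Suc N))"
    using assms by (simp add: asum_def suminf_mult mult.commute)
  finally show ?thesis
    using ev_add[OF Va asum_chi[OF U0], of N x] by (simp add: V norm_minus_commute)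
qed

lemma fourier_series_tendsto:
  assumes "asum 1 U"
  shows "(\<lambda>N. \<Sum>k\<in>{- int N..int N}. complex_of_real (fc U k) * cis (real_of_int k * x)) \<longlonglongrightarrow> ev U x"
proof -
  have s: "summable (\<lambda>j. complex_of_real (lookup (U $ j) k))" for k
    using summable_lookup[OF assms] by (rule summable_of_real)
  have "ev (mop (chi N) U) x = (\<Sum>k\<in>{- int N..int N}. complex_of_real (fc U k) * cis (real_of_int k * x))" for N
    unfolding ev_def mop_nth tev_chi fc_def suminf_of_real[OF summable_lookup[OF assms]]
      suminf_mult2[OF s]
    by (rule suminf_sum) (intro summable_mult2 s)
  then have b: "norm ((\<Sum>k\<in>{- int N..int N}. complex_of_real (fc U k) * cis (real_of_int k * x)) - ev U x)
      \<le> (\<Sum>j. tnorm 1 (U $ j)) * inverse (real (Suc N))" for N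
    using chi_tail[OF assms, of N x] by simp
  show ?thesis
    by (rule LIM_zero_cancel, rule Lim_null_comparison[OF always_eventually, OF allI, OF b],
        rule tendsto_mult_right_zero[OF LIMSEQ_inverse_real_of_nat])
qed

lemma rc_sums:
  assumes "asum 1 U" "par True U"
  shows "(\<lambda>i. 2 * fc U (int (Suc i)) * cos (real (Suc i) * x)) sums (rc U x - fc U 0)"
proof -
  have "fc U (int (Suc i)) * cos (real_of_int (int (Suc i)) * x) + fc U (- int (Suc i)) * cos (real_of_int (- int (Suc i)) * x)
     = 2 * fc U (int (Suc i)) * cos (real (Suc i) * x)" for i
    using fc_uminus[OF assms(2,1), of "int (Suc i)"] by (simp del: of_nat_Suc)
  then have "(\<Sum>k\<in>{- int N..int N}. fc U k * cos (real_of_int k * x))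
     = fc U 0 + (\<Sum>i<N. 2 * fc U (int (Suc i)) * cos (real (Suc i) * x))" for N
    unfolding sum_symmetric by (simp only: of_int_0 mult_zero_left cos_zero mult_1_right)
  moreover have "(\<lambda>N. \<Sum>k\<in>{- int N..int N}. fc U k * cos (real_of_int k * x)) \<longlonglongrightarrow> rc U x"
    using tendsto_Re[OF fourier_series_tendsto[OF assms(1), of x]] by (simp add: ev_eq[OF assms(1)])
  ultimately have "(\<lambda>N. fc U 0 + (\<Sum>i<N. 2 * fc U (int (Suc i)) * cos (real (Suc i) * x))) \<longlonglongrightarrow> rc U x" by simp
  from tendsto_diff[OF this tendsto_const[of "fc U 0"]] show ?thesis by (simp add: sums_def)
qed

lemma rs_sums:
  assumes "asum 1 U" "par False U"
  shows "(\<lambda>i. 2 * fc U (int (Suc i)) * sin (real (Suc i) * x)) sums rs U x"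
proof -
  have "fc U (int (Suc i)) * sin (real_of_int (int (Suc i)) * x) + fc U (- int (Suc i)) * sin (real_of_int (- int (Suc i)) * x)
     = 2 * fc U (int (Suc i)) * sin (real (Suc i) * x)" for i
    using fc_uminus[OF assms(2,1), of "int (Suc i)"] by (simp del: of_nat_Suc)
  then have "(\<Sum>k\<in>{- int N..int N}. fc U k * sin (real_of_int k * x))
     = (\<Sum>i<N. 2 * fc U (int (Suc i)) * sin (real (Suc i) * x))" for N
    unfolding sum_symmetric by (simp only: of_int_0 mult_zero_left sin_zero mult_zero_right add_0)
  moreover have "(\<lambda>N. \<Sum>k\<in>{- int N..int N}. fc U k * sin (real_of_int k * x)) \<longlonglongrightarrow> rs U x"
    using tendsto_Im[OF fourier_series_tendsto[OF assms(1), of x]] by (simp add: ev_eq[OF assms(1)])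
  ultimately show ?thesis by (simp add: sums_def)
qed

lemma fc_mop: "asum i U \<Longrightarrow> fc (mop c U) k = c k * fc U k"
  unfolding fc_def by (simp add: suminf_mult summable_lookup)

definition ct :: "real \<Rightarrow> int \<Rightarrow> real" where "ct h k = coth (real_of_int k * h)"

lemma coth_minus: "coth (- x) = - coth x"
  by (simp add: coth_def)

text \<open>Division by zero gives coth 0 = 0, which fits a transform that ignores the mean.\<close>

lemma ct_0 [simp]: "ct h 0 = 0" by (simp add: ct_def coth_def)
lemma ct_minus: "ct h (- k) = - ct h k" by (simp add: ct_def coth_minus)

lemma coth_inverse_tanh: "coth x = inverse (tanh x)"
  by (simp add: coth_def tanh_def)

text \<open>tanh increases, so coth(k h) <= coth h for k >= 1, and the transform costs no
  derivative.\<close>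

lemma ct_bound:
  assumes "h > 0"
  shows "\<bar>ct h k\<bar> \<le> coth h"
proof -
  have th: "tanh h > 0" using assms by simp
  have *: "0 \<le> ct h k \<and> ct h k \<le> coth h" if "k > 0" for k
  proof -
    have "1 * h \<le> real_of_int k * h" using that assms by (intro mult_right_mono) auto
    then have "tanh h \<le> tanh (real_of_int k * h)" by simp
    then show ?thesis using th by (auto simp: ct_def coth_inverse_tanh intro: le_imp_inverse_le)
  qed
  have "coth h > 0" using th by (simp add: coth_inverse_tanh)
  then show ?thesis
    using *[of k] *[of "- k"] ct_minus[of h k] by (cases k "0::int" rule: linorder_cases) auto
qed

lemma asum_ct: "h > 0 \<Longrightarrow> asum i U \<Longrightarrow> asum i (mop (ct h) U)"
  by (rule asum_mop[of _ _ "coth h"]) (auto intro!: mult_right_mono ct_bound)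

lemma par_ct: "par e U \<Longrightarrow> par (e = False) (mop (ct h) U)"
  by (rule par_mop) (auto simp: ct_minus)

lemma hilbert_rc:
  assumes "h > 0" "asum 1 U" "par True U"
  shows "hilbert_strip h (rc U) = rs (mop (ct h) U)"
proof
  fix x
  have U0: "asum 0 U" using assms(2) by (rule asum_mono) simp
  have "(\<lambda>i. 2 * fc (mop (ct h) U) (int (Suc i)) * sin (real (Suc i) * x)) sums (rs (mop (ct h) U) x)"
    by (rule rs_sums) (use assms asum_ct par_ct[of True U h] in auto)
  also have "(\<lambda>i. 2 * fc (mop (ct h) U) (int (Suc i)) * sin (real (Suc i) * x))
    = (\<lambda>i. fourier_cos (rc U) (Suc i) * coth (real (Suc i) * h) * sin (real (Suc i) * x))"
    by (simp add: fourier_rc[OF U0 assms(3)] fc_mop[OF assms(2)] ct_def mult_ac fun_eq_iff del: of_nat_Suc)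
  finally show "hilbert_strip h (rc U) x = rs (mop (ct h) U) x"
    by (simp add: hilbert_strip_def sums_iff fourier_rc[OF U0 assms(3)])
qed

lemma hilbert_rs:
  assumes "h > 0" "asum 1 U" "par False U"
  shows "hilbert_strip h (rs U) = (\<lambda>x. - rc (mop (ct h) U) x)"
proof
  fix x
  have U0: "asum 0 U" using assms(2) by (rule asum_mono) simp
  have "(\<lambda>i. 2 * fc (mop (ct h) U) (int (Suc i)) * cos (real (Suc i) * x)) sums
      (rc (mop (ct h) U) x - fc (mop (ct h) U) 0)"
    by (rule rc_sums) (use assms asum_ct par_ct[of False U h] in auto)
  also have "(\<lambda>i. 2 * fc (mop (ct h) U) (int (Suc i)) * cos (real (Suc i) * x))
    = (\<lambda>i. fourier_sin (rs U) (Suc i) * coth (real (Suc i) * h) * cos (real (Suc i) * x))"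
    by (simp add: fourier_rs[OF U0 assms(3)] fc_mop[OF assms(2)] ct_def mult_ac fun_eq_iff del: of_nat_Suc)
  finally show "hilbert_strip h (rs U) x = - rc (mop (ct h) U) x"
    by (simp add: hilbert_strip_def sums_iff fourier_rs[OF U0 assms(3)] fc_mop[OF assms(2)])
qed

subsection \<open>Hoelder norms\<close>

lemma nb_suminf: "nb i U C \<Longrightarrow> (\<Sum>j. tnorm i (U $ j)) \<le> C"
  using nb_imp_asum[of i U C] unfolding nb_def asum_def
  by (intro suminf_le_const) (auto intro: order.trans[OF sum_mono2[of "{..n}" "{..<n}" for n]])

lemma abs_rc_nb: "nb i U C \<Longrightarrow> \<bar>rc U x\<bar> \<le> C" and abs_rs_nb: "nb i U C \<Longrightarrow> \<bar>rs U x\<bar> \<le> C"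
  using abs_rc_le[OF nb_imp_asum, of U C x] abs_rs_le[OF nb_imp_asum, of U C x]
    nb_suminf[of 0 U C] nb_weaken[of i U C C 0] by (auto intro: order.trans)

lemma nb_dx: "nb (Suc i) U C \<Longrightarrow> nb i (dx U) C"
  using nb_mop[of real_of_int i 1 "Suc i" U C] by (simp add: mult_right_mono)

text \<open>The constant 5 counts three suprema bounded by C and a Hoelder seminorm bounded by 2
  C.\<close>

lemma
  assumes U: "nb 3 U C" and al: "0 < \<alpha>" "\<alpha> < 1"
  shows holder_norm_rc: "\<bar>holder_norm 2 \<alpha> (rc U)\<bar> \<le> 5 * C"
    and holder_space_rc: "rc U \<in> holder_space 2 \<alpha>"
proof -
  have C: "C \<ge> 0" using U by (rule nb_nonneg)
  have n1: "nb 2 (dx U) C" "nb 1 (dx (dx U)) C" "nb 0 (dx (dx (dx U))) C"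
    using nb_dx[of 2 U C] nb_dx[of 1 "dx U" C] nb_dx[of 0 "dx (dx U)" C] U by (simp_all add: numeral_2_eq_2 numeral_3_eq_3)
  have a: "asum 1 U" "asum 2 U" "asum 1 (dx U)" "asum 1 (dx (dx U))"
    using nb_imp_asum[OF U] nb_imp_asum[OF n1(1)] nb_imp_asum[OF n1(2)] by (auto intro: asum_mono)
  have d1: "deriv (rc U) = (\<lambda>x. - rs (dx U) x)" and d2: "deriv (deriv (rc U)) = (\<lambda>x. - rc (dx (dx U)) x)"
    using deriv_rc[OF a(1)] deriv_deriv_rc[OF a(2)] by simp_all
  define f where "f = (\<lambda>x. - rc (dx (dx U)) x)"
  have fb: "\<bar>f x\<bar> \<le> C" for x using abs_rc_nb[OF n1(2)] by (simp add: f_def)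
  have "(f has_field_derivative rs (dx (dx (dx U))) x) (at x)" for x
    using DERIV_minus[OF rc_deriv[OF a(4)]] by (simp add: f_def)
  then have lip: "\<bar>f x - f y\<bar> \<le> C * \<bar>x - y\<bar>" for x y
    using field_differentiable_bound[of UNIV f "\<lambda>x. rs (dx (dx (dx U))) x" C x y] abs_rs_nb[OF n1(3)]
    by simp
  \<comment> \<open>At distance at most 1 the Lipschitz bound is stronger than the Hoelder bound;
    beyond 1 the supremum bound suffices and produces the factor 2.\<close>
  have hol: "\<bar>f x - f y\<bar> \<le> 2 * C * \<bar>x - y\<bar> powr \<alpha>" for x y
  proof (cases "\<bar>x - y\<bar> \<le> 1")
    case True
    show ?thesis
    proof (cases "x = y")
      case False
      have "\<bar>x - y\<bar> powr 1 \<le> \<bar>x - y\<bar> powr \<alpha>"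
        using True al by (intro powr_mono') auto
      then have "\<bar>x - y\<bar> \<le> \<bar>x - y\<bar> powr \<alpha>" by simp
      then have "C * \<bar>x - y\<bar> \<le> C * \<bar>x - y\<bar> powr \<alpha>" using C by (rule mult_left_mono)
      moreover have "C * \<bar>x - y\<bar> powr \<alpha> \<le> 2 * C * \<bar>x - y\<bar> powr \<alpha>" using C by simp
      ultimately show ?thesis using lip[of x y] by linarith
    qed simp
  next
    case False
    then have "1 \<le> \<bar>x - y\<bar> powr \<alpha>" using al by (intro ge_one_powr_ge_zero) auto
    then have "2 * C * 1 \<le> 2 * C * \<bar>x - y\<bar> powr \<alpha>" using C by (intro mult_left_mono) auto
    then show ?thesis using fb[of x] fb[of y] by linarith
  qed
  have p2: "(deriv ^^ 2) (rc U) = f" by (simp add: numeral_2_eq_2 d2 f_def)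
  show "rc U \<in> holder_space 2 \<alpha>"
    unfolding holder_space_def p2 holder_continuous_def
  proof (intro CollectI conjI allI impI exI)
    fix j :: nat and x assume "j < 2"
    then have "j = 0 \<or> j = 1" by auto
    then show "(deriv ^^ j) (rc U) differentiable (at x)"
    proof
      assume "j = 0"
      then show ?thesis using rc_deriv[OF a(1), of x] unfolding real_differentiable_def by auto
    next
      assume "j = 1"
      then show ?thesis
        using DERIV_minus[OF rs_deriv[OF a(3), of x]] d1 unfolding real_differentiable_def by auto
    qed
  qed (unfold p2, rule hol)
  have sup: "0 \<le> (SUP x. \<bar>g x\<bar>) \<and> (SUP x. \<bar>g x\<bar>) \<le> C" if g: "\<And>x. \<bar>g x\<bar> \<le> C" for g :: "real \<Rightarrow> real"
  proof -
    have "\<bar>g 0\<bar> \<le> (SUP x. \<bar>g x\<bar>)" using g by (intro cSUP_upper) (auto intro!: bdd_aboveI)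
    moreover have "(SUP x. \<bar>g x\<bar>) \<le> C" using g by (intro cSUP_least) auto
    ultimately show ?thesis by auto
  qed
  have "0 \<le> holder_seminorm \<alpha> f \<and> holder_seminorm \<alpha> f \<le> 2 * C"
  proof -
    let ?q = "\<lambda>z. case z of (x, y) \<Rightarrow> \<bar>f x - f y\<bar> / \<bar>x - y\<bar> powr \<alpha>"
    have q: "?q z \<le> 2 * C" if "z \<in> {(x, y). x \<noteq> y}" for z
      using that hol by (cases z) (auto simp: divide_simps)
    have "?q (0, 1) \<le> holder_seminorm \<alpha> f"
      unfolding holder_seminorm_def using q by (intro cSUP_upper bdd_aboveI2) auto
    moreover have "0 \<le> ?q (0, 1)" by simp
    moreover have "holder_seminorm \<alpha> f \<le> 2 * C"
      unfolding holder_seminorm_def using q by (intro cSUP_least) (auto intro: exI[of _ "0::real"] exI[of _ "1::real"])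
    ultimately show ?thesis by linarith
  qed
  moreover have "{..2::nat} = {0, 1, 2}" by auto
  moreover have "0 \<le> (SUP x. \<bar>rc U x\<bar>) \<and> (SUP x. \<bar>rc U x\<bar>) \<le> C" "0 \<le> (SUP x. \<bar>deriv (rc U) x\<bar>) \<and> (SUP x. \<bar>deriv (rc U) x\<bar>) \<le> C"
    "0 \<le> (SUP x. \<bar>f x\<bar>) \<and> (SUP x. \<bar>f x\<bar>) \<le> C"
    using abs_rc_nb[OF U] abs_rs_nb[OF n1(1)] fb by (intro sup; simp add: d1)+
  ultimately show "\<bar>holder_norm 2 \<alpha> (rc U)\<bar> \<le> 5 * C"
    unfolding holder_norm_def p2 by (simp add: p2)
qed

lemma space_X_rc:
  assumes "nb 3 U C" "0 < \<alpha>" "\<alpha> < 1" "cof 0 U = 0"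
  shows "rc U \<in> space_X \<alpha>"
proof -
  have "tc p (- x) = tc p x" for p x by (simp add: tc_def)
  moreover have "tc p (x + 2 * pi) = tc p x" for p x
  proof -
    have "cos (real_of_int k * (x + 2 * pi)) = cos (real_of_int k * x)" for k
      using sin_cos_eq_iff[of "real_of_int k * (x + 2 * pi)" "real_of_int k * x"]
      by (auto simp: algebra_simps intro!: exI[of _ k])
    then show ?thesis by (simp add: tc_def)
  qed
  moreover have "fc U 0 = 0"
  proof -
    have "lookup (U $ j) 0 = 0" for j
      using assms(4) by (metis cof_nth fps_zero_nth lookup_single_eq lookup_zero)
    then show ?thesis by (simp add: fc_def)
  qed
  ultimately show ?thesis
    using holder_space_rc[OF assms(1-3)] mean_rc[OF asum_mono[OF nb_imp_asum[OF assms(1)]]]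
    by (simp add: space_X_def even_periodic_holder_def rc_def)
qed

subsection \<open>Curves given by power series\<close>

text \<open>Substitution of c times the variable. Since \<open>rc\<close> and \<open>ev\<close> sum
  all coefficients, that is, evaluate at parameter 1, \<open>rc (sc s U)\<close> is the value of the
  series at the parameter s.\<close>

definition sc :: "real \<Rightarrow> tser \<Rightarrow> tser" where
  "sc c U = Abs_fps (\<lambda>j. tmul (\<lambda>_. c ^ j) (U $ j))"

lemma sc_nth [simp]: "sc c U $ j = tmul (\<lambda>_. c ^ j) (U $ j)"
  by (simp add: sc_def)

lemma tmul_const: "tmul (\<lambda>_. c) p = single 0 c * p"
  by (rule poly_mapping_eqI) (simp add: lookup_single_mult)

lemma tnorm_tmul_const: "tnorm i (tmul (\<lambda>_. c) p) = \<bar>c\<bar> * tnorm i p"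
  by (simp add: tnorm_superset[OF finite_keys keys_tmul] tnorm_def[of i p] abs_mult sum_distrib_left mult_ac)

lemma tc_tmul_const: "tc (tmul (\<lambda>_. c) p) x = c * tc p x"
  by (simp add: tc_tmul) (simp add: tc_def sum_distrib_left mult_ac)

lemma sc_add: "sc c (U + V) = sc c U + sc c V" by (simp add: fps_eq_iff tmul_add)
lemma sc_minus: "sc c (- U) = - sc c U" by (simp add: fps_eq_iff tmul_minus)
lemma sc_diff: "sc c (U - V) = sc c U - sc c V" by (simp add: fps_eq_iff tmul_diff)
lemma sc_mop: "sc c (mop d U) = mop d (sc c U)"
  by (auto simp: fps_eq_iff intro!: poly_mapping_eqI)
lemma sc_cof: "sc c (cof k U) = cof k (sc c U)"
  by (auto simp: fps_eq_iff lookup_single when_def intro!: poly_mapping_eqI)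
lemma sc_fps_const: "sc c (fps_const p) = fps_const p"
  by (auto simp: fps_eq_iff intro!: poly_mapping_eqI)
lemma sc_KK: "sc c (KK d) = KK d" by (simp add: KK_def sc_fps_const)
lemma sc_one: "sc c 1 = 1" using sc_KK[of c 1] by simp
lemma sc_mult: "sc c (U * V) = sc c U * sc c V"
proof (rule fps_ext)
  fix j
  have "single 0 (c ^ j) * (U $ i * V $ (j - i)) = (single 0 (c ^ i) * U $ i) * (single 0 (c ^ (j - i)) * V $ (j - i))"
    if "i \<le> j" for i
  proof -
    have "single 0 (c ^ j) = single 0 (c ^ i) * (single 0 (c ^ (j - i)) :: trig)"
      using that by (simp add: mult_single flip: power_add)
    then show ?thesis by (simp add: mult_ac)
  qed
  then show "sc c (U * V) $ j = (sc c U * sc c V) $ j"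
    unfolding fps_mult_nth sc_nth tmul_const sum_distrib_left by (intro sum.cong) auto
qed
lemma sc_power2: "sc c (U\<^sup>2) = (sc c U)\<^sup>2" by (simp add: power2_eq_square sc_mult)
lemma sc_X: "sc c fps_X = KK c * fps_X"
  by (rule fps_ext, rule poly_mapping_eqI)
    (auto simp: KK_def lookup_single_mult lookup_one lookup_single when_def le_Suc_eq)
lemma sc_sc: "sc c (sc d U) = sc (c * d) U"
  by (auto simp: fps_eq_iff power_mult_distrib intro!: poly_mapping_eqI)
lemma par_sc: "par e U \<Longrightarrow> par e (sc c U)"
  by (auto simp: par_def parity_iff)
lemma sca_sc: "sca U \<Longrightarrow> sca (sc c U)"
  by (auto simp: sca_def)

lemma nb_sc:
  assumes "nb i U C" "\<bar>c\<bar> \<le> 1" shows "nb i (sc c U) C"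
  unfolding nb_def
proof
  fix J
  have "(\<Sum>j\<le>J. tnorm i (sc c U $ j)) \<le> (\<Sum>j\<le>J. tnorm i (U $ j))"
    using assms(2) by (intro sum_mono) (simp add: tnorm_tmul_const power_abs power_le_one mult_left_le_one_le)
  then show "(\<Sum>j\<le>J. tnorm i (sc c U $ j)) \<le> C" using assms(1) by (auto simp: nb_def intro: order.trans)
qed

lemma nb_sc_vz:
  assumes "nb i U C" "\<bar>c\<bar> \<le> 1" "vz 1 U" shows "nb i (sc c U) (\<bar>c\<bar> * C)"
  unfolding nb_def
proof
  fix J
  have "\<bar>c\<bar> ^ j * tnorm i (U $ j) \<le> \<bar>c\<bar> * tnorm i (U $ j)" for j
  proof (cases j)
    case (Suc l)
    have "\<bar>c\<bar> * \<bar>c\<bar> ^ l \<le> \<bar>c\<bar> * 1" using assms(2) by (intro mult_left_mono power_le_one) auto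
    then show ?thesis using Suc by (intro mult_right_mono) auto
  qed (use assms(3) in \<open>simp add: vz_def\<close>)
  then have "(\<Sum>j\<le>J. tnorm i (sc c U $ j)) \<le> (\<Sum>j\<le>J. \<bar>c\<bar> * tnorm i (U $ j))"
    by (intro sum_mono) (simp add: tnorm_tmul_const power_abs)
  also have "\<dots> = \<bar>c\<bar> * (\<Sum>j\<le>J. tnorm i (U $ j))" by (simp add: sum_distrib_left)
  also have "\<dots> \<le> \<bar>c\<bar> * C" using assms(1) by (intro mult_left_mono) (auto simp: nb_def)
  finally show "(\<Sum>j\<le>J. tnorm i (sc c U $ j)) \<le> \<bar>c\<bar> * C" .
qed

definition dt :: "tser \<Rightarrow> tser" where
  "dt U = Abs_fps (\<lambda>j. tmul (\<lambda>_. real (Suc j)) (U $ Suc j))"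

lemma dt_nth [simp]: "dt U $ j = tmul (\<lambda>_. real (Suc j)) (U $ Suc j)"
  by (simp add: dt_def)

lemma cof_eq_0_iff: "cof k U = 0 \<longleftrightarrow> (\<forall>j. lookup (U $ j) k = 0)"
  unfolding fps_eq_iff by (metis cof_nth fps_zero_nth lookup_single_eq lookup_zero single_zero)
lemma cof_dt: "cof k U = 0 \<Longrightarrow> cof k (dt U) = 0"
  by (simp add: cof_eq_0_iff)

definition conv :: "nat \<Rightarrow> real \<Rightarrow> tser \<Rightarrow> bool" where
  "conv i e U \<longleftrightarrow> (\<forall>x. \<bar>x\<bar> < e \<longrightarrow> summable (\<lambda>j. tnorm i (U $ j) * x ^ j))"

lemma conv_dt: "conv i e U \<Longrightarrow> conv i e (dt U)"
  unfolding conv_def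
proof (intro allI impI)
  fix x :: real assume a: "\<forall>x. \<bar>x\<bar> < e \<longrightarrow> summable (\<lambda>j. tnorm i (U $ j) * x ^ j)" and x: "\<bar>x\<bar> < e"
  have "summable (\<lambda>n. diffs (\<lambda>j. tnorm i (U $ j)) n * x ^ n)"
    by (rule termdiff_converges[of x e]) (use a x in auto)
  then show "summable (\<lambda>j. tnorm i (dt U $ j) * x ^ j)"
    by (simp add: diffs_def tnorm_tmul_const)
qed

lemma conv_asum: "conv i e U \<Longrightarrow> \<bar>x\<bar> < e \<Longrightarrow> asum i (sc x U)"
  unfolding conv_def asum_def
  by (auto simp: tnorm_tmul_const power_abs mult.commute dest!: spec[of _ "\<bar>x\<bar>"])

lemma rc_sc: "rc (sc s U) x = (\<Sum>j. s ^ j * tc (U $ j) x)"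
  by (simp add: rc_def tc_tmul_const)

lemma summable_rc_sc:
  assumes "conv i e U" "\<bar>s\<bar> < e"
  shows "summable (\<lambda>j. s ^ j * tc (U $ j) x)"
  using summable_tc[OF conv_asum[OF assms], of x] by (simp add: tc_tmul_const)

lemma rc_dt_sums:
  assumes "conv i e U" "\<bar>s\<bar> < e"
  shows "(\<lambda>j. real j * s ^ (j - 1) * tc (U $ j) x) sums rc (sc s (dt U)) x"
proof -
  have "(\<lambda>j. s ^ j * (real (Suc j) * tc (U $ Suc j) x)) sums rc (sc s (dt U)) x"
    using summable_sums[OF summable_rc_sc[OF conv_dt[OF assms(1)] assms(2)], of x]
    by (simp add: rc_sc tc_tmul_const)
  then have "(\<lambda>j. real (Suc j) * s ^ (Suc j - 1) * tc (U $ Suc j) x) sums rc (sc s (dt U)) x"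
    by (simp add: mult_ac)
  then show ?thesis by (subst (asm) sums_Suc_iff) simp
qed

text \<open>The error is again a series of this kind, with factors d n that are O(|t - s|) by the
  second-order estimate for powers. A radius K strictly between |s| and e leaves room for t near
  s.\<close>

lemma rc_difference_quotient:
  assumes U: "conv 3 e U" and al: "0 < \<alpha>" "\<alpha> < 1" and s: "\<bar>s\<bar> < e"
  shows "((\<lambda>t. holder_norm 2 \<alpha> (\<lambda>x. (rc (sc t U) x - rc (sc s U) x) / (t - s) - rc (sc s (dt U)) x))
      \<longlongrightarrow> 0) (at s)"
proof -
  define c where "c j = tnorm 3 (U $ j)" for j
  obtain K where K: "\<bar>s\<bar> < K" "K < e" using dense[OF s] by blast
  have "summable (\<lambda>n. diffs (diffs c) n * K ^ n)"
  proof (rule termdiff_converges[of K e])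
    fix x :: real assume "norm x < e"
    then show "summable (\<lambda>n. diffs c n * x ^ n)"
      by (intro termdiff_converges[of x e]) (use U in \<open>auto simp: conv_def c_def\<close>)
  qed (use K in auto)
  then have "summable (\<lambda>n. real (n + 2) * (real (n + 1) * c (n + 2)) * K ^ n)"
    by (simp add: diffs_def mult_ac)
  then have "summable (\<lambda>n. (real (n + 2) * real (n + 2 - 1) * K ^ (n + 2 - 2)) * c (n + 2))"
    by (simp add: mult_ac)
  \<comment> \<open>The truncated differences n - 1 and n - 2 do no harm: the terms n = 0 and n = 1
    carry the factor n (n - 1) = 0.\<close>
  then have sum: "summable (\<lambda>n. (real n * real (n - 1) * K ^ (n - 2)) * c n)"
    by (subst (asm) summable_iff_shift)
  define S where "S = (\<Sum>n. (real n * real (n - 1) * K ^ (n - 2)) * c n)"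
  have bound: "\<bar>holder_norm 2 \<alpha> (\<lambda>x. (rc (sc t U) x - rc (sc s U) x) / (t - s) - rc (sc s (dt U)) x)\<bar>
     \<le> 5 * (S * \<bar>t - s\<bar>)" if t: "t \<noteq> s" "\<bar>t\<bar> < K" for t
  proof -
    define d where "d n = (t ^ n - s ^ n) / (t - s) - real n * s ^ (n - 1)" for n
    have d: "\<bar>d n\<bar> \<le> real n * real (n - 1) * K ^ (n - 2) * \<bar>t - s\<bar>" for n
      using lemma_termdiff3[of "t - s" s K n] t K by (simp add: d_def)
    define Z where "Z = Abs_fps (\<lambda>n. tmul (\<lambda>_. d n) (U $ n))"
    have nbZ: "nb 3 Z (S * \<bar>t - s\<bar>)"
      unfolding nb_def
    proof
      fix J
      have "(\<Sum>j\<le>J. tnorm 3 (Z $ j)) \<le> (\<Sum>j\<le>J. (real j * real (j - 1) * K ^ (j - 2)) * c j * \<bar>t - s\<bar>)"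
      proof (rule sum_mono)
        fix j
        have "\<bar>d j\<bar> * c j \<le> (real j * real (j - 1) * K ^ (j - 2) * \<bar>t - s\<bar>) * c j"
          using d by (intro mult_right_mono) (auto simp: c_def)
        then show "tnorm 3 (Z $ j) \<le> (real j * real (j - 1) * K ^ (j - 2)) * c j * \<bar>t - s\<bar>"
          by (simp add: Z_def tnorm_tmul_const c_def mult_ac)
      qed
      also have "\<dots> = (\<Sum>j\<le>J. (real j * real (j - 1) * K ^ (j - 2)) * c j) * \<bar>t - s\<bar>"
        by (simp add: sum_distrib_right)
      also have "\<dots> \<le> S * \<bar>t - s\<bar>"
        unfolding S_def using K
        by (intro mult_right_mono sum_le_suminf[OF sum]) (auto simp: c_def)
      finally show "(\<Sum>j\<le>J. tnorm 3 (Z $ j)) \<le> S * \<bar>t - s\<bar>" .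
    qed
    have "rc Z x = (rc (sc t U) x - rc (sc s U) x) / (t - s) - rc (sc s (dt U)) x" for x
    proof -
      have te: "\<bar>t\<bar> < e" using t K by simp
      have "(\<lambda>j. (t ^ j * tc (U $ j) x - s ^ j * tc (U $ j) x) / (t - s) - real j * s ^ (j - 1) * tc (U $ j) x)
          sums ((rc (sc t U) x - rc (sc s U) x) / (t - s) - rc (sc s (dt U)) x)"
        unfolding rc_sc[of t] rc_sc[of s U]
        by (intro sums_diff sums_divide summable_sums summable_rc_sc[OF U te] summable_rc_sc[OF U s]
            rc_dt_sums[OF U s])
      moreover have "(\<lambda>j. (t ^ j * tc (U $ j) x - s ^ j * tc (U $ j) x) / (t - s) - real j * s ^ (j - 1) * tc (U $ j) x)
        = (\<lambda>j. tc (Z $ j) x)"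
        by (simp add: Z_def tc_tmul_const d_def fun_eq_iff left_diff_distrib diff_divide_distrib)
      ultimately show ?thesis by (simp add: rc_def sums_iff)
    qed
    then have "(\<lambda>x. (rc (sc t U) x - rc (sc s U) x) / (t - s) - rc (sc s (dt U)) x) = rc Z" by auto
    then show ?thesis using holder_norm_rc[OF nbZ al] by simp
  qed
  show ?thesis
  proof (rule Lim_null_comparison)
    have "eventually (\<lambda>t. \<bar>t\<bar> < K) (at s)"
      using K by (intro eventually_at_in_open'[of "{-K<..<K}" s, THEN eventually_mono]) auto
    moreover have "eventually (\<lambda>t. t \<noteq> s) (at s)" by (simp add: eventually_at_filter)
    ultimately show "eventually (\<lambda>t. norm (holder_norm 2 \<alpha> (\<lambda>x. (rc (sc t U) x - rc (sc s U) x) / (t - s) - rc (sc s (dt U)) x))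
        \<le> 5 * (S * \<bar>t - s\<bar>)) (at s)"
      by eventually_elim (use bound in auto)
    have "((\<lambda>t. 5 * (S * \<bar>t - s\<bar>)) \<longlongrightarrow> 5 * (S * \<bar>s - s\<bar>)) (at s)"
      by (intro tendsto_intros)
    then show "((\<lambda>t. 5 * (S * \<bar>t - s\<bar>)) \<longlongrightarrow> 0) (at s)" by simp
  qed
qed

lemma smooth_curve_rc:
  assumes U: "conv 3 e U" and al: "0 < \<alpha>" "\<alpha> < 1" and U0: "cof 0 U = 0"
  shows "smooth_X_curve_on \<alpha> {-e<..<e} (\<lambda>s. rc (sc s U))"
proof -
  define D where "D j = (dt ^^ j) U" for j
  have D: "conv 3 e (D j)" "cof 0 (D j) = 0" for j
    by (induction j) (auto simp: D_def U U0 conv_dt cof_dt)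
  show ?thesis
    unfolding smooth_X_curve_on_def
  proof (intro exI[of _ "\<lambda>j s. rc (sc s (D j))"] conjI allI ballI)
    show "rc (sc s (D 0)) = rc (sc s U)" for s by (simp add: D_def)
    fix j s assume s: "s \<in> {-e<..<e}"
    then have "\<bar>s\<bar> < e" by auto
    then show "rc (sc s (D j)) \<in> space_X \<alpha>"
      using asum_imp_nb[OF conv_asum[OF D(1)]] D(2)[of j]
      by (intro space_X_rc[OF _ al]) (auto simp: cof_eq_0_iff)
    show "((\<lambda>t. holder_norm 2 \<alpha> (\<lambda>x. (rc (sc t (D j)) x - rc (sc s (D j)) x) / (t - s) - rc (sc s (D (Suc j))) x))
       \<longlongrightarrow> 0) (at s)"
      using rc_difference_quotient[OF D(1)[of j] al \<open>\<bar>s\<bar> < e\<close>] by (simp add: D_def)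
  qed
qed

lemma smooth_on_rc:
  assumes U: "conv 0 e U"
  shows "smooth_on {-e<..<e} (\<lambda>s. rc (sc s U) x)"
proof -
  have der: "((\<lambda>s. rc (sc s V) x) has_field_derivative rc (sc s (dt V)) x) (at s)"
    if V: "conv 0 e V" and s: "\<bar>s\<bar> < e" for V s
  proof -
    have "((\<lambda>s. \<Sum>n. tc (V $ n) x * s ^ n) has_field_derivative (\<Sum>n. diffs (\<lambda>n. tc (V $ n) x) n * s ^ n)) (at s)"
    proof (rule termdiffs_strong')
      show "summable (\<lambda>n. tc (V $ n) x * s ^ n)" if "norm s < e" for s :: real
        using summable_rc_sc[OF V, of s x] that by (simp add: mult.commute)
    qed (use s in auto)
    then show ?thesis
      by (simp add: rc_sc tc_tmul_const diffs_def mult_ac)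
  qed
  define D where "D j = (dt ^^ j) U" for j
  have D: "conv 0 e (D j)" for j
    by (induction j) (auto simp: D_def U conv_dt)
  have eq: "(deriv ^^ j) (\<lambda>s. rc (sc s U) x) s = rc (sc s (D j)) x" if "\<bar>s\<bar> < e" for j s
    using that
  proof (induction j arbitrary: s)
    case (Suc j)
    have "((deriv ^^ j) (\<lambda>s. rc (sc s U) x) has_field_derivative rc (sc s (dt (D j))) x) (at s)"
    proof (rule has_field_derivative_transform_within_open[OF der[OF D Suc.prems]])
      show "open {-e<..<e}" "s \<in> {-e<..<e}" using Suc.prems by auto
    qed (use Suc.IH in auto)
    then show ?case by (simp add: DERIV_imp_deriv D_def)
  qed (simp add: D_def)
  show ?thesis
    unfolding smooth_on_def
  proof (intro allI ballI)
    fix j s assume "s \<in> {-e<..<e}"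
    then have s: "\<bar>s\<bar> < e" by auto
    have "((deriv ^^ j) (\<lambda>s. rc (sc s U) x) has_field_derivative rc (sc s (dt (D j))) x) (at s)"
    proof (rule has_field_derivative_transform_within_open[OF der[OF D s]])
      show "open {-e<..<e}" "s \<in> {-e<..<e}" using s by auto
    qed (use eq in auto)
    then show "(deriv ^^ j) (\<lambda>s. rc (sc s U) x) differentiable at s"
      using real_differentiable_def by blast
  qed
qed

section \<open>Pointwise values of the operator F\<close>

definition good :: "tser \<Rightarrow> bool" where "good U \<longleftrightarrow> asum 1 U \<and> par True U"

lemma good_add: "good U \<Longrightarrow> good V \<Longrightarrow> good (U + V)"
  by (simp add: good_def asum_add par_add)
lemma good_diff: "good U \<Longrightarrow> good V \<Longrightarrow> good (U - V)"
  by (simp add: good_def asum_diff par_diff)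
lemma good_minus: "good U \<Longrightarrow> good (- U)"
  by (simp add: good_def asum_minus par_minus)
lemma good_mult: "good U \<Longrightarrow> good V \<Longrightarrow> good (U * V)"
  by (simp add: good_def asum_mult par_mult_even)
lemma good_KK: "good (KK c)" by (simp add: good_def asum_KK par_sca)
lemma good_one: "good 1" using good_KK[of 1] by simp
lemma good_power2: "good U \<Longrightarrow> good (U\<^sup>2)" by (simp add: power2_eq_square good_mult)
lemmas good_intros = good_add good_diff good_minus good_mult good_KK good_one good_power2

lemma rc_add_good: "good U \<Longrightarrow> good V \<Longrightarrow> rc (U + V) x = rc U x + rc V x"
  unfolding good_def by (rule rc_add[of 1]) auto
lemma rc_diff_good: "good U \<Longrightarrow> good V \<Longrightarrow> rc (U - V) x = rc U x - rc V x"
  unfolding good_def by (rule rc_diff[of 1]) auto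
lemma rc_minus_good: "good U \<Longrightarrow> rc (- U) x = - rc U x"
  unfolding good_def by (rule rc_minus[of 1]) auto
lemma rc_mult_good: "good U \<Longrightarrow> good V \<Longrightarrow> rc (U * V) x = rc U x * rc V x"
  unfolding good_def by (rule rc_mult_even[of 1]) auto
lemma rc_one: "rc 1 x = 1" using rc_KK[of 1 x] by simp
lemma rc_power2_good: "good U \<Longrightarrow> rc (U\<^sup>2) x = (rc U x)\<^sup>2"
  by (simp add: power2_eq_square rc_mult_good)
lemmas rc_good = rc_add_good rc_diff_good rc_minus_good rc_mult_good rc_power2_good rc_KK rc_one

lemma rc_sca: "sca U \<Longrightarrow> rc U x = fc U 0"
proof -
  assume s: "sca U"
  have "tc (U $ j) x = lookup (U $ j) 0" for j
    by (subst sca_nth[OF s]) (auto simp: tc_def)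
  then show ?thesis by (simp add: rc_def fc_def)
qed

lemma fc_cof: "fc (cof k U) 0 = fc U k" by (simp add: fc_def)

context wave_series
begin

context
  fixes g A B :: real
  assumes h: "h > 0" and dm: "dm = (\<lambda>j. real_of_int j * coth (real_of_int j * h))"
    and par_eqs: "gA2 = g * A / 2" "gAh = g * A * h" "gB = g * B"
begin

lemma dd_eq: "dd U = mop (ct h) (dx U)"
  by (simp add: mop_mop dm ct_def mult.commute)
lemma dld_eq: "dld U = mop (ct h) (dx (dx U))"
  by (simp add: mop_mop dm ct_def mult_ac)
lemma dq_eq: "dq U = dx (dx U)"
  by (simp add: mop_mop)

lemma asum_dd: "asum 2 U \<Longrightarrow> asum 1 (dd U)"
  unfolding dd_eq by (intro asum_ct h asum_dx) (simp add: numeral_2_eq_2)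
lemma par_dd: "par True U \<Longrightarrow> par True (dd U)"
  by (rule par_mop_even) (simp_all add: dm_even)
lemma par_dl: "par True U \<Longrightarrow> par False (dl U)"
  using par_mop[of real_of_int False True U] by simp
lemma par_dld: "par True U \<Longrightarrow> par False (dld U)"
  using par_mop[of "\<lambda>j. real_of_int j * dm j" False True U] by (simp add: dm_even)
lemma par_dq: "par True U \<Longrightarrow> par True (dq U)"
  by (rule par_mop_even) simp_all

text \<open>On e^(i k x) the derivative has symbol i k and the transform has symbol - i coth(k h);
  the product k coth(k h) is real and even.\<close>

lemma hilbert_deriv:
  assumes "asum 2 V" "par True V"
  shows "hilbert_strip h (deriv (rc V)) = rc (dd V)"
proof -
  have a: "asum 1 (dx V)" "asum 1 V" using assms asum_dx[of 1 V] asum_mono[of 2 V 1] by (auto simp: numeral_2_eq_2)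
  have "deriv (rc V) = rs (- dx V)"
    using rs_minus[OF a(1)] by (simp add: deriv_rc[OF a(2)] fun_eq_iff)
  moreover have "hilbert_strip h (rs (- dx V)) = (\<lambda>x. - rc (mop (ct h) (- dx V)) x)"
    by (rule hilbert_rs[OF h]) (use a assms par_dl in \<open>auto intro: asum_minus par_minus\<close>)
  moreover have "rc (mop (ct h) (- dx V)) x = - rc (dd V) x" for x
    unfolding dd_eq mop_minus by (rule rc_minus[of 1]) (use asum_ct[OF h a(1)] in auto)
  ultimately show ?thesis by simp
qed

lemma hilbert_deriv2:
  assumes "asum 3 V" "par True V"
  shows "hilbert_strip h (deriv (deriv (rc V))) = (\<lambda>x. - rs (dld V) x)"
proof -
  have a: "asum 1 (dx (dx V))" "asum 2 V"
    using assms asum_dx[of 1 "dx V"] asum_dx[of 2 V] asum_mono[of 3 V 2] by (auto simp: numeral_2_eq_2 numeral_3_eq_3)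
  have "deriv (deriv (rc V)) = rc (- dx (dx V))"
    using rc_minus[OF a(1)] by (simp add: deriv_deriv_rc[OF a(2)] fun_eq_iff)
  moreover have "hilbert_strip h (rc (- dx (dx V))) = rs (mop (ct h) (- dx (dx V)))"
    by (rule hilbert_rc[OF h]) (use a par_dq[OF assms(2)] in \<open>auto simp: dq_eq intro: asum_minus par_minus\<close>)
  moreover have "rs (mop (ct h) (- dx (dx V))) x = - rs (dld V) x" for x
    unfolding dld_eq mop_minus by (rule rs_minus[of 1]) (use asum_ct[OF h a(1)] in auto)
  ultimately show ?thesis by auto
qed

theorem F_op_rc:
  assumes w: "asum 3 w" "par True w" and L: "sca L" "asum 1 L" and Kp: "sca Kp" "asum 1 Kp"
    and M: "sca M" "asum 1 M" and rt: "asum 1 rt" "par True rt" "\<And>x. rc rt x > 0"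
    and eq1: "rt\<^sup>2 * surfJ w = 1"
    and eq2: "(surfP L Kp w)\<^sup>2 - (L\<^sup>2 + M - KK (2 * gB) * w) * surfJ w - KK (2 * \<sigma>) * rt * surfN w = 0"
  shows "nondegenerate h (rc w)"
    "F_op g h A B \<sigma> (rc L 0) (rc Kp 0 - g * A * h) (rc M 0, rc w) = (\<lambda>x. 0)"
proof -
  have w2: "asum 2 w" "asum 1 w" "asum 2 (w * w)" "asum 2 (w * w * w)" 
    using asum_mono[OF w(1), of 2] asum_mono[OF w(1), of 1] by (auto intro: asum_mult)
  have p2: "par True (w * w)" "par True (w * w * w)" using w by (auto intro: par_mult_even)
  have odd: "asum 1 (dl w)" "asum 1 (dld w)" "par False (dl w)" "par False (dld w)"
    using asum_dx[of 1 w] asum_ct[OF h asum_dx[of 1 "dx w"]] asum_dx[of 2 w] w w2 par_dl par_dld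
    by (auto simp: dld_eq numeral_2_eq_2 numeral_3_eq_3)
  have gd: "good w" "good L" "good Kp" "good M" "good rt" "good (dd w)" "good (dd (w * w))" "good (dd (w * w * w))"
    "good (dq w)" "good (cof 0 (w * w))" "good (cof 0 (w * w * w))" "good (dl w * dl w)" "good (dl w * dld w)"
    using w w2 p2 L Kp M rt odd par_dd par_dq[OF w(2)] asum_dd asum_dx[of 1 "dx w"] asum_dx[of 2 w] par_mult[OF odd(3,3)] par_mult[OF odd(3,4)]
    unfolding good_def dq_eq
    by (auto simp: par_sca numeral_2_eq_2 numeral_3_eq_3 intro: asum_cof asum_mono asum_mult)
  define w0 w1 where "w0 = rc w" and "w1 = deriv w0"
  have d1: "w1 = (\<lambda>x. - rs (dl w) x)" and d2: "deriv w1 = (\<lambda>x. - rc (dq w) x)"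
    unfolding w0_def w1_def dq_eq using deriv_rc[OF w2(2)] deriv_deriv_rc[OF w2(1)] by simp_all
  have C1: "hilbert_strip h w1 = rc (dd w)"
    unfolding w0_def w1_def by (rule hilbert_deriv) (use w w2 in auto)
  have C2: "hilbert_strip h (deriv w1) = (\<lambda>x. - rs (dld w) x)"
    unfolding w0_def w1_def by (rule hilbert_deriv2) (use w in auto)
  have der: "(w0 has_field_derivative w1 x) (at x)" for x
    using rc_deriv[OF w2(2)] d1 by (simp add: w0_def)
  have half: "asum 2 (KK (1/2) * (w * w))" "par True (KK (1/2) * (w * w))"
    and third: "asum 2 (KK (1/3) * (w * w * w))" "par True (KK (1/3) * (w * w * w))"
    by (intro asum_mult asum_KK w2 par_mult_even[OF par_sca[OF sca_KK] p2(1)] par_mult_even[OF par_sca[OF sca_KK] p2(2)])+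
  \<comment> \<open>w w' is the derivative of w^2 / 2, and below w^2 w' is that of w^3 / 3, so every
    transform in F falls under \<open>hilbert_deriv\<close> or
    \<open>hilbert_deriv2\<close>.\<close>
  have "(\<lambda>y. w0 y * w1 y) = deriv (rc (KK (1/2) * (w * w)))"
  proof
    fix y
    have "rc (KK (1/2) * (w * w)) = (\<lambda>y. 1 / 2 * (w0 y)\<^sup>2)"
      by (rule ext) (simp add: rc_good good_intros gd w0_def power2_eq_square)
    moreover have "((\<lambda>y. 1 / 2 * (w0 y)\<^sup>2) has_field_derivative w0 y * w1 y) (at y)"
      by (auto intro!: derivative_eq_intros der)
    ultimately show "w0 y * w1 y = deriv (rc (KK (1/2) * (w * w))) y" by (simp add: DERIV_imp_deriv)
  qed
  then have C3: "hilbert_strip h (\<lambda>y. w0 y * w1 y) x = 1 / 2 * rc (dd (w * w)) x" for x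
    using hilbert_deriv[OF half] by (simp add: mop_sca_mult rc_good gd good_intros)
  have "(\<lambda>y. w0 y ^ 2 * w1 y) = deriv (rc (KK (1/3) * (w * w * w)))"
  proof
    fix y
    have "rc (KK (1/3) * (w * w * w)) = (\<lambda>y. 1 / 3 * w0 y ^ 3)"
      by (rule ext) (simp add: rc_good good_intros gd w0_def power3_eq_cube)
    moreover have "((\<lambda>y. 1 / 3 * w0 y ^ 3) has_field_derivative w0 y ^ 2 * w1 y) (at y)"
      by (auto intro!: derivative_eq_intros der)
    ultimately show "w0 y ^ 2 * w1 y = deriv (rc (KK (1/3) * (w * w * w))) y" by (simp add: DERIV_imp_deriv)
  qed
  then have C4: "hilbert_strip h (\<lambda>y. w0 y ^ 2 * w1 y) x = 1 / 3 * rc (dd (w * w * w)) x" for x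
    using hilbert_deriv[OF third] by (simp add: mop_sca_mult rc_good gd good_intros)
  have m2: "mean (\<lambda>y. w0 y ^ 2) = rc (cof 0 (w * w)) x" for x
  proof -
    have "(\<lambda>y. w0 y ^ 2) = rc (w * w)" by (rule ext) (simp add: rc_good gd w0_def power2_eq_square)
    then show ?thesis using mean_rc[OF asum_mono[OF w2(3)]] by (simp add: rc_sca fc_cof)
  qed
  have m3: "mean (\<lambda>y. w0 y ^ 3) = rc (cof 0 (w * w * w)) x" for x
  proof -
    have "(\<lambda>y. w0 y ^ 3) = rc (w * w * w)" by (rule ext) (simp add: rc_good gd good_intros w0_def power3_eq_cube)
    then show ?thesis using mean_rc[OF asum_mono[OF w2(4)]] by (simp add: rc_sca fc_cof)
  qed
  have J: "rc (surfJ w) x = (1 + rc (dd w) x)\<^sup>2 + (w1 x)\<^sup>2" for x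
    using rc_mult_odd[OF odd(1,1,3,3), of x]
    by (simp add: surfJ_def rc_good gd good_intros d1 power2_eq_square)
  have gJ: "good (surfJ w)" unfolding surfJ_def by (intro good_intros gd)
  have N: "rc (surfN w) x = - rc (dq w) x - rc (dd w) x * rc (dq w) x - rs (dl w) x * rs (dld w) x" for x
    using rc_mult_odd[OF odd(1,2,3,4), of x]
    by (simp add: surfN_def rc_good gd good_intros)
  have gN: "good (surfN w)" unfolding surfN_def by (intro good_intros gd)
  have gP: "good (surfP L Kp w)" unfolding surfP_def by (intro good_intros gd)
  have RJ: "(rc rt x)\<^sup>2 * ((1 + rc (dd w) x)\<^sup>2 + (w1 x)\<^sup>2) = 1" for x
  proof -
    have "rc (rt\<^sup>2 * surfJ w) x = (rc rt x)\<^sup>2 * rc (surfJ w) x"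
      by (simp add: rc_good gd good_intros gJ)
    then show ?thesis by (simp add: eq1 J rc_one)
  qed
  then show nd: "nondegenerate h (rc w)"
    unfolding nondegenerate_def w0_def[symmetric] w1_def[symmetric] C1
    by (metis mult_zero_right zero_neq_one)
  \<comment> \<open>The polynomial equation determines 1 / rt up to sign only; positivity of rt
    selects the square root that occurs in F.\<close>
  have sq: "sqrt ((1 + rc (dd w) x)\<^sup>2 + (w1 x)\<^sup>2) = 1 / rc rt x" for x
    using RJ[of x] rt(3)[of x]
    by (intro real_sqrt_unique) (auto simp: field_simps power2_eq_square)
  have E: "(rc (surfP L Kp w) x)\<^sup>2 - ((rc L x)\<^sup>2 + rc M x - 2 * gB * rc w x) * ((1 + rc (dd w) x)\<^sup>2 + (w1 x)\<^sup>2)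
    - 2 * \<sigma> * rc rt x * rc (surfN w) x = 0" for x
  proof -
    have "rc ((surfP L Kp w)\<^sup>2 - (L\<^sup>2 + M - KK (2 * gB) * w) * surfJ w - KK (2 * \<sigma>) * rt * surfN w) x = rc (KK 0) x"
      by (simp only: eq2 KK_0)
    then show ?thesis
      by (simp add: rc_add_good rc_diff_good rc_mult_good rc_power2_good rc_KK gd good_intros gP gJ gN J del: KK_0 KK_numeral)
  qed
  have P: "rc (surfP L Kp w) x = rc L x - (rc Kp x - gAh) * (1 / (2 * h) * rc (cof 0 (w * w)) x - rc w x + 1 / 2 * rc (dd (w * w)) x - rc w x * rc (dd w) x)
     - gA2 * (1 / (3 * h) * rc (cof 0 (w * w * w)) x - rc (cof 0 (w * w)) x - rc w x * rc w x - 2 * h * rc w x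
        + 1 / 3 * rc (dd (w * w * w)) x - rc w x * rc w x * rc (dd w) x + h * rc (dd (w * w)) x - 2 * h * (rc w x * rc (dd w) x))" for x
    unfolding surfP_def
    by (simp add: rc_add_good rc_diff_good rc_mult_good rc_KK gd good_intros del: KK_0 KK_numeral)
  have sc: "rc L x = rc L 0" "rc Kp x = rc Kp 0" "rc M x = rc M 0" for x
    using L Kp M by (simp_all add: rc_sca)
  show "F_op g h A B \<sigma> (rc L 0) (rc Kp 0 - g * A * h) (rc M 0, rc w) = (\<lambda>x. 0)"
  proof
    fix x
    let ?D = "rc (dd w) x" and ?m2 = "rc (cof 0 (w * w)) x" and ?m3 = "rc (cof 0 (w * w * w)) x"
      and ?d2 = "1 / 2 * rc (dd (w * w)) x" and ?d3 = "1 / 3 * rc (dd (w * w * w)) x"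
    have br: "rc L 0 - (rc Kp 0 - g * A * h) * (?m2 / (2 * h) - w0 x + ?d2 - w0 x * ?D)
      - g * A / 2 * (?m3 / (3 * h) - ?m2 - w0 x ^ 2 - 2 * h * w0 x + ?d3 - w0 x ^ 2 * ?D + 2 * h * ?d2 - 2 * h * w0 x * ?D)
      = rc (surfP L Kp w) x"
      unfolding P sc[of x] unfolding par_eqs w0_def by (simp add: power2_eq_square mult_ac)
    have N': "deriv w1 x + ?D * deriv w1 x - w1 x * - rs (dld w) x = rc (surfN w) x"
      unfolding N d2 unfolding d1 by simp
    have M': "(rc L 0)\<^sup>2 + rc M 0 - 2 * g * B * w0 x = (rc L x)\<^sup>2 + rc M x - 2 * gB * rc w x"
      unfolding sc[of x] unfolding par_eqs w0_def by simp
    show "F_op g h A B \<sigma> (rc L 0) (rc Kp 0 - g * A * h) (rc M 0, rc w) x = 0"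
      unfolding F_op_def prod.case Let_def w0_def[symmetric] w1_def[symmetric] C1 C2 C3 C4 sq
        m2[of x] m3[of x] br N' M'
      using E[of x, folded w0_def] by (simp add: add.commute mult_ac flip: w0_def)
  qed
qed

end

end

section \<open>The solution curve\<close>

lemma rc_sc_0: "rc (sc 0 X) x = tc (X $ 0) x"
proof -
  have "(\<lambda>j. 0 ^ j * tc (X $ j) x) sums (\<Sum>j\<in>{0}. 0 ^ j * tc (X $ j) x)"
    by (rule sums_finite) auto
  then show ?thesis by (simp add: rc_sc sums_iff)
qed

lemma rc_X: "rc fps_X x = 1"
proof -
  have "(\<lambda>j. tc ((fps_X :: tser) $ j) x) sums (\<Sum>j\<in>{1}. tc ((fps_X :: tser) $ j) x)"
    by (rule sums_finite) (auto simp: fps_X_def tc_def)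
  then show ?thesis by (simp add: rc_def sums_iff fps_X_def tc_def)
qed

text \<open>Undoes the rescaling in \<open>ss\<close>: convergence up to 1 in the formal variable
  becomes convergence for |s| < e in the true parameter.\<close>

lemma conv_sc:
  assumes "nb i X C" "e > 0" shows "conv i e (sc (1 / e) X)"
  unfolding conv_def
proof (intro allI impI)
  fix x :: real assume x: "\<bar>x\<bar> < e"
  show "summable (\<lambda>j. tnorm i (sc (1 / e) X $ j) * x ^ j)"
  proof (rule summable_comparison_test'[of "\<lambda>j. tnorm i (X $ j)" 0])
    show "summable (\<lambda>j. tnorm i (X $ j))" using nb_imp_asum[OF assms(1)] by (simp add: asum_def)
    fix j :: nat
    have "\<bar>1 / e\<bar> ^ j * \<bar>x\<bar> ^ j = (\<bar>x\<bar> / e) ^ j"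
      using assms(2) by (simp add: power_divide)
    also have "\<dots> \<le> 1" using x assms(2) by (intro power_le_one) auto
    finally have "(\<bar>1 / e\<bar> ^ j * \<bar>x\<bar> ^ j) * tnorm i (X $ j) \<le> 1 * tnorm i (X $ j)"
      by (rule mult_right_mono) simp
    then show "norm (tnorm i (sc (1 / e) X $ j) * x ^ j) \<le> tnorm i (X $ j)"
      by (simp add: tnorm_tmul_const power_abs abs_mult mult_ac)
  qed
qed

definition curve_exists ::
  "real \<Rightarrow> real \<Rightarrow> real \<Rightarrow> real \<Rightarrow> real \<Rightarrow> real \<Rightarrow> real \<Rightarrow> real \<Rightarrow> (real \<Rightarrow> real) \<Rightarrow> bool" where
  "curve_exists g h A B \<sigma> \<alpha> lam0 \<beta>0 \<phi> \<longleftrightarrow>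
     (\<exists>\<delta>>0. \<exists>(lam :: real \<Rightarrow> real) (\<beta> :: real \<Rightarrow> real) (\<mu> :: real \<Rightarrow> real)
              (w :: real \<Rightarrow> real \<Rightarrow> real).
           smooth_on {-\<delta><..<\<delta>} lam \<and> smooth_on {-\<delta><..<\<delta>} \<beta> \<and> smooth_on {-\<delta><..<\<delta>} \<mu> \<and>
           smooth_X_curve_on \<alpha> {-\<delta><..<\<delta>} w \<and>
           lam 0 = lam0 \<and> \<beta> 0 = \<beta>0 \<and> \<mu> 0 = 0 \<and> w 0 = (\<lambda>x. 0) \<and>
           (\<forall>s\<in>{-\<delta><..<\<delta>}. w s \<in> space_X \<alpha> \<and> nondegenerate h (w s) \<and>
              F_op g h A B \<sigma> (lam s) (\<beta> s) (\<mu> s, w s) = (\<lambda>x. 0)) \<and>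
           (\<lambda>s. holder_norm 2 \<alpha> (\<lambda>x. w s x - s * \<phi> x)) \<in> O[at 0](\<lambda>s. s\<^sup>2))"

context wave_series
begin

lemma sc_surfJ: "sc c (surfJ w) = surfJ (sc c w)"
  by (simp add: surfJ_def sc_add sc_diff sc_mult sc_mop sc_one sc_power2)
lemma sc_surfN: "sc c (surfN w) = surfN (sc c w)"
  by (simp add: surfN_def sc_add sc_diff sc_mult sc_mop sc_minus)
lemma sc_surfP: "sc c (surfP L K w) = surfP (sc c L) (sc c K) (sc c w)"
  by (simp add: surfP_def sc_add sc_diff sc_mult sc_mop sc_minus sc_cof sc_KK del: KK_numeral)

theorem solution_curve:
  fixes g A B \<alpha> :: real
  assumes h: "h > 0" and dm: "dm = (\<lambda>j. real_of_int j * coth (real_of_int j * h))"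
    and par_eqs: "gA2 = g * A / 2" "gAh = g * A * h" "gB = g * B"
    and lam0: "lam0 \<noteq> 0"
    and phi_0: "lookup phi0 0 = 0" "lookup phi1 0 = 0" and sm_0: "sm 0 = 0"
    and regular: "\<And>j. sm j \<noteq> 0 \<Longrightarrow> sm j * ell j = 1 \<and> lookup phi0 j = 0 \<and> lookup phi1 j = 0"
    and kernel: "\<And>r U j. adm U \<Longrightarrow> j \<noteq> 0 \<Longrightarrow> sm j = 0 \<Longrightarrow> ell j = 0 \<and>
      (KK (2 * lookup phi0 j) + ss r * KK (2 * lookup phi1 j)) * (p1 r U - KK (dm j) * q1 r U)
        = - (ss r * cof j (Ru r U))"
    and al: "0 < \<alpha>" "\<alpha> < 1"
  shows "curve_exists g h A B \<sigma> \<alpha> lam0 (kap0 - g * A * h) (tc phi0)"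
proof -
  have "bigo 0 1 (\<lambda>r U. rhou U)" using near_rhou by (simp add: near_def near_bd_def)
  from bigo_mult[OF bigo_ss this] have "bigo (Suc 2) 1 (\<lambda>r U. ss r * rhou U)" by (simp add: eval_nat_numeral)
  then have "for_small (\<lambda>r U. nb 1 (ss r * rhou U) (r\<^sup>2))"
    by (rule bigo_absorb)
  \<comment> \<open>With r < 1/2 the correction s rho is at most r^2 <= 1/4, which keeps 1 + s rho
    positive.\<close>
  moreover have "\<forall>\<^sub>F r :: real in at_right 0. r \<in> {0<..<1 / 2}" by (rule eventually_at_right_real) simp
  ultimately have "\<forall>\<^sub>F r in at_right 0. r \<in> {0<..<1 / 2} \<and>
      (\<exists>U. adm U \<and> small r U \<and> step r U = U \<and> nb 1 (ss r * rhou U) (r\<^sup>2))"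
    using fixed_point by eventually_elim blast
  from eventually_happens'[OF trivial_limit_at_right_real this]
  obtain r U where r: "0 < r" "r < 1 / 2" and U: "adm U" "small r U" "step r U = U"
    and nbR: "nb 1 (ss r * rhou U) (r\<^sup>2)"
    by auto
  define e where "e = r ^ 3"
  have e: "e > 0" using r by (simp add: e_def)
  note adm = U(1)[unfolded adm_def] and small = U(2)[unfolded small_def]
  define wu where "wu = ss r * Wu r U"
  define Z where "Z = ss r * rhou U"
  define rt where "rt = 1 + Z"
  have dm_0: "dm 0 = 0" by (simp add: dm)
  have gAh: "gAh = 2 * h * gA2" by (simp add: par_eqs)
  have eq1: "rt\<^sup>2 * surfJ wu = 1"
    and eq2: "(surfP (lamu U) (kapu U) wu)\<^sup>2 - ((lamu U)\<^sup>2 + ss r * sM U - KK (2 * gB) * wu) * surfJ wu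
      - KK (2 * \<sigma>) * rt * surfN wu = 0"
    unfolding rt_def Z_def wu_def
    using surface_eq[OF U(1,3) lam0 phi_0 sm_0 dm_0 regular kernel[OF U(1)] gAh] by blast+
  have nbV: "nb 3 (sV U) (r\<^sup>2)" and nbZ: "nb 1 Z (r\<^sup>2)"
    using small nbR by (auto simp: Z_def)
  have nbss: "nb i (ss r) e" for i
    using nb_mult[OF nb_KK nb_X, of i "r ^ 3"] e by (simp add: ss_def e_def)
  have par_fps: "par True (fps_const phi0)" "par True (fps_const phi1)"
    using phi_par by (auto simp: par_def parity_iff fps_const_def)
  have asum_fps: "asum i (fps_const p)" for i p using nb_fps_const by (rule nb_imp_asum)
  obtain CW where nbw: "nb 3 wu CW"
    unfolding wu_def Wu_def
    using nb_mult[OF nbss nb_add[OF nb_add[OF nb_fps_const nb_mult[OF nbss nb_fps_const]] nbV]] by blast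
  obtain CL where nbL: "nb 1 (lamu U) CL"
    unfolding lamu_def using nb_add[OF nb_KK conjunct1[OF conjunct2[OF conjunct2[OF conjunct2[OF small]]]]] by blast
  obtain CG where nbG: "nb 1 (kapu U) CG"
    unfolding kapu_def using nb_add[OF nb_KK conjunct2[OF conjunct2[OF conjunct2[OF conjunct2[OF small]]]]] by blast
  obtain CM where nbM: "nb 1 (ss r * sM U) CM"
    using nb_mult[OF nbss conjunct1[OF conjunct2[OF conjunct2[OF small]]]] by blast
  obtain CB where nbB: "nb 1 (kapu U - KK gAh) CB"
    using nb_diff[OF nbG nb_KK] by blast
  have scas: "sca (lamu U)" "sca (kapu U)" "sca (ss r * sM U)"
    using adm by (auto simp: lamu_def kapu_def intro: sca_add sca_mult)
  have parW: "par True (Wu r U)" and parR: "par True (rhou U)"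
    using near_Wu near_rhou U(1) by (auto simp: near_def near_alg_def)
  have parw: "par True wu" and parZ: "par True Z"
    unfolding wu_def Z_def by (intro par_mult_even par_sca[OF sca_ss] parW parR)+
  have "sV U = V1 r U" using step_sel(1)[of r U] unfolding U(3) .
  then have "cof 0 (sV U) = cof 0 (V1 r U)" by (rule arg_cong)
  also have "\<dots> = 0" by (simp add: V1_def cof_minus cof_mop sm_0)
  finally have cof_V: "cof 0 (sV U) = 0" .
  have "cof 0 (fps_const p) = KK (lookup p 0)" for p by (auto simp: fps_eq_iff KK_def)
  then have cof_w: "cof 0 wu = 0"
    by (simp add: wu_def Wu_def cof_add cof_sca_mult cof_V phi_0)
  have sV0: "vz 1 (sV U)" "sL U $ 0 = 0" "sG U $ 0 = 0" "sM U $ 0 = 0"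
    using adm by (auto simp: vz_def)
  define lam where "lam s = rc (sc s (sc (1 / e) (lamu U))) 0" for s
  define bet where "bet s = rc (sc s (sc (1 / e) (kapu U - KK gAh))) 0" for s
  define mu where "mu s = rc (sc s (sc (1 / e) (ss r * sM U))) 0" for s
  define w where "w s = rc (sc s (sc (1 / e) wu))" for s
  have smooth: "smooth_on {-e<..<e} lam" "smooth_on {-e<..<e} bet" "smooth_on {-e<..<e} mu"
    unfolding lam_def bet_def mu_def
    using nb_weaken[OF nbL order.refl, of 0] nb_weaken[OF nbB order.refl, of 0] nb_weaken[OF nbM order.refl, of 0]
    by (auto intro!: smooth_on_rc conv_sc[OF _ e])
  have curve: "smooth_X_curve_on \<alpha> {-e<..<e} w"
    unfolding w_def
    by (rule smooth_curve_rc[OF conv_sc[OF nbw e] al]) (use cof_w in \<open>simp add: cof_eq_0_iff\<close>)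
  have tcs: "tc (single 0 c) x = c" for c x by (auto simp: tc_def)
  have t1: "tmul (\<lambda>_. 1) p = p" for p by (rule poly_mapping_eqI) simp
  have t0: "tc 0 x = 0" for x by (simp add: tc_def)
  have "lamu U $ 0 = single 0 lam0" "(kapu U - KK gAh) $ 0 = single 0 (kap0 - gAh)"
    "(ss r * sM U) $ 0 = 0" "wu $ 0 = 0"
    using sV0 vz_ss[of r] by (simp_all add: lamu_def kapu_def KK_def single_diff wu_def vz_def)
  then have init: "lam 0 = lam0" "bet 0 = kap0 - g * A * h" "mu 0 = 0" "w 0 = (\<lambda>x. 0)"
    by (auto simp: lam_def bet_def mu_def w_def rc_sc_0 tcs t1 t0 par_eqs)
  have sol: "w s \<in> space_X \<alpha> \<and> nondegenerate h (w s) \<and> F_op g h A B \<sigma> (lam s) (bet s) (mu s, w s) = (\<lambda>x. 0)"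
    if s: "s \<in> {-e<..<e}" for s
  proof -
    define t where "t = s * (1 / e)"
    have t: "\<bar>t\<bar> \<le> 1" using s e by (auto simp: t_def abs_mult)
    have scs: "sc s (sc (1 / e) X) = sc t X" for X by (simp add: sc_sc t_def)
    have X: "w s \<in> space_X \<alpha>"
      unfolding w_def scs
      by (rule space_X_rc[OF nb_sc[OF nbw t] al]) (use cof_w in \<open>simp add: cof_eq_0_iff\<close>)
    have bet_eq: "bet s = rc (sc t (kapu U)) 0 - g * A * h"
      unfolding bet_def scs sc_diff sc_KK
      using rc_diff[of 1 "sc t (kapu U)" "KK gAh" 0] nb_imp_asum[OF nb_sc[OF nbG t]]
      by (simp add: asum_KK rc_KK par_eqs)
    have eq1': "(sc t rt)\<^sup>2 * surfJ (sc t wu) = 1"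
      using arg_cong[OF eq1, of "sc t"] by (simp add: sc_mult sc_power2 sc_surfJ sc_one)
    have eq2': "(surfP (sc t (lamu U)) (sc t (kapu U)) (sc t wu))\<^sup>2
        - ((sc t (lamu U))\<^sup>2 + sc t (ss r * sM U) - KK (2 * gB) * sc t wu) * surfJ (sc t wu)
        - KK (2 * \<sigma>) * sc t rt * surfN (sc t wu) = 0"
      using arg_cong[OF eq2, of "sc t"]
      by (simp only: sc_mult sc_add sc_diff sc_power2 sc_surfJ sc_surfN sc_surfP sc_KK sc_fps_const[of t 0, simplified])
    have rt_eq: "sc t rt = 1 + sc t Z" by (simp add: rt_def sc_add sc_one)
    have aZ: "asum 1 (sc t Z)" using nb_sc[OF nbZ t] by (rule nb_imp_asum)
    have pos: "rc (sc t rt) x > 0" for x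
    proof -
      have "\<bar>rc (sc t Z) x\<bar> \<le> r\<^sup>2" by (rule abs_rc_nb[OF nb_sc[OF nbZ t]])
      moreover have "r\<^sup>2 \<le> (1 / 2)\<^sup>2" using r by (intro power_mono) auto
      moreover have "rc (sc t rt) x = 1 + rc (sc t Z) x"
        unfolding rt_eq using rc_add[OF asum_one aZ, of x] by (simp add: rc_one)
      ultimately show ?thesis by (simp add: power2_eq_square)
    qed
    have rt: "asum 1 (sc t rt)" "par True (sc t rt)"
      unfolding rt_eq using aZ parZ par_sca[OF sca_KK[of 1]] by (auto intro: asum_add asum_one par_add par_sc)
    note F = F_op_rc[OF h dm par_eqs nb_imp_asum[OF nb_sc[OF nbw t]] par_sc[OF parw] sca_sc[OF scas(1)]
        nb_imp_asum[OF nb_sc[OF nbL t]] sca_sc[OF scas(2)] nb_imp_asum[OF nb_sc[OF nbG t]]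
        sca_sc[OF scas(3)] nb_imp_asum[OF nb_sc[OF nbM t]] rt pos eq1' eq2']
    show ?thesis
      using X F unfolding bet_eq unfolding lam_def mu_def w_def scs by blast
  qed
  \<comment> \<open>w - s phi0 is s times a series Y that vanishes at parameter 0, hence is bounded
    by |s| / e times its norm bound e |phi1| + r^2; the 5 comes from
    \<open>holder_norm_rc\<close>.\<close>
  define cc where "cc = 5 * (e * tnorm 3 phi1 + r\<^sup>2) / e"
  have bound: "\<bar>holder_norm 2 \<alpha> (\<lambda>x. w s x - s * tc phi0 x)\<bar> \<le> cc * s\<^sup>2" if s: "\<bar>s\<bar> < e" for s
  proof -
    define t where "t = s * (1 / e)"
    have t: "\<bar>t\<bar> \<le> 1" "\<bar>t\<bar> = \<bar>s\<bar> / e" using s e by (auto simp: t_def abs_mult)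
    have scs: "sc s (sc (1 / e) X) = sc t X" for X by (simp add: sc_sc t_def)
    define Y where "Y = sc t (ss r) * fps_const phi1 + sc t (sV U)"
    have "nb 3 Y (\<bar>t\<bar> * e * tnorm 3 phi1 + \<bar>t\<bar> * r\<^sup>2)"
      unfolding Y_def
      by (intro nb_add nb_mult nb_fps_const nb_sc_vz[OF nbss t(1) vz_ss] nb_sc_vz[OF nbV t(1) sV0(1)])
    from nb_mult[OF nb_KK this, of s] have nbY: "nb 3 (KK s * Y) (\<bar>s\<bar> * (\<bar>t\<bar> * e * tnorm 3 phi1 + \<bar>t\<bar> * r\<^sup>2))" .
    have "asum 1 Y"
      unfolding Y_def
      by (intro asum_add asum_mult asum_fps nb_imp_asum[OF nb_sc[OF nbss t(1)]]
          asum_mono[OF nb_imp_asum[OF nb_sc[OF nbV t(1)]]]) simp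
    moreover have "par True Y"
      unfolding Y_def
      by (intro par_add par_mult_even par_sc par_sca[OF sca_ss] par_fps) (use adm in auto)
    ultimately have gY: "good Y" by (simp add: good_def)
    have gss: "good (sc t (ss r))" and gp: "good (fps_const phi0)"
      unfolding good_def
      using par_sc[OF par_sca[OF sca_ss]] nb_imp_asum[OF nb_sc[OF nbss t(1)]] par_fps asum_fps by auto
    have rss: "rc (sc t (ss r)) x = s" for x
    proof -
      have gX: "good fps_X" unfolding good_def using nb_imp_asum[OF nb_X] by (auto intro: par_sca)
      have "sc t (ss r) = KK (e * t) * fps_X"
        by (simp add: ss_def sc_mult sc_KK sc_X KK_mult e_def mult_ac)
      then show ?thesis using e by (simp add: rc_mult_good gX good_KK rc_KK rc_X t_def)
    qed
    have "sc t wu = sc t (ss r) * (fps_const phi0 + Y)"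
      by (simp add: wu_def Wu_def Y_def sc_mult sc_add sc_fps_const add.assoc)
    then have "w s x = s * (rc (fps_const phi0) x + rc Y x)" for x
      by (simp add: w_def scs rc_mult_good gss rc_add_good gp gY good_add rss)
    moreover have "rc (fps_const phi0) x = tc phi0 x" for x
    proof -
      have "(\<lambda>j. tc (fps_const phi0 $ j) x) sums (\<Sum>j\<in>{0}. tc (fps_const phi0 $ j) x)"
        by (rule sums_finite) (auto simp: tc_def)
      then show ?thesis by (simp add: rc_def sums_iff)
    qed
    ultimately have "(\<lambda>x. w s x - s * tc phi0 x) = rc (KK s * Y)"
      by (intro ext) (simp add: rc_mult_good gY good_KK rc_KK algebra_simps)
    then have "\<bar>holder_norm 2 \<alpha> (\<lambda>x. w s x - s * tc phi0 x)\<bar> \<le> 5 * (\<bar>s\<bar> * (\<bar>t\<bar> * e * tnorm 3 phi1 + \<bar>t\<bar> * r\<^sup>2))"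
      using holder_norm_rc[OF nbY al] by simp
    also have "\<dots> = cc * s\<^sup>2"
      unfolding t(2) cc_def using e by (simp add: field_simps power2_eq_square)
    finally show ?thesis .
  qed
  have "eventually (\<lambda>s. \<bar>s\<bar> < e) (at 0)"
    using e by (auto simp: eventually_at intro!: exI[of _ e])
  then have "eventually (\<lambda>s. norm (holder_norm 2 \<alpha> (\<lambda>x. w s x - s * tc phi0 x)) \<le> cc * norm (s\<^sup>2)) (at 0)"
    by eventually_elim (use bound in auto)
  then have O: "(\<lambda>s. holder_norm 2 \<alpha> (\<lambda>x. w s x - s * tc phi0 x)) \<in> O[at 0](\<lambda>s. s\<^sup>2)"
    by (rule bigoI)
  show ?thesis
    unfolding curve_exists_def using e smooth curve init sol O by blast
qed

end

section \<open>The kernel of the linearisation\<close>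

lemma nonneg_by_deriv:
  fixes f f' :: "real \<Rightarrow> real"
  assumes "f 0 = 0" "\<And>x. (f has_field_derivative f' x) (at x)" "\<And>x. 0 \<le> x \<Longrightarrow> 0 \<le> f' x" "0 \<le> y"
  shows "0 \<le> f y"
proof -
  have "f 0 \<le> f y"
    by (rule DERIV_nonneg_imp_nondecreasing[OF assms(4)]) (use assms in blast)
  then show ?thesis using assms(1) by simp
qed

lemma sinh_ge_self: assumes "0 \<le> y" shows "y \<le> sinh (y :: real)"
proof -
  have "0 \<le> sinh y - y"
    by (rule nonneg_by_deriv[of "\<lambda>y. sinh y - y" "\<lambda>y. cosh y - 1"])
      (use assms in \<open>auto intro!: derivative_eq_intros simp: cosh_real_ge_1\<close>)
  then show ?thesis by simp
qed

lemma cosh_ge_quadratic: assumes "0 \<le> y" shows "1 + y\<^sup>2 / 2 \<le> cosh (y :: real)"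
proof -
  have "0 \<le> cosh y - 1 - y\<^sup>2 / 2"
    by (rule nonneg_by_deriv[of "\<lambda>y. cosh y - 1 - y\<^sup>2 / 2" "\<lambda>y. sinh y - y"])
      (use assms in \<open>auto intro!: derivative_eq_intros simp: sinh_ge_self\<close>)
  then show ?thesis by simp
qed

lemma sinh_ge_cubic: assumes "0 \<le> y" shows "y + y ^ 3 / 6 \<le> sinh (y :: real)"
proof -
  have "0 \<le> sinh y - y - y ^ 3 / 6"
  proof (rule nonneg_by_deriv[of "\<lambda>y. sinh y - y - y ^ 3 / 6" "\<lambda>y. cosh y - 1 - y\<^sup>2 / 2"])
    show "0 \<le> x \<Longrightarrow> 0 \<le> cosh x - 1 - x\<^sup>2 / 2" for x :: real using cosh_ge_quadratic[of x] by simp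
  qed (use assms in \<open>auto intro!: derivative_eq_intros\<close>)
  then show ?thesis by simp
qed

lemma tanh_le_self: assumes "0 \<le> y" shows "tanh y \<le> (y :: real)"
proof -
  have "0 \<le> y - tanh y"
    by (rule nonneg_by_deriv[of "\<lambda>y. y - tanh y" "\<lambda>y. (tanh y)\<^sup>2"])
      (use assms in \<open>auto intro!: derivative_eq_intros\<close>)
  then show ?thesis by simp
qed

lemma tanh_ge_cubic: "0 \<le> y \<Longrightarrow> y - y ^ 3 / 3 \<le> tanh (y :: real)"
proof -
  assume y: "0 \<le> y"
  have "0 \<le> tanh y - (y - y ^ 3 / 3)"
  proof (rule nonneg_by_deriv[of "\<lambda>y. tanh y - (y - y ^ 3 / 3)" "\<lambda>y. (1 - (tanh y)\<^sup>2) - (1 - y\<^sup>2)" y])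
    show "((\<lambda>y. tanh y - (y - y ^ 3 / 3)) has_field_derivative (1 - (tanh x)\<^sup>2) - (1 - x\<^sup>2)) (at x)" for x :: real
      by (auto intro!: derivative_eq_intros)
    show "0 \<le> x \<Longrightarrow> 0 \<le> (1 - (tanh x)\<^sup>2) - (1 - x\<^sup>2)" for x :: real
      using power_mono[OF tanh_le_self[of x], of 2] by simp
  qed (use y in auto)
  then show ?thesis by simp
qed

text \<open>After division by cosh y, the cubic lower bounds for sinh and tanh are just sharp
  enough: the y^4 terms cancel and (y^3 / 6)^2 remains.\<close>

lemma hyperbolic_inequality:
  fixes y :: real assumes "y > 0"
  shows "2 * y\<^sup>2 * cosh y < y * sinh y + cosh y * (sinh y)\<^sup>2"
proof -
  have "(y + y ^ 3 / 6)\<^sup>2 \<le> (sinh y)\<^sup>2"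
    using assms sinh_ge_cubic[of y] by (intro power_mono) auto
  moreover have "y * (y - y ^ 3 / 3) \<le> y * tanh y"
    using assms tanh_ge_cubic[of y] by (intro mult_left_mono) auto
  moreover have "(y + y ^ 3 / 6)\<^sup>2 + y * (y - y ^ 3 / 3) = 2 * y\<^sup>2 + (y ^ 3 / 6)\<^sup>2"
    by (simp add: power2_eq_square power3_eq_cube algebra_simps)
  moreover have "0 < (y ^ 3 / 6)\<^sup>2" using assms by simp
  ultimately have "2 * y\<^sup>2 < y * tanh y + (sinh y)\<^sup>2" by linarith
  then have "2 * y\<^sup>2 * cosh y < (y * tanh y + (sinh y)\<^sup>2) * cosh y"
    by (intro mult_strict_right_mono) auto
  also have "\<dots> = y * sinh y + cosh y * (sinh y)\<^sup>2"
    by (simp add: tanh_def algebra_simps)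
  finally show ?thesis .
qed

text \<open>Up to a factor, the derivative of \<open>k * coth (k * h)\<close> with respect to \<open>k^2\<close>.\<close>

definition slope :: "real \<Rightarrow> real" where "slope y = coth y / y - 1 / (sinh y)\<^sup>2"

lemma slope_decreasing:
  assumes "0 < a" "a < b" shows "slope b < slope a"
proof (rule DERIV_neg_imp_decreasing[OF assms(2)])
  fix y assume "a \<le> y" "y \<le> b"
  then have y: "y > 0" using assms by simp
  then have s: "sinh y > 0" by simp
  let ?D = "((sinh y * sinh y - cosh y * cosh y) / (sinh y * sinh y) * y - coth y) / (y * y)
     + 2 * sinh y * cosh y / ((sinh y)\<^sup>2 * (sinh y)\<^sup>2)"
  have "(slope has_field_derivative ?D) (at y)"
    unfolding slope_def[abs_def] coth_def[abs_def]
    using y s by (auto intro!: derivative_eq_intros simp: field_simps power2_eq_square)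
  moreover have "?D < 0"
  proof -
    have c: "sinh y * sinh y - cosh y * cosh y = - 1"
      using cosh_square_eq[of y] by (simp add: power2_eq_square)
    have "?D = (2 * y\<^sup>2 * cosh y - (y * sinh y + cosh y * (sinh y)\<^sup>2)) / (y\<^sup>2 * sinh y ^ 3)"
      unfolding c coth_def using y s by (simp add: field_simps power2_eq_square power3_eq_cube)
    also have "\<dots> < 0"
      using hyperbolic_inequality[OF y] y s by (intro divide_neg_pos) auto
    finally show ?thesis .
  qed
  ultimately show "\<exists>D. (slope has_real_derivative D) (at y) \<and> D < 0" by blast
qed

text \<open>By Rolle, three zeros of f give two zeros of f', that is, two points with the same value
  of \<open>slope\<close>, which is strictly decreasing.\<close>

lemma three_modes:
  fixes c d s :: real
  assumes h: "h > 0" and c: "c > 0" and x: "0 < x1" "x1 < x2" "x2 < x3"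
    and f: "f = (\<lambda>x. c * (x * coth (x * h)) - s * x\<^sup>2 - d)"
    and zero: "f x1 = 0" "f x2 = 0" "f x3 = 0"
  shows False
proof -
  define f' where "f' x = c * h * x * slope (x * h) - 2 * s * x" for x
  have der: "(f has_field_derivative f' x) (at x)" if "x > 0" for x
  proof -
    have s: "sinh (x * h) > 0" using that h by simp
    have c2: "cosh (x * h) * cosh (x * h) = sinh (x * h) * sinh (x * h) + 1"
      using cosh_square_eq[of "x * h"] by (simp add: power2_eq_square)
    have "(f has_field_derivative
       c * (1 * coth (x * h) + x * ((sinh (x * h) * h * sinh (x * h) - cosh (x * h) * (cosh (x * h) * h)) / (sinh (x * h) * sinh (x * h)))) - s * (2 * x) - 0) (at x)"
      unfolding f coth_def[abs_def]
      using that h s by (auto intro!: derivative_eq_intros simp: field_simps)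
    also have "sinh (x * h) * h * sinh (x * h) - cosh (x * h) * (cosh (x * h) * h) = - h"
      using c2 by (simp add: algebra_simps)
    also have "c * (1 * coth (x * h) + x * (- h / (sinh (x * h) * sinh (x * h)))) - s * (2 * x) - 0 = f' x"
      unfolding f'_def slope_def using that h s by (simp add: field_simps power2_eq_square)
    finally show ?thesis .
  qed
  have cont: "continuous_on {a..b} f" if "0 < a" for a b
    by (rule DERIV_continuous_on[where D = f']) (use that der in \<open>auto intro: has_field_derivative_at_within\<close>)
  have rolle: "\<exists>z>a. z < b \<and> f' z = 0" if ab: "0 < a" "a < b" "f a = f b" for a b
  proof -
    have "f differentiable (at z)" if "a < z" for z
      using der[of z] that \<open>0 < a\<close> real_differentiable_def by (metis order.strict_trans)
    then obtain z where z: "a < z" "z < b" "(f has_real_derivative 0) (at z)"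
      using Rolle[OF ab(2,3) cont[OF ab(1)]] by blast
    then have "f' z = 0" using der[of z] ab(1) by (auto intro: DERIV_unique)
    then show ?thesis using z by blast
  qed
  obtain z1 where z1: "x1 < z1" "z1 < x2" "f' z1 = 0" using rolle[of x1 x2] x zero by auto
  obtain z2 where z2: "x2 < z2" "z2 < x3" "f' z2 = 0" using rolle[of x2 x3] x zero by auto
  have "c * h * slope (z1 * h) = 2 * s" "c * h * slope (z2 * h) = 2 * s"
    using z1 z2 x by (auto simp: f'_def)
  then have "slope (z1 * h) = slope (z2 * h)" using c h by (metis mult_cancel_left mult_eq_0_iff order_less_irrefl)
  moreover have "slope (z2 * h) < slope (z1 * h)"
    using z1 z2 x h by (intro slope_decreasing) auto
  ultimately show False by simp
qed

section \<open>The dispersion relation\<close>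

lemma Tk_pos: "h > 0 \<Longrightarrow> k \<ge> 1 \<Longrightarrow> Tk h k > 0"
  by (simp add: Tk_def)

lemma inverse_Tk: "h > 0 \<Longrightarrow> k \<ge> 1 \<Longrightarrow> 1 / Tk h k = real k * coth (real k * h)"
  by (simp add: Tk_def coth_def tanh_def)

text \<open>Multiplied by T > 0, the dispersion relation becomes c^2 + q - (lam - c)^2 = 0; its two
  roots are the two elements of \<open>lambda_set\<close>.\<close>

lemma lambda_set_iff:
  assumes "h > 0" "k \<ge> 1" "g * B + \<sigma> * (real k)\<^sup>2 > 0"
  shows "lam \<in> lambda_set g h A B \<sigma> \<beta> k \<longleftrightarrow>
    lam * (\<beta> + A * g * h) + g * B - lam\<^sup>2 * (real k * coth (real k * h)) + \<sigma> * (real k)\<^sup>2 = 0"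
proof -
  define T c q where "T = Tk h k" and "c = (\<beta> + A * g * h) / 2 * T" and "q = (g * B + \<sigma> * (real k)\<^sup>2) * T"
  have T: "T > 0" using Tk_pos assms by (simp add: T_def)
  then have q: "q > 0" using assms by (simp add: q_def)
  have rad: "(\<beta> + A * g * h)\<^sup>2 / 4 * T\<^sup>2 + (g * B + \<sigma> * (real k)\<^sup>2) * T = c\<^sup>2 + q"
    by (simp add: c_def q_def power2_eq_square)
  have "lam \<in> lambda_set g h A B \<sigma> \<beta> k \<longleftrightarrow> lam - c = sqrt (c\<^sup>2 + q) \<or> lam - c = - sqrt (c\<^sup>2 + q)"
    unfolding lambda_set_def lambda_plus_def lambda_minus_def T_def[symmetric] rad c_def[symmetric] by auto
  also have "\<dots> \<longleftrightarrow> (lam - c)\<^sup>2 = c\<^sup>2 + q"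
  proof
    assume "lam - c = sqrt (c\<^sup>2 + q) \<or> lam - c = - sqrt (c\<^sup>2 + q)"
    then show "(lam - c)\<^sup>2 = c\<^sup>2 + q" using q by (auto simp: add_nonneg_pos)
  next
    assume "(lam - c)\<^sup>2 = c\<^sup>2 + q"
    then have "\<bar>lam - c\<bar> = sqrt (c\<^sup>2 + q)" by (metis real_sqrt_abs)
    then show "lam - c = sqrt (c\<^sup>2 + q) \<or> lam - c = - sqrt (c\<^sup>2 + q)" by linarith
  qed
  also have "\<dots> \<longleftrightarrow> T * (lam * (\<beta> + A * g * h) + g * B - lam\<^sup>2 * (1 / T) + \<sigma> * (real k)\<^sup>2) = 0"
  proof -
    have "T * (lam * (\<beta> + A * g * h) + g * B - lam\<^sup>2 * (1 / T) + \<sigma> * (real k)\<^sup>2)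
      = T * (lam * (\<beta> + A * g * h)) + T * (g * B) - lam\<^sup>2 * (T * (1 / T)) + T * (\<sigma> * (real k)\<^sup>2)"
      by (simp add: algebra_simps)
    also have "\<dots> = c\<^sup>2 + q - (lam - c)\<^sup>2"
      using T by (simp add: c_def q_def power2_eq_square field_simps)
    finally show ?thesis by auto
  qed
  also have "\<dots> \<longleftrightarrow> lam * (\<beta> + A * g * h) + g * B - lam\<^sup>2 * (real k * coth (real k * h)) + \<sigma> * (real k)\<^sup>2 = 0"
    using T inverse_Tk[OF assms(1,2)] by (simp add: T_def)
  finally show ?thesis .
qed

definition cosp :: "nat \<Rightarrow> real \<Rightarrow> trig" where
  "cosp m c = single (int m) (c / 2) + single (- int m) (c / 2)"

lemma lookup_cosp: "m \<ge> 1 \<Longrightarrow> lookup (cosp m c) j = (if \<bar>j\<bar> = int m then c / 2 else 0)"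
  by (auto simp: cosp_def lookup_add lookup_single when_def)

lemma tc_add: "tc (p + q) x = tc p x + tc q x"
  using tev_add[of p q x] by (simp add: tev_eq complex_eq_iff)

lemma tc_cosp: "m \<ge> 1 \<Longrightarrow> tc (cosp m c) x = c * cos (real m * x)"
proof -
  have "tc (single k c) x = c * cos (real_of_int k * x)" for k c by (auto simp: tc_def)
  then show ?thesis by (simp add: cosp_def tc_add)
qed

definition dsym :: "real \<Rightarrow> int \<Rightarrow> real" where "dsym h j = real_of_int j * coth (real_of_int j * h)"

text \<open>The symbol \<open>ell\<close> in the original parameters, available outside the locale
  because the locale parameter \<open>sm\<close> has to be chosen from it.\<close>

definition lsym :: "real \<Rightarrow> real \<Rightarrow> real \<Rightarrow> real \<Rightarrow> real \<Rightarrow> real \<Rightarrow> real \<Rightarrow> int \<Rightarrow> real" where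
  "lsym g h A B \<sigma> lam \<beta> j =
     2 * (lam * (\<beta> + g * A * h) + g * B - lam\<^sup>2 * dsym h j + \<sigma> * (real_of_int j * real_of_int j))"

lemma dsym_minus: "dsym h (- j) = dsym h j"
  by (simp add: dsym_def coth_minus)

lemma lsym_minus: "lsym g h A B \<sigma> lam \<beta> (- j) = lsym g h A B \<sigma> lam \<beta> j"
  by (simp add: lsym_def dsym_minus)

lemma lsym_abs: "lsym g h A B \<sigma> lam \<beta> \<bar>j\<bar> = lsym g h A B \<sigma> lam \<beta> j"
  by (cases "j \<ge> 0") (auto simp: lsym_minus)

lemma dsym_bound: "h > 0 \<Longrightarrow> \<bar>dsym h j\<bar> \<le> coth h * \<bar>real_of_int j\<bar>"
  using mult_right_mono[OF ct_bound[of h j], of "\<bar>real_of_int j\<bar>"]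
  by (simp add: dsym_def ct_def abs_mult mult.commute)

text \<open>Surface tension contributes sigma j^2, while all other terms grow at most linearly;
  hence the inverse symbol gains two derivatives.\<close>

lemma lsym_growth:
  assumes h: "h > 0" and s: "\<sigma> > 0" and Exc: "\<And>j. j \<notin> Exc \<Longrightarrow> lsym g h A B \<sigma> lam \<beta> j \<noteq> 0"
  obtains C where "\<And>j. \<bar>if j \<in> Exc then 0 else 1 / lsym g h A B \<sigma> lam \<beta> j\<bar> * (1 + \<bar>real_of_int j\<bar>)\<^sup>2 \<le> C"
proof -
  let ?l = "lsym g h A B \<sigma> lam \<beta>"
  define Y P D where "Y = lam * (\<beta> + g * A * h) + g * B" and "P = \<bar>Y\<bar>" and "D = lam\<^sup>2 * coth h"
  define c where "c = 2 * (P + D)"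
  have ct0: "coth h > 0" using h by (simp add: coth_def)
  have c: "c \<ge> 0" using ct0 by (simp add: c_def P_def D_def)
  obtain N :: nat where N: "real N > c / \<sigma> + 1" using reals_Archimedean2 by blast
  define f where "f j = (1 + \<bar>real_of_int j\<bar>)\<^sup>2 / \<bar>?l j\<bar>" for j
  \<comment> \<open>The 4 comes from (1 + x)^2 <= (2 x)^2 for large modes; the finitely many others
    are covered by the sum.\<close>
  define C where "C = 4 / \<sigma> + (\<Sum>j\<in>{- int N..int N}. f j)"
  have f0: "f j \<ge> 0" for j by (simp add: f_def)
  have "f j \<le> C" if "j \<notin> Exc" for j
  proof (cases "\<bar>j\<bar> \<le> int N")
    case True
    then have "f j \<le> (\<Sum>j\<in>{- int N..int N}. f j)"
      by (intro member_le_sum f0) auto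
    moreover have "4 / \<sigma> \<ge> 0" using s by simp
    ultimately show ?thesis unfolding C_def by linarith
  next
    case False
    define x where "x = \<bar>real_of_int j\<bar>"
    have x: "x > real N" using False by (simp add: x_def)
    then have x1: "x \<ge> 1" using N c s by (smt (verit) divide_nonneg_pos)
    have "c / \<sigma> \<le> x" using N x by linarith
    then have "c \<le> \<sigma> * x" using s by (simp add: pos_divide_le_eq mult.commute)
    then have cx: "c * x \<le> \<sigma> * x * x" using x1 by (intro mult_right_mono) auto
    have "lam\<^sup>2 * dsym h j \<le> lam\<^sup>2 * (coth h * x)"
      using dsym_bound[OF h, of j] by (intro mult_left_mono) (auto simp: x_def)
    then have "lam\<^sup>2 * dsym h j \<le> D * x" by (simp add: D_def mult.assoc)
    moreover have "P * 1 \<le> P * x"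
      using x1 by (intro mult_left_mono) (auto simp: P_def)
    moreover have "- P \<le> Y" by (simp add: P_def)
    moreover have "?l j = 2 * (Y - lam\<^sup>2 * dsym h j + \<sigma> * x * x)" by (simp add: lsym_def Y_def x_def)
    moreover have "c * x = 2 * (P * x) + 2 * (D * x)" by (simp add: c_def algebra_simps)
    moreover have "l \<ge> 2 * S - cx"
      if "ld \<le> Dx" "P' * 1 \<le> Px" "- P' \<le> Y'" "l = 2 * (Y' - ld + S)" "cx = 2 * Px + 2 * Dx"
      for l S cx ld Dx P' Px Y' :: real using that by argo
    ultimately have "?l j \<ge> 2 * (\<sigma> * x * x) - c * x" by blast
    then have l: "?l j \<ge> \<sigma> * x * x" using cx by linarith
    have sx: "\<sigma> * x * x > 0" using s x1 by simp
    have "(1 + x)\<^sup>2 \<le> (2 * x)\<^sup>2" using x1 by (intro power_mono) auto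
    then have "(1 + x)\<^sup>2 \<le> (4 / \<sigma>) * (\<sigma> * x * x)" using s by (simp add: power2_eq_square)
    also have "\<dots> \<le> (4 / \<sigma>) * ?l j" using l s by (intro mult_left_mono) auto
    finally have "(1 + x)\<^sup>2 \<le> 4 / \<sigma> * ?l j" .
    moreover have "?l j > 0" using l sx by linarith
    ultimately have "f j \<le> 4 / \<sigma>"
      unfolding f_def x_def[symmetric] by (simp only: abs_of_pos pos_divide_le_eq)
    moreover have "0 \<le> (\<Sum>j\<in>{- int N..int N}. f j)" by (intro sum_nonneg f0)
    ultimately show ?thesis by (simp add: C_def)
  qed
  moreover have "C \<ge> 0" unfolding C_def using s by (intro add_nonneg_nonneg sum_nonneg f0) auto
  ultimately show thesis by (intro that[of C]) (auto simp: f_def)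
qed

section \<open>Solving the kernel equations\<close>

context wave_series
begin

lemma p1_q1: "p1 r U - KK d * q1 r U = KK (x1 - d * x3) * Yn r U + KK (x2 - d * x4) * Yk r U"
  by (simp add: p1_def q1_def KK_diff KK_mult algebra_simps)

text \<open>The choice of \<open>x2\<close> removes \<open>Yk\<close> from p - d q for d =
  \<open>dm n\<close>, and the first condition normalises the factor of \<open>Yn\<close>.\<close>

lemma kernel_first:
  assumes "a * (x1 - dm n * x3) = - 1" "x2 = dm n * x4"
  shows "KK a * (p1 r U - KK (dm n) * q1 r U) = - (ss r * cof n (Ru r U))"
proof -
  have "KK a * KK (x1 - dm n * x3) = - 1"
    using assms(1) by (simp add: KK_minus flip: KK_mult)
  then have "KK a * (KK (x1 - dm n * x3) * Yn r U) = - Yn r U"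
    by (simp flip: mult.assoc)
  moreover have "KK (x2 - dm n * x4) = 0" using assms(2) by simp
  ultimately show ?thesis unfolding p1_q1 by (simp add: Yn_def)
qed

text \<open>If \<open>deg\<close> holds, the amplitude comes from \<open>phi1\<close> with a factor
  s, which is the factor s of the right-hand side; \<open>R0\<close> may be subtracted in
  \<open>Yk\<close> by \<open>cof_R0\<close>.\<close>

lemma kernel_second:
  assumes U: "adm U" and x: "x1 = dm k * x3"
    and y: "if deg then b = 0 \<and> y = 1 \<and> x2 - dm k * x4 = - 1 else y = 0 \<and> b * (x2 - dm k * x4) = - 1"
  shows "(KK b + ss r * KK y) * (p1 r U - KK (dm k) * q1 r U) = - (ss r * cof k (Ru r U))"
proof -
  have pq: "p1 r U - KK (dm k) * q1 r U = KK (x2 - dm k * x4) * Yk r U"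
    unfolding p1_q1 using x by simp
  show ?thesis
  proof (cases deg)
    case True
    have "Yk r U = cof k (Ru r U)"
      unfolding Yk_deg[OF True] cof_diff cof_R0[OF True U] by simp
    moreover have "b = 0" "y = 1" "x2 - dm k * x4 = - 1" using y True by auto
    ultimately show ?thesis unfolding pq by (simp add: KK_minus)
  next
    case False
    have b: "y = 0" "b * (x2 - dm k * x4) = - 1" using y False by auto
    have "KK b * KK (x2 - dm k * x4) = - 1"
      using b(2) by (simp add: KK_minus flip: KK_mult)
    then have "KK b * (KK (x2 - dm k * x4) * Yk r U) = - Yk r U"
      by (simp flip: mult.assoc)
    then show ?thesis unfolding pq b(1) using Yk_nondeg[OF False, of r U] by simp
  qed
qed

end

text \<open>Provides the witnesses for \<open>x1\<close> to \<open>x4\<close>; up to sign, u - v is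
  the determinant of the 2x2 system.\<close>

lemma solve_pair:
  fixes p u v :: real
  assumes "p \<noteq> 0" "u \<noteq> v"
  shows "p * (u * (- 1 / (p * (u - v))) - v * (- 1 / (p * (u - v)))) = - 1"
proof -
  have "p * (u * c - v * c) = p * (u - v) * c" for c by (simp add: algebra_simps)
  from this[of "- 1 / (p * (u - v))"] show ?thesis using assms by simp
qed

context
  fixes g h A B \<sigma> \<alpha> lam0 \<beta>0 :: real
  assumes pos: "g > 0" "h > 0" "B > 0" "\<sigma> > 0" and al: "0 < \<alpha>" "\<alpha> < 1"
begin

abbreviation (input) "lin \<equiv> lsym g h A B \<sigma> lam0 \<beta>0"
abbreviation (input) "bifurcates \<equiv> curve_exists g h A B \<sigma> \<alpha> lam0 \<beta>0"

text \<open>\<open>Exc\<close> consists of the modes on which \<open>sm\<close> is set to 0: mode 0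
  and the kernel. If k lies outside, it is a mere placeholder of amplitude 0.\<close>

lemma curve_exists_kernel:
  fixes n k :: nat and Exc :: "int set" and a b y x1 x2 x3 x4 :: real
  assumes nk: "n \<ge> 1" "k \<ge> 1" "n \<noteq> k"
    and Exc: "0 \<in> Exc" "Exc \<subseteq> {0, int n, - int n, int k, - int k}" "\<And>j. - j \<in> Exc \<longleftrightarrow> j \<in> Exc" "int n \<in> Exc"
    and invertible: "\<And>j. j \<notin> Exc \<Longrightarrow> lin j \<noteq> 0"
    and n: "lin (int n) = 0"
      "a * (x1 - dsym h (int n) * x3) = - 1" "x2 = dsym h (int n) * x4"
    and k: "int k \<in> Exc \<Longrightarrow> lin (int k) = 0 \<and> x1 = dsym h (int k) * x3 \<and>
        (if deg then b = 0 \<and> y = 1 \<and> x2 - dsym h (int k) * x4 = - 1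
         else y = 0 \<and> b * (x2 - dsym h (int k) * x4) = - 1)"
      "int k \<notin> Exc \<Longrightarrow> b = 0 \<and> y = 0" "deg \<Longrightarrow> b = 0 \<and> k \<noteq> 2 * n"
  shows "bifurcates (\<lambda>x. a * cos (real n * x) + b * cos (real k * x))"
proof -
  define sm where "sm j = (if j \<in> Exc then 0 else 1 / lin j)" for j
  obtain cS where cS: "\<And>j. \<bar>sm j\<bar> * (1 + \<bar>real_of_int j\<bar>)\<^sup>2 \<le> cS"
    unfolding sm_def using lsym_growth[OF pos(2,4) invertible] by blast
  define phi0 where "phi0 = cosp n a + cosp k b"
  define phi1 where "phi1 = cosp k y"
  have lp0: "lookup phi0 j = (if \<bar>j\<bar> = int n then a / 2 else if \<bar>j\<bar> = int k then b / 2 else 0)" for j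
    using nk by (simp add: phi0_def lookup_add lookup_cosp)
  have lp1: "lookup phi1 j = (if \<bar>j\<bar> = int k then y / 2 else 0)" for j
    using nk by (simp add: phi1_def lookup_cosp)
  interpret wave_series h "g * A / 2" "g * A * h" "g * B" \<sigma> lam0 "\<beta>0 + g * A * h" "coth h" cS x1 x2 x3 x4
    "int n" "int k" phi0 phi1 "dsym h" sm deg
  proof
    fix j
    show "dsym h (- j) = dsym h j" by (rule dsym_minus)
    have "coth h > 0" using pos by (simp add: coth_def)
    then have "coth h * \<bar>real_of_int j\<bar> \<le> coth h * (1 + \<bar>real_of_int j\<bar>)" by (intro mult_left_mono) auto
    then show "\<bar>dsym h j\<bar> \<le> coth h * (1 + \<bar>real_of_int j\<bar>)" using dsym_bound[OF pos(2), of j] by linarith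
    show "sm (- j) = sm j" using Exc(3)[of j] by (auto simp: sm_def lsym_minus)
    show "\<bar>sm j\<bar> * (1 + \<bar>real_of_int j\<bar>)\<^sup>2 \<le> cS" by (rule cS)
  next
    show "parity True phi0" "parity True phi1" by (auto simp: parity_iff lp0 lp1)
    assume "deg"
    then show "keys phi0 \<subseteq> {int n, - int n}" using k(3) by (auto simp: in_keys_iff lp0 split: if_splits)
    show "int k \<notin> {0, int n, - int n, 2 * int n, - 2 * int n}" using k(3)[OF \<open>deg\<close>] nk by auto
  qed
  have ell: "ell j = lin j" for j by (simp add: ell_def lsym_def)
  have lam0: "lam0 \<noteq> 0"
  proof
    assume "lam0 = 0"
    then have "lin (int n) = 2 * (g * B + \<sigma> * (real n * real n))" by (simp add: lsym_def)
    moreover have "g * B + \<sigma> * (real n * real n) > 0" using pos by (intro add_pos_nonneg) auto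
    ultimately show False using n(1) by simp
  qed
  have inExc: "j \<in> Exc \<Longrightarrow> j = 0 \<or> \<bar>j\<bar> = int n \<or> \<bar>j\<bar> = int k" for j using Exc(2) by auto
  have absExc: "\<bar>j\<bar> \<in> Exc \<longleftrightarrow> j \<in> Exc" for j using Exc(3)[of j] by (cases "j \<ge> 0") auto
  have sm0: "sm j = 0 \<longleftrightarrow> j \<in> Exc" for j using invertible by (auto simp: sm_def)
  have dabs: "dsym h j = dsym h \<bar>j\<bar>" for j by (cases "j \<ge> 0") (auto simp: dsym_minus)
  have ker: "ell j = 0 \<and>
      (KK (2 * lookup phi0 j) + ss r * KK (2 * lookup phi1 j)) * (p1 r U - KK (dsym h j) * q1 r U)
        = - (ss r * cof j (Ru r U))" if U: "adm U" and j: "j \<noteq> 0" "sm j = 0" for r U j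
  proof -
    have "par True (Ru r U)" using near_alg_Ru U by (auto simp: near_alg_def)
    then have cofabs: "cof j (Ru r U) = cof \<bar>j\<bar> (Ru r U)" by (cases "j \<ge> 0") (auto simp: cof_par)
    have jE: "j \<in> Exc" using j(2) sm0 by blast
    from inExc[OF this] j(1) have "\<bar>j\<bar> = int n \<or> \<bar>j\<bar> = int k" by blast
    then show ?thesis
    proof
      assume 1: "\<bar>j\<bar> = int n"
      have l: "2 * lookup phi0 j = a" "2 * lookup phi1 j = 0" using 1 nk by (simp_all add: lp0 lp1)
      have "ell j = 0" unfolding ell using n(1) lsym_abs[of g h A B \<sigma> lam0 \<beta>0 j] 1 by simp
      then show ?thesis
        unfolding l cofabs dabs[of j] 1 using kernel_first[OF n(2,3), of r U] by simp
    next
      assume 2: "\<bar>j\<bar> = int k"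
      have "int k \<in> Exc" using absExc[of j] jE unfolding 2 by blast
      note kk = k(1)[OF this]
      have l: "2 * lookup phi0 j = b" "2 * lookup phi1 j = y" using 2 nk by (simp_all add: lp0 lp1)
      have "ell j = 0" unfolding ell using kk lsym_abs[of g h A B \<sigma> lam0 \<beta>0 j] 2 by simp
      then show ?thesis
        unfolding l cofabs dabs[of j] 2 using kernel_second[OF U conjunct1[OF conjunct2[OF kk]] conjunct2[OF conjunct2[OF kk]]]
        by blast
    qed
  qed
  have reg: "sm j * ell j = 1 \<and> lookup phi0 j = 0 \<and> lookup phi1 j = 0" if "sm j \<noteq> 0" for j
  proof -
    have j: "j \<notin> Exc" using that sm0 by blast
    then have "\<bar>j\<bar> \<noteq> int n" using Exc(4) absExc[of j] by auto
    moreover have "\<bar>j\<bar> = int k \<Longrightarrow> b = 0 \<and> y = 0" using k(2) j absExc[of j] by auto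
    ultimately show ?thesis using j invertible[of j] by (auto simp: sm_def ell lp0 lp1)
  qed
  have tcphi: "tc phi0 x = a * cos (real n * x) + b * cos (real k * x)" for x
    using nk by (simp add: phi0_def tc_add tc_cosp)
  have "tc phi0 = (\<lambda>x. a * cos (real n * x) + b * cos (real k * x))" using tcphi by (rule ext)
  then show ?thesis
    using solution_curve[OF pos(2) _ refl refl refl lam0 _ _ _ reg ker al] nk Exc(1)
    by (simp add: dsym_def[abs_def] lp0 lp1 sm_def)
qed

lemma lsym_zero_iff:
  assumes "k \<ge> 1"
  shows "lin (int k) = 0 \<longleftrightarrow> lam0 \<in> lambda_set g h A B \<sigma> \<beta>0 k"
proof -
  have "g * B + \<sigma> * (real k)\<^sup>2 > 0" using pos by (intro add_pos_nonneg) auto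
  note iff = lambda_set_iff[OF pos(2) assms this, of lam0 A \<beta>0]
  have "lin (int k) = 2 * (lam0 * (\<beta>0 + A * g * h) + g * B
      - lam0\<^sup>2 * (real k * coth (real k * h)) + \<sigma> * (real k)\<^sup>2)"
    by (simp add: lsym_def dsym_def power2_eq_square mult_ac)
  then show ?thesis unfolding iff by (simp only: mult_eq_0_iff) simp
qed

lemma lsym_three_zeros:
  fixes i j k :: nat
  assumes ijk: "1 \<le> i" "i < j" "j < k"
    and z: "lin (int i) = 0" "lin (int j) = 0" "lin (int k) = 0"
  shows False
proof -
  have "lam0 \<noteq> 0"
  proof
    assume "lam0 = 0"
    then have "lin (int i) = 2 * (g * B + \<sigma> * (real i * real i))" by (simp add: lsym_def)
    moreover have "g * B + \<sigma> * (real i * real i) > 0" using pos by (intro add_pos_nonneg) auto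
    ultimately show False using z(1) by simp
  qed
  then have l: "lam0\<^sup>2 > 0" by simp
  show False
    by (rule three_modes[OF pos(2) l, of "real i" "real j" "real k" _ \<sigma> "lam0 * (\<beta>0 + g * A * h) + g * B", OF _ _ _ refl])
      (use ijk z in \<open>auto simp: lsym_def dsym_def power2_eq_square\<close>)
qed

lemma lsym_two_zeros:
  fixes n k j :: nat
  assumes nk: "1 \<le> n" "1 \<le> k" "n \<noteq> k" "1 \<le> j"
    and z: "lin (int n) = 0" "lin (int k) = 0" "lin (int j) = 0"
  shows "j = n \<or> j = k"
proof (rule ccontr)
  assume "\<not> (j = n \<or> j = k)"
  then consider "n < k \<and> k < j" | "n < j \<and> j < k" | "j < n \<and> n < k" | "k < n \<and> n < j" | "k < j \<and> j < n" | "j < k \<and> k < n"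
    using nk by linarith
  then show False
    by cases (use lsym_three_zeros nk z in blast)+
qed

text \<open>On the kernel only \<open>dsym\<close> and sigma j^2 vary with j, so equal values of
  \<open>dsym\<close> would force equal modes.\<close>

lemma dsym_neq:
  fixes n k :: nat
  assumes "n \<noteq> k" "lin (int n) = 0" "lin (int k) = 0"
  shows "dsym h (int n) \<noteq> dsym h (int k)"
proof
  assume eq: "dsym h (int n) = dsym h (int k)"
  define X where "X = lam0 * (\<beta>0 + g * A * h) + g * B - lam0\<^sup>2 * dsym h (int k)"
  have "X + \<sigma> * (real n * real n) = 0" "X + \<sigma> * (real k * real k) = 0"
    using assms(2,3) unfolding lsym_def eq of_int_of_nat_eq X_def[symmetric] by simp_all
  then have "\<sigma> * (real n * real n) = \<sigma> * (real k * real k)" by linarith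
  then have "real n * real n = real k * real k" using pos by simp
  then show False using assms(1) by (metis of_nat_eq_iff of_nat_mult power2_eq_square power2_eq_iff_nonneg of_nat_0_le_iff)
qed

lemma two_kernel_modes:
  fixes n k :: nat
  assumes nk: "1 \<le> n" "1 \<le> k" "n \<noteq> k"
    and z: "lin (int n) = 0" "lin (int k) = 0"
    and j: "j \<notin> {0, int n, - int n, int k, - int k}"
  shows "lin j \<noteq> 0"
proof
  assume "lin j = 0"
  then have "lin (int (nat \<bar>j\<bar>)) = 0" by (simp add: lsym_abs)
  then have "nat \<bar>j\<bar> = n \<or> nat \<bar>j\<bar> = k"
    using lsym_two_zeros[OF nk _ z, of "nat \<bar>j\<bar>"] j by auto
  moreover have "j \<noteq> 0" using j by simp
  ultimately have "j = int n \<or> j = - int n \<or> j = int k \<or> j = - int k" by linarith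
  then show False using j by auto
qed

lemma curve_exists_two_modes:
  fixes n k :: nat
  assumes nk: "n \<ge> 1" "k \<ge> 1" "n \<noteq> k"
    and z: "lin (int n) = 0" "lin (int k) = 0"
    and ab: "a \<noteq> 0" "b \<noteq> 0"
  shows "bifurcates (\<lambda>x. a * cos (real n * x) + b * cos (real k * x))"
proof -
  let ?n = "dsym h (int n)" and ?k = "dsym h (int k)"
  have d: "?n \<noteq> ?k" by (rule dsym_neq[OF nk(3) z])
  show ?thesis
    by (rule curve_exists_kernel[OF nk, where Exc = "{0, int n, - int n, int k, - int k}"
          and ?x3.0 = "- 1 / (a * (?k - ?n))" and ?x1.0 = "?k * (- 1 / (a * (?k - ?n)))"
          and ?x4.0 = "- 1 / (b * (?n - ?k))" and ?x2.0 = "?n * (- 1 / (b * (?n - ?k)))"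
          and deg = False and y = 0])
      (use two_kernel_modes[OF nk z] z ab solve_pair[OF ab(1) d[symmetric]] solve_pair[OF ab(2) d] in auto)
qed

lemma curve_exists_one_mode:
  fixes n :: nat
  assumes n: "n \<ge> 1"
    and z: "lin (int n) = 0" and z2: "lin (int (2 * n)) \<noteq> 0"
    and a: "a \<noteq> 0"
  shows "bifurcates (\<lambda>x. a * cos (real n * x))"
proof (cases "\<exists>k\<ge>1. k \<noteq> n \<and> lin (int k) = 0")
  case True
  then obtain k where k: "k \<ge> 1" "n \<noteq> k" "lin (int k) = 0" by auto
  have k2: "k \<noteq> 2 * n" using k(3) z2 by auto
  let ?n = "dsym h (int n)" and ?k = "dsym h (int k)"
  have d: "?n \<noteq> ?k" by (rule dsym_neq[OF k(2) z k(3)])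
  \<comment> \<open>Any nonzero amplitude of the term s^2 cos(k x) would do; it is taken to be 1,
    which replaces b in the coefficients \<open>x2\<close> and \<open>x4\<close>.\<close>
  have "bifurcates (\<lambda>x. a * cos (real n * x) + 0 * cos (real k * x))"
  proof (rule curve_exists_kernel[OF n k(1,2), where Exc = "{0, int n, - int n, int k, - int k}"
        and ?x3.0 = "- 1 / (a * (?k - ?n))" and ?x1.0 = "?k * (- 1 / (a * (?k - ?n)))"
        and ?x4.0 = "- 1 / (1 * (?n - ?k))" and ?x2.0 = "?n * (- 1 / (1 * (?n - ?k)))"
        and deg = True and y = 1])
    show "a * (?k * (- 1 / (a * (?k - ?n))) - ?n * (- 1 / (a * (?k - ?n)))) = - 1"
      by (rule solve_pair[OF a d[symmetric]])
    show "lin (int k) = 0 \<and> ?k * (- 1 / (a * (?k - ?n))) = ?k * (- 1 / (a * (?k - ?n))) \<and>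
      (if True then 0 = (0::real) \<and> 1 = (1::real) \<and> ?n * (- 1 / (1 * (?n - ?k))) - ?k * (- 1 / (1 * (?n - ?k))) = - 1
       else 1 = (0::real) \<and> 0 * (?n * (- 1 / (1 * (?n - ?k))) - ?k * (- 1 / (1 * (?n - ?k)))) = - 1)"
      using k(3) solve_pair[OF one_neq_zero d] by (simp only: if_True mult_1_left simp_thms)
  qed (use two_kernel_modes[OF n k(1,2) z k(3)] z k2 in auto)
  then show ?thesis by simp
next
  case False
  have inv: "lin j \<noteq> 0" if "j \<notin> {0, int n, - int n}" for j
  proof
    assume "lin j = 0"
    then have "lin (int (nat \<bar>j\<bar>)) = 0" by (simp add: lsym_abs)
    moreover have "nat \<bar>j\<bar> \<ge> 1" using that by auto
    moreover have "nat \<bar>j\<bar> \<noteq> n"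
    proof
      assume "nat \<bar>j\<bar> = n"
      then have "\<bar>j\<bar> = int n" by auto
      then have "j = int n \<or> j = - int n" by linarith
      then show False using that by auto
    qed
    ultimately show False using False by blast
  qed
  \<comment> \<open>With a one-dimensional kernel p alone is adjusted and q stays 0;
    \<open>Suc n\<close> is the placeholder mode.\<close>
  have "bifurcates (\<lambda>x. a * cos (real n * x) + 0 * cos (real (Suc n) * x))"
    by (rule curve_exists_kernel[OF n, of "Suc n", where Exc = "{0, int n, - int n}"
          and ?x3.0 = 0 and ?x1.0 = "- 1 / a" and ?x4.0 = 0 and ?x2.0 = 0
          and deg = False and y = 0])
      (use inv z a n in auto)
  then show ?thesis by simp
qed

end

theorem theorem3:
  fixes g h A B \<sigma> \<alpha> lam0 \<beta>0 a b :: real and n m :: nat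
  assumes "g > 0" and "h > 0" and "B > 0" and "\<sigma> > 0"
    and "0 < \<alpha>" and "\<alpha> < 1"
    and "n \<ge> 1" and "m \<ge> 1" and "n \<noteq> m"
    and "\<beta>0 \<in> beta_set g h A B \<sigma> n m"
    and "lam0 \<in> lambda_set g h A B \<sigma> \<beta>0 n"
    and "a\<^sup>2 + b\<^sup>2 = 1"
    and "b \<noteq> 0 \<Longrightarrow> lam0 \<in> lambda_set g h A B \<sigma> \<beta>0 m"
    and "b = 0 \<Longrightarrow> lam0 \<notin> lambda_set g h A B \<sigma> \<beta>0 (2 * n)"
    and "a = 0 \<Longrightarrow> lam0 \<notin> lambda_set g h A B \<sigma> \<beta>0 (2 * m)"
  shows "\<exists>\<delta>>0. \<exists>(lam :: real \<Rightarrow> real) (\<beta> :: real \<Rightarrow> real) (\<mu> :: real \<Rightarrow> real)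
              (w :: real \<Rightarrow> real \<Rightarrow> real).
           smooth_on {-\<delta><..<\<delta>} lam \<and> smooth_on {-\<delta><..<\<delta>} \<beta> \<and> smooth_on {-\<delta><..<\<delta>} \<mu> \<and>
           smooth_X_curve_on \<alpha> {-\<delta><..<\<delta>} w \<and>
           lam 0 = lam0 \<and> \<beta> 0 = \<beta>0 \<and> \<mu> 0 = 0 \<and> w 0 = (\<lambda>x. 0) \<and>
           (\<forall>s\<in>{-\<delta><..<\<delta>}. w s \<in> space_X \<alpha> \<and> nondegenerate h (w s) \<and>
              F_op g h A B \<sigma> (lam s) (\<beta> s) (\<mu> s, w s) = (\<lambda>x. 0)) \<and>
           (\<lambda>s. holder_norm 2 \<alpha>
                  (\<lambda>x. w s x - s * (a * cos (real n * x) + b * cos (real m * x))))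
             \<in> O[at 0](\<lambda>s. s\<^sup>2)"
proof -
  note pos = assms(1-4) and al = assms(5,6)
  note iff = lsym_zero_iff[OF pos al, of _ A lam0 \<beta>0]
  have "curve_exists g h A B \<sigma> \<alpha> lam0 \<beta>0 (\<lambda>x. a * cos (real n * x) + b * cos (real m * x))"
  proof -
    consider "a \<noteq> 0" "b \<noteq> 0" | "b = 0" "a \<noteq> 0" | "a = 0" "b \<noteq> 0" using assms(12)
      by (cases "a = 0"; cases "b = 0") auto
    then show ?thesis
    proof cases
      case 1
      then show ?thesis using curve_exists_two_modes[OF pos al assms(7-9)] iff assms(7,8,11,13) by auto
    next
      case 2
      then show ?thesis using curve_exists_one_mode[OF pos al assms(7)] iff[of n] iff[of "2 * n"] assms(7,11,14) by auto
    next
      case 3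
      then show ?thesis using curve_exists_one_mode[OF pos al assms(8)] iff[of m] iff[of "2 * m"] assms(8,13,15) by auto
    qed
  qed
  then show ?thesis unfolding curve_exists_def .
qed

end
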